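(* Static quantize-map-forward is optimal and achieves the full-duplex diversity-multiplexing tradeoff in the half-duplex $(a,b,c)$-relay channel when (i) $c\ge\min(a,b)$; (ii) $c<\min(a,b)$ and $r\le c$, where $r$ is the multiplexing gain.
   Context: Channel. For $a,b,c\ge 0$, the half-duplex $(a,b,c)$-relay channel (indexed by $\rho$) has a source S, relay R, destination D, each with one antenna. The gains of the S-R, R-D, S-D links are $h_{sr}\rho^{a/2},h_{rd}\rho^{b/2},h_{sd}\rho^{c/2}$ with $h_{sr},h_{rd},h_{sd}$ i.i.d. $\mathcal{CN}(0,1)$, constant over a codeword (quasi-static fading) and independent across codewords. At times when the relay listens, $y_r=h_{sr}\rho^{a/2}x_s+z_r$ and $y_d=h_{sd}\rho^{c/2}x_s+z_d$; at times when the relay transmits, $y_r=0$ and $y_d=h_{sd}\rho^{c/2}x_s+h_{rd}\rho^{b/2}x_r+z_d$. In the full-duplex $(a,b,c)$-relay channel the relay listens and transmits simultaneously: at all times $y_r=h_{sr}\rho^{a/2}x_s+z_r$ and $y_d=h_{sd}\rho^{c/2}x_s+h_{rd}\rho^{b/2}x_r+z_d$. Noises are i.i.d. $\mathcal{CN}(0,1)$ over time and independent across nodes; $x_s,x_r$ satisfy a unit power constraint. Codeword lengths are assumed large enough that an error occurs only when the channel is in outage. Receive CSI: the source knows no channel realization; the relay knows only $h_{sr}$ (its listen/transmit schedule in the half-duplex case may be random and may depend on its receive CSI and received signals); the destination knows the realizations (the relay can communicate $h_{sr}$ to it). The parameters $a,b,c,\rho,r$ are known to all nodes. DMT. A sequence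 of codes indexed by $\rho$, with rate $R$ and average error probability $P_e$ (both depending on $\rho$), achieves multiplexing gain $r$ and diversity gain $d$ if $\lim_{\rho\to\infty}R/\log\rho=r$ and $\lim_{\rho\to\infty}\log P_e/\log\rho=-d$. The diversity-multiplexing tradeoff of a channel at $r$ is the supremum of diversity gains achievable over all families of codes with multiplexing gain $r$; a scheme is optimal if it achieves this tradeoff. Static quantize-map-forward (QMF): the relay listens during the first half of the block, quantizes its received signal at the noise level, maps it to a random codeword, and transmits that in the second half, regardless of the channel realizations. For given realizations it achieves a rate at least $C-\kappa$, where $\kappa$ is a constant independent of $\rho$ and of the realizations, and $C$ (an upper bound on the rate achievable with this schedule) is the value at $t=\frac12$ of $$\min\Big\{t\log(1+|h_{sr}|^2\rho^a+|h_{sd}|^2\rho^c)+(1-t)\log(1+|h_{sd}|^2\rho^c),\ t\log(1+|h_{sd}|^2\rho^c)+(1-t)\log\big(1+(|h_{rd}|\rho^{b/2}+|h_{sd}|\rho^{c/2})^2\big)\Big\}.$$ *)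

theory Defs
  imports "HOL-Probability.Probability"
begin

definition complex_normal :: "complex measure" where
  "complex_normal = density lborel (\<lambda>z. ennreal (exp (- (cmod z)\<^sup>2) / pi))"

datatype duplex = Half_Duplex | Full_Duplex

text \<open>
  A block code. The relay may randomise by means of a private seed in the unit interval. At time
  \<open>t\<close> it acts on the seed, on its receive channel gain \<open>h\<^sub>s\<^sub>r\<close> and on the signals it received
  at the times before \<open>t\<close>, which are given as a function that is \<open>undefined\<close> outside \<open>{..<t}\<close>.
  The decoder knows \<open>(h\<^sub>s\<^sub>r, h\<^sub>r\<^sub>d, h\<^sub>s\<^sub>d)\<close>, but not the seed.
\<close>

record relay_code =
  block_len :: nat
  num_msgs :: nat
  codebook :: "nat \<Rightarrow> nat \<Rightarrow> complex"
  listens :: "real \<Rightarrow> complex \<Rightarrow> nat \<Rightarrow> (nat \<Rightarrow> complex) \<Rightarrow> bool"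
  signal :: "real \<Rightarrow> complex \<Rightarrow> nat \<Rightarrow> (nat \<Rightarrow> complex) \<Rightarrow> complex"
  decoder :: "complex \<times> complex \<times> complex \<Rightarrow> (nat \<Rightarrow> complex) \<Rightarrow> nat"

definition unit_power_source :: "relay_code \<Rightarrow> bool" where
  "unit_power_source C \<longleftrightarrow>
    (\<forall>m<num_msgs C. (\<Sum>t<block_len C. (cmod (codebook C m t))\<^sup>2) \<le> real (block_len C))"

definition unit_power_relay :: "relay_code \<Rightarrow> bool" where
  "unit_power_relay C \<longleftrightarrow>
    (\<forall>u h y. (\<Sum>t<block_len C. (cmod (signal C u h t (restrict y {..<t})))\<^sup>2) \<le> real (block_len C))"

fun obeys_duplex :: "duplex \<Rightarrow> relay_code \<Rightarrow> bool" where
  "obeys_duplex Half_Duplex C \<longleftrightarrow>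
    (\<forall>t<block_len C. \<forall>u h y. listens C u h t (restrict y {..<t}) \<longrightarrow>
       signal C u h t (restrict y {..<t}) = 0)"
| "obeys_duplex Full_Duplex C \<longleftrightarrow>
    (\<forall>t<block_len C. \<forall>u h y. listens C u h t (restrict y {..<t}))"

definition measurable_code :: "relay_code \<Rightarrow> bool" where
  "measurable_code C \<longleftrightarrow>
    (\<forall>t<block_len C.
       (\<lambda>(u, h, y). listens C u h t y) \<in>
         borel \<Otimes>\<^sub>M borel \<Otimes>\<^sub>M PiM {..<t} (\<lambda>_. borel) \<rightarrow>\<^sub>M count_space UNIV \<and>
       (\<lambda>(u, h, y). signal C u h t y) \<in>
         borel \<Otimes>\<^sub>M borel \<Otimes>\<^sub>M PiM {..<t} (\<lambda>_. borel) \<rightarrow>\<^sub>M borel) \<and>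
    (\<lambda>(h, y). decoder C h y) \<in>
      borel \<Otimes>\<^sub>M PiM {..<block_len C} (\<lambda>_. borel) \<rightarrow>\<^sub>M count_space UNIV"

definition relay_channel_code :: "duplex \<Rightarrow> relay_code \<Rightarrow> bool" where
  "relay_channel_code D C \<longleftrightarrow>
    0 < block_len C \<and> 0 < num_msgs C \<and> unit_power_source C \<and> unit_power_relay C \<and>
    obeys_duplex D C \<and> measurable_code C"

definition rate :: "relay_code \<Rightarrow> real" where
  "rate C = ln (real (num_msgs C)) / real (block_len C)"

text \<open>
  What the relay has received before time \<open>t\<close>, when message \<open>m\<close> is sent, the seed is \<open>u\<close>, the
  gain is \<open>hsr\<close> and the noise at the relay is \<open>zr\<close>.
\<close>

primrec relay_received ::
  "real \<Rightarrow> real \<Rightarrow> relay_code \<Rightarrow> nat \<Rightarrow> real \<Rightarrow> complex \<Rightarrow> (nat \<Rightarrow> complex) \<Rightarrow> nat \<Rightarrow> (nat \<Rightarrow> complex)"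
where
  "relay_received a \<rho> C m u hsr zr 0 = (\<lambda>_. undefined)"
| "relay_received a \<rho> C m u hsr zr (Suc t) =
    (let y = relay_received a \<rho> C m u hsr zr t in
     y(t := if listens C u hsr t y
            then hsr * complex_of_real (\<rho> powr (a / 2)) * codebook C m t + zr t
            else 0))"

text \<open>
  In half-duplex mode the relay signal is 0 while the relay listens, so that one formula covers
  both phases.
\<close>

definition dest_received ::
  "real \<Rightarrow> real \<Rightarrow> real \<Rightarrow> real \<Rightarrow> relay_code \<Rightarrow> nat \<Rightarrow> real \<Rightarrow> complex \<times> complex \<times> complex \<Rightarrow>
   (nat \<Rightarrow> complex) \<Rightarrow> (nat \<Rightarrow> complex) \<Rightarrow> (nat \<Rightarrow> complex)"
where
  "dest_received a b c \<rho> C m u h zr zd = (case h of (hsr, hrd, hsd) \<Rightarrow>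
    (\<lambda>t\<in>{..<block_len C}.
       hsd * complex_of_real (\<rho> powr (c / 2)) * codebook C m t +
       hrd * complex_of_real (\<rho> powr (b / 2)) * signal C u hsr t (relay_received a \<rho> C m u hsr zr t) +
       zd t))"

text \<open>Fading gains, relay seed, and the noise at the relay and at the destination.\<close>

definition channel_space ::
  "nat \<Rightarrow> ((complex \<times> complex \<times> complex) \<times> real \<times> (nat \<Rightarrow> complex) \<times> (nat \<Rightarrow> complex)) measure"
where
  "channel_space T =
    (complex_normal \<Otimes>\<^sub>M complex_normal \<Otimes>\<^sub>M complex_normal) \<Otimes>\<^sub>M
    uniform_measure lborel {0..1} \<Otimes>\<^sub>M
    PiM {..<T} (\<lambda>_. complex_normal) \<Otimes>\<^sub>M PiM {..<T} (\<lambda>_. complex_normal)"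

definition error_prob :: "real \<Rightarrow> real \<Rightarrow> real \<Rightarrow> real \<Rightarrow> relay_code \<Rightarrow> real" where
  "error_prob a b c \<rho> C =
    (\<Sum>m<num_msgs C. measure (channel_space (block_len C))
       {(h, u, zr, zd) \<in> space (channel_space (block_len C)).
          decoder C h (dest_received a b c \<rho> C m u h zr zd) \<noteq> m}) / real (num_msgs C)"

text \<open>
  Rates are required to stay away from 0. For \<open>r > 0\<close> this follows from the limit. For \<open>r = 0\<close> it
  excludes rates that vanish as \<open>\<rho>\<close> grows, with which every diversity gain could be reached.
\<close>

definition has_multiplexing_gain :: "(real \<Rightarrow> real) \<Rightarrow> real \<Rightarrow> bool" where
  "has_multiplexing_gain R r \<longleftrightarrow>
    ((\<lambda>\<rho>. R \<rho> / ln \<rho>) \<longlongrightarrow> r) at_top \<and>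
    (\<exists>R0>0. \<forall>\<^sub>F \<rho> in at_top. R0 \<le> R \<rho>)"

text \<open>The library has \<open>ln 0 = 0\<close>; an error probability 0 must count as \<open>-\<infinity>\<close> here.\<close>

definition log_prob :: "real \<Rightarrow> ereal" where
  "log_prob p = (if p = 0 then -\<infinity> else ereal (ln p))"

definition has_diversity_gain :: "(real \<Rightarrow> real) \<Rightarrow> ereal \<Rightarrow> bool" where
  "has_diversity_gain Pe d \<longleftrightarrow> ((\<lambda>\<rho>. log_prob (Pe \<rho>) / ereal (ln \<rho>)) \<longlongrightarrow> - d) at_top"

definition achieves_gains ::
  "duplex \<Rightarrow> real \<Rightarrow> real \<Rightarrow> real \<Rightarrow> (real \<Rightarrow> relay_code) \<Rightarrow> real \<Rightarrow> ereal \<Rightarrow> bool"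
where
  "achieves_gains D a b c \<C> r d \<longleftrightarrow>
    (\<forall>\<^sub>F \<rho> in at_top. relay_channel_code D (\<C> \<rho>)) \<and>
    has_multiplexing_gain (\<lambda>\<rho>. rate (\<C> \<rho>)) r \<and>
    has_diversity_gain (\<lambda>\<rho>. error_prob a b c \<rho> (\<C> \<rho>)) d"

definition dmt :: "duplex \<Rightarrow> real \<Rightarrow> real \<Rightarrow> real \<Rightarrow> real \<Rightarrow> ereal" where
  "dmt D a b c r = Sup {d. \<exists>\<C>. achieves_gains D a b c \<C> r d}"

text \<open>Quantization at the level of the unit-variance noise: rounding to Gaussian integers.\<close>

definition quantize :: "complex \<Rightarrow> complex" where
  "quantize z = Complex (of_int (round (Re z))) (of_int (round (Im z)))"

text \<open>
  Static quantize-map-forward with half-block length \<open>n\<close>, source codebook \<open>X\<close> and relay mapping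
  \<open>F\<close> from quantized sequences to codewords.
\<close>

definition qmf_code ::
  "nat \<Rightarrow> nat \<Rightarrow> (nat \<Rightarrow> nat \<Rightarrow> complex) \<Rightarrow> ((nat \<Rightarrow> complex) \<Rightarrow> nat \<Rightarrow> complex) \<Rightarrow>
   (complex \<times> complex \<times> complex \<Rightarrow> (nat \<Rightarrow> complex) \<Rightarrow> nat) \<Rightarrow> relay_code"
where
  "qmf_code n M X F dec =
    \<lparr> block_len = 2 * n, num_msgs = M, codebook = X,
      listens = (\<lambda>u h t y. t < n),
      signal = (\<lambda>u h t y. if t < n then 0 else F (\<lambda>i\<in>{..<n}. quantize (y i)) (t - n)),
      decoder = dec \<rparr>"

text \<open>
  The random codebooks. Letters are i.i.d. uniform on the unit disc, so that the power constraints
  hold almost surely. Each quantized sequence has its own independent codeword.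
\<close>

definition random_codeword :: "nat \<Rightarrow> (nat \<Rightarrow> complex) measure" where
  "random_codeword k = PiM {..<k} (\<lambda>_. uniform_measure lborel (cball 0 1))"

definition qmf_ensemble ::
  "nat \<Rightarrow> nat \<Rightarrow> ((nat \<Rightarrow> nat \<Rightarrow> complex) \<times> ((nat \<Rightarrow> complex) \<Rightarrow> nat \<Rightarrow> complex)) measure"
where
  "qmf_ensemble n M =
    PiM {..<M} (\<lambda>_. random_codeword (2 * n)) \<Otimes>\<^sub>M
    PiM ({..<n} \<rightarrow>\<^sub>E range quantize) (\<lambda>_. random_codeword n)"

text \<open>The decoder knows both codebooks; the error probability is averaged over them.\<close>

type_synonym qmf_decoder =
  "(nat \<Rightarrow> nat \<Rightarrow> complex) \<times> ((nat \<Rightarrow> complex) \<Rightarrow> nat \<Rightarrow> complex) \<Rightarrow>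
   complex \<times> complex \<times> complex \<Rightarrow> (nat \<Rightarrow> complex) \<Rightarrow> nat"

definition measurable_qmf_decoder :: "nat \<Rightarrow> nat \<Rightarrow> qmf_decoder \<Rightarrow> bool" where
  "measurable_qmf_decoder n M dec \<longleftrightarrow>
    (\<lambda>(XF, h, y). dec XF h y) \<in>
      qmf_ensemble n M \<Otimes>\<^sub>M borel \<Otimes>\<^sub>M PiM {..<2 * n} (\<lambda>_. borel) \<rightarrow>\<^sub>M count_space UNIV"

definition qmf_error_prob ::
  "real \<Rightarrow> real \<Rightarrow> real \<Rightarrow> real \<Rightarrow> nat \<Rightarrow> nat \<Rightarrow> qmf_decoder \<Rightarrow> real"
where
  "qmf_error_prob a b c \<rho> n M dec =
    (LINT XF|qmf_ensemble n M. error_prob a b c \<rho> (qmf_code n M (fst XF) (snd XF) (dec XF)))"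

definition static_qmf_achieves :: "real \<Rightarrow> real \<Rightarrow> real \<Rightarrow> real \<Rightarrow> ereal \<Rightarrow> bool" where
  "static_qmf_achieves a b c r d \<longleftrightarrow>
    (\<exists>n M dec.
      (\<forall>\<^sub>F \<rho> in at_top. 0 < n \<rho> \<and> 0 < M \<rho> \<and> measurable_qmf_decoder (n \<rho>) (M \<rho>) (dec \<rho>)) \<and>
      has_multiplexing_gain (\<lambda>\<rho>. ln (real (M \<rho>)) / real (2 * n \<rho>)) r \<and>
      has_diversity_gain (\<lambda>\<rho>. qmf_error_prob a b c \<rho> (n \<rho>) (M \<rho>) (dec \<rho>)) d)"

end

theory Submission
  imports Defs "HOL-Real_Asymp.Real_Asymp"
begin

text \<open>
  Both tradeoffs equal the cut-set exponent \<open>(c - r)\<^sup>+ + (min a b - r)\<^sup>+\<close>, and static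
  quantize-map-forward attains it.

  Converse. Fix the fading gains and compare the law of the channel output given the message with
  a Gaussian law that does not depend on the message. The average log-likelihood ratio is at most
  \<open>T\<close> times the capacity of the cut, so by a Fano-type bound the error probability stays away from
  0 whenever the capacity of a cut is below the rate. In the cut around the source, a genie hands
  the destination the relay's noisy observations at all times; the relay signal is then a function
  of the output and can be subtracted. The gains for which a cut is that weak have probability
  at least \<open>\<rho>\<close> to the minus cut-set exponent, up to \<open>\<rho>\<^sup>\<epsilon>\<close>. None of this uses the schedule of the relay.

  Achievability. The decoder looks for a message and a quantized relay sequence that explain what
  was received, letter by letter, up to noise of size \<open>ln \<rho>\<close>, which is exceeded with superpolynomially
  small probability. For a wrong message, either the relay sequence is the true one, and the
  received signals are hit by an independent source codeword, or it is one of the few sequences close to the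
  wrong source codeword, and an independent relay codeword has to match as well. A letter received
  through the gain \<open>g\<close> falls into a given disc of radius \<open>t\<close> with probability at most
  \<open>t\<^sup>2 / \<bar>g\<bar>\<^sup>2\<close>, so the union bound decays exponentially in the block length unless one
  of the two QMF cuts is in outage. Under the hypothesis on \<open>c\<close> and \<open>r\<close>, the exponent of this
  outage event equals the cut-set exponent.
\<close>

section \<open>The complex normal distribution\<close>

text \<open>A weak converse is enough: a success probability bounded away from 1 at bad gains makes
  an error as likely as such gains, up to a constant. But it has to hold for every block length and,
  when \<open>r = 0\<close>, for as few as two messages, hence the explicit constants. Since a
  diversity gain is an exact limit, the converse is also applied to the random codes themselves and
  so has to be uniform in the code. The hypothesis on \<open>c\<close> and \<open>r\<close> reflects
  the rigid half-half schedule. Put \<open>m = min a b\<close>. The outage probability is bounded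
  with exponent \<open>c - r\<close> (weak direct link) and with exponent
  \<open>c + m - 2 * r\<close> (small product of the gains of the two links of a cut). The largest
  of these and 0 is the cut-set exponent unless \<open>c < r < m\<close>. In that gap the cut-set
  exponent is \<open>m - r\<close>, but the product only gives \<open>(m - r) - (r - c)\<close>: a
  direct link weaker than the rate wastes part of each half block.\<close>

lemma nn_integral_exp_real:
  assumes "0 < (s::real)"
  shows "(\<integral>\<^sup>+x. ennreal (exp (- s * x\<^sup>2)) \<partial>lborel) = ennreal (sqrt (pi / s))"
proof -
  define \<sigma> where "\<sigma> = sqrt (1 / (2 * s))"
  have \<sigma>: "0 < \<sigma>" "\<sigma>\<^sup>2 = 1 / (2 * s)" using assms by (auto simp: \<sigma>_def)
  have eq: "exp (- s * x\<^sup>2) = sqrt (pi / s) * normal_density 0 \<sigma> x" for x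
    using assms by (simp add: normal_density_def \<sigma>(2) field_simps real_sqrt_divide real_sqrt_mult)
  have "(\<integral>\<^sup>+x. ennreal (exp (- s * x\<^sup>2)) \<partial>lborel) =
      ennreal (sqrt (pi / s)) * (\<integral>\<^sup>+x. ennreal (normal_density 0 \<sigma> x) \<partial>lborel)"
    unfolding eq using assms by (subst nn_integral_cmult[symmetric]) (auto simp: ennreal_mult)
  also have "(\<integral>\<^sup>+x. ennreal (normal_density 0 \<sigma> x) \<partial>lborel) = 1"
    using \<sigma>(1) by (subst nn_integral_eq_integral) auto
  finally show ?thesis by simp
qed

lemma nn_integral_lborel_complex_prod:
  fixes f g :: "real \<Rightarrow> real"
  assumes [measurable]: "f \<in> borel_measurable borel" "g \<in> borel_measurable borel"
    and nn: "\<And>x. 0 \<le> f x" "\<And>x. 0 \<le> g x"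
  shows "(\<integral>\<^sup>+z. ennreal (f (Re z) * g (Im z)) \<partial>lborel) =
    (\<integral>\<^sup>+x. ennreal (f x) \<partial>lborel) * (\<integral>\<^sup>+x. ennreal (g x) \<partial>lborel)"
proof -
  \<comment> \<open>\<open>Basis\<close> consists of 1 and the imaginary unit, so this selector puts
    \<open>f\<close> on the real and \<open>g\<close> on the imaginary coordinate.\<close>
  let ?F = "\<lambda>b::complex. if b = 1 then f else g"
  have "(\<integral>\<^sup>+z. (\<Prod>b\<in>Basis. ennreal (?F b (z \<bullet> b))) \<partial>(lborel::complex measure)) =
      (\<Prod>b\<in>Basis. (\<integral>\<^sup>+x. ennreal (?F b x) \<partial>lborel))"
    using nn by (intro nn_integral_lborel_prod) auto
  then show ?thesis
    using nn by (simp add: Basis_complex_def inner_complex_def ennreal_mult)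
qed

text \<open>General \<open>s\<close> serves twice: \<open>s = 1\<close> normalises the density,
  \<open>s = 1/2\<close> gives the tail bound.\<close>

lemma nn_integral_exp_cmod:
  assumes "0 < (s::real)"
  shows "(\<integral>\<^sup>+z. ennreal (exp (- s * (cmod z)\<^sup>2)) \<partial>lborel) = ennreal (pi / s)"
proof -
  have "(\<integral>\<^sup>+z. ennreal (exp (- s * (cmod z)\<^sup>2)) \<partial>lborel) =
      (\<integral>\<^sup>+z. ennreal (exp (- s * (Re z)\<^sup>2) * exp (- s * (Im z)\<^sup>2)) \<partial>lborel)"
    by (simp add: cmod_power2 ring_distribs flip: exp_add)
  also have "\<dots> = ennreal (pi / s)"
    using assms by (subst nn_integral_lborel_complex_prod)
      (auto simp: nn_integral_exp_real[simplified] simp flip: ennreal_mult)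
  finally show ?thesis .
qed

lemma sets_complex_normal [simp, measurable_cong]: "sets complex_normal = sets borel"
  and space_complex_normal [simp]: "space complex_normal = UNIV"
  by (simp_all add: complex_normal_def)

lemma nn_integral_complex_normal:
  assumes [measurable]: "f \<in> borel_measurable borel"
  shows "(\<integral>\<^sup>+z. f z \<partial>complex_normal) = (\<integral>\<^sup>+z. ennreal (exp (- (cmod z)\<^sup>2) / pi) * f z \<partial>lborel)"
  unfolding complex_normal_def by (subst nn_integral_density) auto

lemma emeasure_complex_normal_UNIV: "emeasure complex_normal UNIV = 1"
proof -
  have "emeasure complex_normal UNIV = (\<integral>\<^sup>+z. ennreal (exp (- (cmod z)\<^sup>2) / pi) \<partial>lborel)"
    unfolding complex_normal_def by (subst emeasure_density) auto
  also have "\<dots> = (\<integral>\<^sup>+z. ennreal (1 / pi) * ennreal (exp (- 1 * (cmod z)\<^sup>2)) \<partial>lborel)"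
    by (subst ennreal_mult[symmetric]) auto
  also have "\<dots> = 1"
    by (subst nn_integral_cmult) (simp_all add: nn_integral_exp_cmod[of 1, simplified] flip: ennreal_mult)
  finally show ?thesis .
qed

lemma prob_space_complex_normal: "prob_space complex_normal"
  by (rule prob_spaceI) (simp add: emeasure_complex_normal_UNIV)

interpretation CN: prob_space complex_normal
  by (rule prob_space_complex_normal)

lemma emeasure_cball_complex: "0 \<le> r \<Longrightarrow> emeasure lborel (cball (c::complex) r) = ennreal (pi * r\<^sup>2)"
  by (simp add: emeasure_cball unit_ball_vol_numeral eval_unit_ball_vol)

lemma cball_sqrt: "0 \<le> x \<Longrightarrow> {z. (cmod z)\<^sup>2 \<le> x} = cball 0 (sqrt x)"
  by (auto simp: real_le_rsqrt  real_sqrt_le_iff) (metis norm_ge_zero real_sqrt_le_iff real_sqrt_power real_sqrt_unique)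

text \<open>The density is at most \<open>1 / pi\<close> and the disc has area
  \<open>pi * x\<close>. With the lower bound that follows, a fading power falls below
  \<open>x\<close> with probability of order \<open>x\<close>; this is all that the exponents see of
  the fading law.\<close>

lemma complex_normal_small_le:
  assumes "0 \<le> x"
  shows "measure complex_normal {z. (cmod z)\<^sup>2 \<le> x} \<le> x"
proof -
  have "emeasure complex_normal {z. (cmod z)\<^sup>2 \<le> x} = emeasure complex_normal (cball 0 (sqrt x))"
    using assms by (simp add: cball_sqrt)
  also have "\<dots> = (\<integral>\<^sup>+z. ennreal (exp (- (cmod z)\<^sup>2) / pi) * indicator (cball 0 (sqrt x)) z \<partial>lborel)"
    unfolding complex_normal_def by (subst emeasure_density) auto
  also have "\<dots> \<le> (\<integral>\<^sup>+z. ennreal (1 / pi) * indicator (cball 0 (sqrt x)) z \<partial>(lborel::complex measure))"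
    by (intro nn_integral_mono) (auto split: split_indicator intro!: ennreal_leI divide_right_mono)
  also have "\<dots> = ennreal x"
    using assms by (subst nn_integral_cmult_indicator) (auto simp: emeasure_cball_complex simp flip: ennreal_mult)
  finally show ?thesis using assms by (simp add: CN.emeasure_eq_measure)
qed

text \<open>On the unit disc the density is at least \<open>exp (- 1) / pi\<close>, so the part of
  the event inside that disc suffices; this explains the \<open>min\<close>.\<close>

lemma complex_normal_small_ge:
  assumes "0 \<le> x"
  shows "min 1 x / exp 1 \<le> measure complex_normal {z. (cmod z)\<^sup>2 \<le> x}"
proof -
  define y where "y = min 1 x"
  have y: "0 \<le> y" "y \<le> 1" "y \<le> x" using assms by (auto simp: y_def)
  have "ennreal (y / exp 1) = (\<integral>\<^sup>+z. ennreal (exp (- 1) / pi) * indicator (cball 0 (sqrt y)) z \<partial>(lborel::complex measure))"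
    using y by (subst nn_integral_cmult_indicator)
      (auto simp: emeasure_cball_complex exp_minus field_simps simp flip: ennreal_mult)
  also have "\<dots> \<le> (\<integral>\<^sup>+z. ennreal (exp (- (cmod z)\<^sup>2) / pi) * indicator (cball 0 (sqrt y)) z \<partial>lborel)"
    using y by (intro nn_integral_mono) (auto split: split_indicator intro!: ennreal_leI divide_right_mono
      simp: cball_sqrt[symmetric] simp del: mem_cball)
  also have "\<dots> = emeasure complex_normal (cball 0 (sqrt y))"
    unfolding complex_normal_def by (subst emeasure_density) auto
  also have "\<dots> \<le> emeasure complex_normal {z. (cmod z)\<^sup>2 \<le> x}"
    using y by (intro emeasure_mono) (auto simp: cball_sqrt[symmetric] simp del: mem_cball)
  finally show ?thesis unfolding y_def[symmetric] by (simp add: CN.emeasure_eq_measure)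
qed

text \<open>The exponent is split in half. One half is bounded by its value at \<open>t\<close>, the
  other integrates to \<open>2 * pi\<close> and leaves the factor 2.\<close>

lemma complex_normal_tail:
  assumes "0 \<le> (t::real)"
  shows "measure complex_normal {z. t < cmod z} \<le> 2 * exp (- t\<^sup>2 / 2)"
proof -
  have "emeasure complex_normal {z. t < cmod z} =
      (\<integral>\<^sup>+z. ennreal (exp (- (cmod z)\<^sup>2) / pi) * indicator {z. t < cmod z} z \<partial>lborel)"
    unfolding complex_normal_def by (subst emeasure_density) auto
  also have "\<dots> \<le> (\<integral>\<^sup>+z. ennreal (exp (- t\<^sup>2 / 2) / pi) * ennreal (exp (- (1/2) * (cmod z)\<^sup>2)) \<partial>lborel)"
  proof (rule nn_integral_mono)
    fix z :: complex
    have "exp (- (cmod z)\<^sup>2) \<le> exp (- t\<^sup>2 / 2) * exp (- (1/2) * (cmod z)\<^sup>2)" if "t < cmod z"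
    proof -
      have "t\<^sup>2 \<le> (cmod z)\<^sup>2" using that assms by (intro power_mono) auto
      then show ?thesis by (simp flip: exp_add)
    qed
    then show "ennreal (exp (- (cmod z)\<^sup>2) / pi) * indicator {z. t < cmod z} z
        \<le> ennreal (exp (- t\<^sup>2 / 2) / pi) * ennreal (exp (- (1/2) * (cmod z)\<^sup>2))"
      by (auto split: split_indicator simp flip: ennreal_mult intro!: ennreal_leI divide_right_mono)
  qed
  also have "\<dots> = ennreal (2 * exp (- t\<^sup>2 / 2))"
    by (subst nn_integral_cmult)
      (simp_all add: nn_integral_exp_cmod[of "1/2", simplified] mult.commute flip: ennreal_mult)
  finally show ?thesis by (simp add: CN.emeasure_eq_measure)
qed

text \<open>By this symmetry the integral of a linear functional equals its own negative, so the
  mean vanishes.\<close>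

lemma distr_complex_normal_uminus: "distr complex_normal borel uminus = complex_normal"
proof (rule measure_eqI)
  fix A assume "A \<in> sets (distr complex_normal borel uminus)"
  then have [measurable]: "A \<in> sets borel" by simp
  have "emeasure (distr complex_normal borel uminus) A = (\<integral>\<^sup>+z. indicator A (- z) \<partial>complex_normal)"
    by (subst nn_integral_indicator[symmetric]) (auto simp: nn_integral_distr simp del: nn_integral_indicator)
  also have "\<dots> = (\<integral>\<^sup>+z. ennreal (exp (- (cmod z)\<^sup>2) / pi) * indicator A (- z) \<partial>lborel)"
    by (subst nn_integral_complex_normal) auto
  also have "\<dots> = (\<integral>\<^sup>+z. ennreal (exp (- (cmod z)\<^sup>2) / pi) * indicator A z \<partial>lborel)"
    by (subst (2) lborel_affine[of "-1" "0::complex"])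
      (auto simp: nn_integral_density nn_integral_distr)
  also have "\<dots> = emeasure complex_normal A"
    unfolding complex_normal_def by (subst emeasure_density) auto
  finally show "emeasure (distr complex_normal borel uminus) A = emeasure complex_normal A" .
qed simp

text \<open>The weight is \<open>sqrt pi\<close> times the normal density of variance 1/2.\<close>

lemma nn_integral_sq_mult_exp:
  "(\<integral>\<^sup>+x. ennreal (x\<^sup>2 * exp (- x\<^sup>2)) \<partial>lborel) = ennreal (sqrt pi / 2)"
proof -
  define \<sigma> :: real where "\<sigma> = sqrt (1/2)"
  have \<sigma>: "0 < \<sigma>" "\<sigma>\<^sup>2 = 1/2" by (auto simp: \<sigma>_def)
  have "has_bochner_integral lborel (\<lambda>x. normal_density 0 \<sigma> x * (x - 0) ^ (2 * 1)) (fact (2 * 1) / ((2 / \<sigma>\<^sup>2) ^ 1 * fact 1))"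
    by (rule normal_moment_even) (use \<sigma> in auto)
  then have hb: "has_bochner_integral lborel (\<lambda>x. normal_density 0 \<sigma> x * x\<^sup>2) (1/2)"
    by (simp only: \<sigma>(2)) (simp add: power2_eq_square)
  have eq: "x\<^sup>2 * exp (- x\<^sup>2) = sqrt pi * (normal_density 0 \<sigma> x * x\<^sup>2)" for x
    by (simp add: normal_density_def \<sigma>(2) real_sqrt_divide)
  have "(\<integral>\<^sup>+x. ennreal (x\<^sup>2 * exp (- x\<^sup>2)) \<partial>lborel) =
    ennreal (\<integral>x. sqrt pi * (normal_density 0 \<sigma> x * x\<^sup>2) \<partial>lborel)"
    unfolding eq using hb by (intro nn_integral_eq_integral) (auto simp: has_bochner_integral_iff)
  also have "\<dots> = ennreal (sqrt pi / 2)"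
    using hb by (simp add: has_bochner_integral_iff)
  finally show ?thesis .
qed

text \<open>Real and imaginary part contribute 1/2 each, which is the normalisation to unit noise
  power.\<close>

lemma nn_integral_complex_normal_cmod_sq:
  "(\<integral>\<^sup>+z. ennreal ((cmod z)\<^sup>2) \<partial>complex_normal) = 1"
proof -
  have "(\<integral>\<^sup>+z. ennreal ((cmod z)\<^sup>2) \<partial>complex_normal) =
      (\<integral>\<^sup>+z. (ennreal (1 / pi) * ennreal (((Re z)\<^sup>2 * exp (- (Re z)\<^sup>2)) * exp (- (Im z)\<^sup>2))
        + ennreal (1 / pi) * ennreal (exp (- (Re z)\<^sup>2) * ((Im z)\<^sup>2 * exp (- (Im z)\<^sup>2)))) \<partial>lborel)"
    by (subst nn_integral_complex_normal)
      (auto intro!: nn_integral_cong simp: cmod_power2 field_simps exp_diff exp_minus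
         simp flip: ennreal_mult ennreal_plus)
  also have "\<dots> = ennreal (1 / pi) * (ennreal (sqrt pi / 2) * ennreal (sqrt pi)) +
      ennreal (1 / pi) * (ennreal (sqrt pi) * ennreal (sqrt pi / 2))"
    by (subst nn_integral_add, simp, simp, (subst nn_integral_cmult, simp)+,
        (subst nn_integral_lborel_complex_prod, simp, simp, simp, simp)+)
      (simp add: nn_integral_sq_mult_exp nn_integral_exp_real[of 1, simplified])
  also have "\<dots> = ennreal (1 / pi * (sqrt pi / 2 * sqrt pi) + 1 / pi * (sqrt pi * (sqrt pi / 2)))"
    by (simp only: ennreal_mult[symmetric] ennreal_plus[symmetric] mult_nonneg_nonneg divide_nonneg_nonneg
      zero_le_one pi_ge_zero real_sqrt_ge_zero zero_le_numeral order_refl)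
  also have "\<dots> = 1"
    by (simp add: field_simps)
  finally show ?thesis .
qed

lemma complex_normal_cmod_sq:
  "has_bochner_integral complex_normal (\<lambda>z. (cmod z)\<^sup>2) 1"
  by (rule has_bochner_integral_nn_integral) (simp_all add: nn_integral_complex_normal_cmod_sq)

lemma integrable_complex_normal_linear:
  "integrable complex_normal (\<lambda>z. Re (w * z))"
proof (rule Bochner_Integration.integrable_bound)
  show "integrable complex_normal (\<lambda>z. (cmod w)\<^sup>2 + (cmod z)\<^sup>2)"
    using complex_normal_cmod_sq by (auto simp: has_bochner_integral_iff)
  show "AE z in complex_normal. norm (Re (w * z)) \<le> norm ((cmod w)\<^sup>2 + (cmod z)\<^sup>2)"
  proof (rule AE_I2)
    fix z
    have "\<bar>Re (w * z)\<bar> \<le> cmod w * cmod z" by (metis abs_Re_le_cmod norm_mult)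
    also have "\<dots> \<le> (cmod w)\<^sup>2 + (cmod z)\<^sup>2"
      using sum_squares_bound[of "cmod w" "cmod z", unfolded mult.assoc]
        mult_nonneg_nonneg[OF norm_ge_zero[of w] norm_ge_zero[of z]] by linarith
    finally show "norm (Re (w * z)) \<le> norm ((cmod w)\<^sup>2 + (cmod z)\<^sup>2)" by simp
  qed
qed simp

lemma integral_complex_normal_linear: "(LINT z|complex_normal. Re (w * z)) = 0"
proof -
  have "(LINT z|complex_normal. Re (w * z)) = (LINT z|distr complex_normal borel uminus. Re (w * z))"
    by (simp add: distr_complex_normal_uminus)
  also have "\<dots> = - (LINT z|complex_normal. Re (w * z))"
    by (subst integral_distr) (simp_all only: mult_minus_right uminus_complex.sel Bochner_Integration.integral_minus, simp_all)
  finally show ?thesis by simp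
qed

lemma has_bochner_integral_const_CN: "has_bochner_integral complex_normal (\<lambda>_. c) (c::real)"
  unfolding has_bochner_integral_iff using CN.prob_space by (simp del: space_complex_normal)

text \<open>Pythagoras: the cross term is linear in \<open>z\<close> and has mean 0.\<close>

lemma complex_normal_cmod_sq_affine:
  "has_bochner_integral complex_normal (\<lambda>z. (cmod (\<mu> + \<beta> * z))\<^sup>2) ((cmod \<mu>)\<^sup>2 + (cmod \<beta>)\<^sup>2)"
proof -
  have eq: "(cmod (\<mu> + \<beta> * z))\<^sup>2 = (cmod \<mu>)\<^sup>2 + 2 * Re ((cnj \<mu> * \<beta>) * z) + (cmod \<beta>)\<^sup>2 * (cmod z)\<^sup>2" for z
    unfolding cmod_power2 by (simp add: power2_eq_square algebra_simps)
  have "has_bochner_integral complex_normal (\<lambda>z. Re ((cnj \<mu> * \<beta>) * z)) 0"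
    unfolding has_bochner_integral_iff
    using integrable_complex_normal_linear integral_complex_normal_linear by blast
  from has_bochner_integral_add[OF has_bochner_integral_add[OF has_bochner_integral_const_CN[of "(cmod \<mu>)\<^sup>2"]
      has_bochner_integral_mult_right[OF this, of 2]] has_bochner_integral_mult_right[OF complex_normal_cmod_sq, of "(cmod \<beta>)\<^sup>2"]]
  show ?thesis unfolding eq by simp
qed

section \<open>Change of measure and a Fano-type bound\<close>

text \<open>
  \<open>W m\<close> is the inverse likelihood ratio between the law of the output given \<open>m\<close> and a fixed
  reference law, and \<open>A m\<close> is the event of correct decoding. The proof integrates
  \<open>1 + v \<le> exp v\<close> for \<open>v = s 1\<^bsub>A m\<^esub> + ln (W m) - ln 2\<close> with \<open>exp s = M + 1\<close>.
\<close>

lemma fano_bound: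
  fixes P :: "'a measure" and A :: "nat \<Rightarrow> 'a set" and W :: "nat \<Rightarrow> 'a \<Rightarrow> real"
  assumes "prob_space P" and M: "0 < M"
    and A [measurable]: "\<And>m. m < M \<Longrightarrow> A m \<in> sets P"
    and W [measurable]: "\<And>m. m < M \<Longrightarrow> W m \<in> borel_measurable P"
    and pos: "\<And>m x. m < M \<Longrightarrow> 0 < W m x"
    and tot: "\<And>m. m < M \<Longrightarrow> (\<integral>\<^sup>+x. ennreal (W m x) \<partial>P) \<le> 1"
    and corr: "(\<Sum>m<M. \<integral>\<^sup>+x. ennreal (W m x) * indicator (A m) x \<partial>P) \<le> 1"
    and int: "\<And>m. m < M \<Longrightarrow> integrable P (\<lambda>x. ln (W m x))"
    and D: "\<And>m. m < M \<Longrightarrow> - (LINT x|P. ln (W m x)) \<le> D"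
  shows "(\<Sum>m<M. measure P (A m)) / real M \<le> (D + ln 2) / ln (real M + 1)"
proof -
  interpret prob_space P by fact
  define s where "s = ln (real M + 1)"
  have s: "0 < s" "exp s = real M + 1" using M by (auto simp: s_def)
  have intW: "integrable P (W m)" and intWA: "integrable P (\<lambda>x. W m x * indicator (A m) x)"
    and W1: "(LINT x|P. W m x) \<le> 1"
    and WA: "ennreal (LINT x|P. W m x * indicator (A m) x) = (\<integral>\<^sup>+x. ennreal (W m x) * indicator (A m) x \<partial>P)"
    if m: "m < M" for m
  proof -
    note [measurable] = A[OF m] W[OF m]
    have "(\<integral>\<^sup>+x. ennreal (W m x) \<partial>P) < \<infinity>"
      using tot[OF m] by (rule order.strict_trans1) simp
    then show i: "integrable P (W m)"
      using pos[OF m] by (intro integrableI_nonneg) (auto intro: less_imp_le)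
    show i2: "integrable P (\<lambda>x. W m x * indicator (A m) x)"
      using integrable_real_mult_indicator[OF A[OF m] i] by (simp add: mult.commute)
    have "ennreal (LINT x|P. W m x) \<le> 1"
      using tot[OF m] pos[OF m] i by (subst nn_integral_eq_integral[symmetric]) (auto intro: less_imp_le)
    then show "(LINT x|P. W m x) \<le> 1" by simp
    show "ennreal (LINT x|P. W m x * indicator (A m) x) = (\<integral>\<^sup>+x. ennreal (W m x) * indicator (A m) x \<partial>P)"
      using pos[OF m] i2 by (subst nn_integral_eq_integral[symmetric])
        (auto intro!: nn_integral_cong mult_nonneg_nonneg split: split_indicator intro: less_imp_le)
  qed
  have WAs: "(\<Sum>m<M. LINT x|P. W m x * indicator (A m) x) \<le> 1"
  proof -
    have "ennreal (\<Sum>m<M. LINT x|P. W m x * indicator (A m) x) =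
        (\<Sum>m<M. ennreal (LINT x|P. W m x * indicator (A m) x))"
      using pos by (intro sum_ennreal[symmetric] Bochner_Integration.integral_nonneg) (auto split: split_indicator intro: less_imp_le)
    also have "\<dots> \<le> 1" using corr by (simp add: WA)
    finally show ?thesis by simp
  qed
  \<comment> \<open>With this \<open>s\<close> the exponential equals \<open>W m / 2\<close>, plus
    \<open>real M / 2 * W m\<close> on \<open>A m\<close>. Summed over \<open>m\<close>, these two
    parts are bounded by \<open>real M / 2\<close> each, through \<open>tot\<close> and
    \<open>corr\<close>.\<close>
  have key: "1 + s * prob (A m) - D - ln 2 \<le> 1/2 + real M / 2 * (LINT x|P. W m x * indicator (A m) x)"
    if m: "m < M" for m
  proof -
    note [measurable] = A[OF m] W[OF m]
    have "(LINT x|P. 1 + s * indicator (A m) x + ln (W m x) - ln 2)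
        \<le> (LINT x|P. 1/2 * W m x + real M / 2 * (W m x * indicator (A m) x))"
    proof (rule integral_mono)
      show "integrable P (\<lambda>x. 1 + s * indicator (A m) x + ln (W m x) - ln 2)"
        using int[OF m] by (intro Bochner_Integration.integrable_add Bochner_Integration.integrable_diff integrable_mult_right integrable_real_indicator) (auto simp: emeasure_eq_measure)
      show "integrable P (\<lambda>x. 1/2 * W m x + real M / 2 * (W m x * indicator (A m) x))"
        using intW[OF m] intWA[OF m] by simp
      fix x
      have "1 + (s * indicator (A m) x + ln (W m x) - ln 2) \<le> exp (s * indicator (A m) x + ln (W m x) - ln 2)"
        by (rule exp_ge_add_one_self)
      also have "\<dots> = 1/2 * W m x + real M / 2 * (W m x * indicator (A m) x)"
        using pos[OF m, of x] s by (auto simp: exp_add exp_diff field_simps split: split_indicator)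
      finally show "1 + s * indicator (A m) x + ln (W m x) - ln 2 \<le> 1/2 * W m x + real M / 2 * (W m x * indicator (A m) x)"
        by simp
    qed
    moreover have "(LINT x|P. 1 + s * indicator (A m) x + ln (W m x) - ln 2) =
        1 + s * prob (A m) + (LINT x|P. ln (W m x)) - ln 2"
      using int[OF m] A[OF m] by (simp add: prob_space integrable_real_indicator emeasure_eq_measure)
    moreover have "(LINT x|P. 1/2 * W m x + real M / 2 * (W m x * indicator (A m) x)) =
        1/2 * (LINT x|P. W m x) + real M / 2 * (LINT x|P. W m x * indicator (A m) x)"
      using intW[OF m] intWA[OF m] by simp
    ultimately show ?thesis using D[OF m] W1[OF m] by linarith
  qed
  have "(\<Sum>m<M. 1 + s * prob (A m) - D - ln 2) \<le> (\<Sum>m<M. 1/2 + real M / 2 * (LINT x|P. W m x * indicator (A m) x))"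
    by (intro sum_mono key) auto
  then have "real M * (1 - D - ln 2) + s * (\<Sum>m<M. prob (A m)) \<le> real M / 2 + real M / 2 * (\<Sum>m<M. LINT x|P. W m x * indicator (A m) x)"
    by (simp add: sum.distrib sum_subtractf sum_distrib_left algebra_simps)
  also have "\<dots> \<le> real M / 2 + real M / 2 * 1"
    using WAs by (intro add_left_mono mult_left_mono) auto
  finally have "s * (\<Sum>m<M. prob (A m)) \<le> real M * (D + ln 2)"
    by (simp add: algebra_simps)
  then show ?thesis
    unfolding s_def[symmetric] using M s(1) by (simp add: field_simps)
qed

text \<open>The weight divides the density with mean \<open>\<nu>\<close> and variance
  \<open>v\<close> at \<open>z + \<mu>\<close> by the standard density at \<open>z\<close>. It turns
  the law of the received letter \<open>z + \<mu>\<close> into a reference law in which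
  \<open>\<mu>\<close> no longer occurs.\<close>

lemma nn_integral_complex_normal_shift:
  fixes g :: "complex \<Rightarrow> ennreal"
  assumes [measurable]: "g \<in> borel_measurable borel" and v: "0 < v"
  shows "(\<integral>\<^sup>+z. g (z + \<mu>) * ennreal (exp ((cmod z)\<^sup>2 - (cmod (z + \<mu> - \<nu>))\<^sup>2 / v) / v) \<partial>complex_normal) =
    (\<integral>\<^sup>+y. g (complex_of_real (sqrt v) * y + \<nu>) \<partial>complex_normal)"
proof -
  have "(\<integral>\<^sup>+z. g (z + \<mu>) * ennreal (exp ((cmod z)\<^sup>2 - (cmod (z + \<mu> - \<nu>))\<^sup>2 / v) / v) \<partial>complex_normal) =
      (\<integral>\<^sup>+z. g (z + \<mu>) * ennreal (exp (- (cmod (z + \<mu> - \<nu>))\<^sup>2 / v) / (pi * v)) \<partial>lborel)"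
  proof (subst nn_integral_complex_normal, measurable, intro nn_integral_cong)
    fix z
    have "exp (- (cmod z)\<^sup>2) / pi * (exp ((cmod z)\<^sup>2 - (cmod (z + \<mu> - \<nu>))\<^sup>2 / v) / v) =
        exp (- (cmod (z + \<mu> - \<nu>))\<^sup>2 / v) / (pi * v)"
      by (simp flip: exp_add)
    then show "ennreal (exp (- (cmod z)\<^sup>2) / pi) * (g (z + \<mu>) * ennreal (exp ((cmod z)\<^sup>2 - (cmod (z + \<mu> - \<nu>))\<^sup>2 / v) / v)) =
        g (z + \<mu>) * ennreal (exp (- (cmod (z + \<mu> - \<nu>))\<^sup>2 / v) / (pi * v))"
      using v by (simp only: mult.left_commute[of "ennreal (exp (- (cmod z)\<^sup>2) / pi)"]) (simp flip: ennreal_mult)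
  qed
  also have "\<dots> = (\<integral>\<^sup>+z. g z * ennreal (exp (- (cmod (z - \<nu>))\<^sup>2 / v) / (pi * v)) \<partial>lborel)"
    by (subst (2) lborel_distr_plus[of \<mu>, symmetric])
      (auto simp: nn_integral_distr add.commute)
  \<comment> \<open>Substitution of \<open>\<nu> + sqrt v *\<^sub>R y\<close>. The plane has real
    dimension 2, so the Jacobian of the scaling is \<open>(sqrt v)\<^sup>2 = v\<close>.\<close>
  also have "\<dots> = (\<integral>\<^sup>+y. ennreal v * (g (\<nu> + sqrt v *\<^sub>R y) * ennreal (exp (- (cmod (sqrt v *\<^sub>R y))\<^sup>2 / v) / (pi * v))) \<partial>lborel)"
    using v by (subst lborel_affine[of "sqrt v" \<nu>])
      (auto simp: nn_integral_density nn_integral_distr)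
  also have "\<dots> = (\<integral>\<^sup>+y. g (complex_of_real (sqrt v) * y + \<nu>) \<partial>complex_normal)"
  proof (subst nn_integral_complex_normal, measurable, intro nn_integral_cong)
    fix y :: complex
    have "v * (exp (- (cmod (sqrt v *\<^sub>R y))\<^sup>2 / v) / (pi * v)) = exp (- (cmod y)\<^sup>2) / pi"
      using v by (simp add: power_mult_distrib)
    then show "ennreal v * (g (\<nu> + sqrt v *\<^sub>R y) * ennreal (exp (- (cmod (sqrt v *\<^sub>R y))\<^sup>2 / v) / (pi * v))) =
        ennreal (exp (- (cmod y)\<^sup>2) / pi) * g (complex_of_real (sqrt v) * y + \<nu>)"
      using v by (simp only: mult.left_commute[of "ennreal v"] scaleR_conv_of_real add.commute[of \<nu>])
        (simp add: mult.commute flip: ennreal_mult)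
  qed
  finally show ?thesis .
qed

interpretation CNP: product_sigma_finite "\<lambda>_::'i. complex_normal"
  by (rule product_sigma_finite.intro) (rule CN.sigma_finite_measure_axioms)

text \<open>Density at \<open>z\<close> of the law of variance \<open>v\<close> centred at \<open>- \<delta>\<close>, relative to \<^const>\<open>complex_normal\<close>.\<close>

definition shift_weight :: "real \<Rightarrow> complex \<Rightarrow> complex \<Rightarrow> real" where
  "shift_weight v \<delta> z = exp ((cmod z)\<^sup>2 - (cmod (z + \<delta>))\<^sup>2 / v) / v"

text \<open>Letter by letter, one substitution at a time. \<open>g\<close> is generalised because
  integrating out the new letter changes it. The means \<open>\<nu> i\<close> stay free because the
  reference law of the second output is centred at a multiple of the first.\<close>

lemma nn_integral_PiM_complex_normal_shift:
  fixes g :: "('i \<Rightarrow> complex) \<Rightarrow> ennreal"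
  assumes "finite I" and "g \<in> borel_measurable (PiM I (\<lambda>_. borel))" and v: "0 < v"
  shows "(\<integral>\<^sup>+z. g (\<lambda>i\<in>I. z i + \<mu> i) * ennreal (\<Prod>i\<in>I. shift_weight v (\<mu> i - \<nu> i) (z i)) \<partial>PiM I (\<lambda>_. complex_normal)) =
    (\<integral>\<^sup>+y. g (\<lambda>i\<in>I. complex_of_real (sqrt v) * y i + \<nu> i) \<partial>PiM I (\<lambda>_. complex_normal))"
  using assms(1,2)
proof (induction I arbitrary: g)
  case empty
  then show ?case by (simp add: PiM_empty nn_integral_count_space_finite)
next
  case (insert i I)
  note [measurable] = insert.prems
  have [measurable]: "(\<lambda>z. shift_weight v \<delta> z) \<in> borel_measurable borel" for \<delta>
    unfolding shift_weight_def by measurable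
  have w0: "0 \<le> shift_weight v \<delta> z" for \<delta> z using v by (simp add: shift_weight_def)
  have r: "(\<lambda>j\<in>insert i I. (x(i := y)) j + a j) = (\<lambda>j\<in>I. x j + a j)(i := y + a i)"
      "(\<lambda>j\<in>insert i I. c * (x(i := y)) j + a j) = (\<lambda>j\<in>I. c * x j + a j)(i := c * y + a i)" for x y a and c :: complex
    using insert.hyps by auto
  have P: "(\<Prod>j\<in>insert i I. shift_weight v (\<mu> j - \<nu> j) ((x(i := y)) j)) =
    shift_weight v (\<mu> i - \<nu> i) y * (\<Prod>j\<in>I. shift_weight v (\<mu> j - \<nu> j) (x j))" for x y
    using insert.hyps by (subst prod.insert) (auto intro!: arg_cong2[where f="(*)"] prod.cong)
  have "(\<integral>\<^sup>+z. g (\<lambda>i\<in>insert i I. z i + \<mu> i) * ennreal (\<Prod>i\<in>insert i I. shift_weight v (\<mu> i - \<nu> i) (z i)) \<partial>PiM (insert i I) (\<lambda>_. complex_normal)) =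
      (\<integral>\<^sup>+x. (\<integral>\<^sup>+y. g ((\<lambda>j\<in>I. x j + \<mu> j)(i := y + \<mu> i)) *
        ennreal (shift_weight v (\<mu> i - \<nu> i) y * (\<Prod>j\<in>I. shift_weight v (\<mu> j - \<nu> j) (x j))) \<partial>complex_normal) \<partial>PiM I (\<lambda>_. complex_normal))"
    unfolding P[symmetric] r[symmetric]
    by (rule CNP.product_nn_integral_insert) (use insert.hyps in auto)
  also have "\<dots> = (\<integral>\<^sup>+x. (\<integral>\<^sup>+y. g ((\<lambda>j\<in>I. x j + \<mu> j)(i := sqrt v * y + \<nu> i)) \<partial>complex_normal) *
        ennreal (\<Prod>j\<in>I. shift_weight v (\<mu> j - \<nu> j) (x j)) \<partial>PiM I (\<lambda>_. complex_normal))"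
  proof (intro nn_integral_cong)
    fix x :: "'i \<Rightarrow> complex"
    have [measurable]: "(\<lambda>y. g ((\<lambda>j\<in>I. x j + \<mu> j)(i := y))) \<in> borel_measurable borel"
      by measurable
    have "(\<integral>\<^sup>+y. g ((\<lambda>j\<in>I. x j + \<mu> j)(i := y + \<mu> i)) *
        ennreal (shift_weight v (\<mu> i - \<nu> i) y * (\<Prod>j\<in>I. shift_weight v (\<mu> j - \<nu> j) (x j))) \<partial>complex_normal) =
      (\<integral>\<^sup>+y. g ((\<lambda>j\<in>I. x j + \<mu> j)(i := y + \<mu> i)) * ennreal (shift_weight v (\<mu> i - \<nu> i) y) * ennreal (\<Prod>j\<in>I. shift_weight v (\<mu> j - \<nu> j) (x j)) \<partial>complex_normal)"
      using w0 by (simp add: ennreal_mult prod_nonneg mult.assoc)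
    also have "\<dots> = (\<integral>\<^sup>+y. g ((\<lambda>j\<in>I. x j + \<mu> j)(i := y + \<mu> i)) * ennreal (shift_weight v (\<mu> i - \<nu> i) y) \<partial>complex_normal) * ennreal (\<Prod>j\<in>I. shift_weight v (\<mu> j - \<nu> j) (x j))"
      by (rule nn_integral_multc) measurable
    also have "(\<integral>\<^sup>+y. g ((\<lambda>j\<in>I. x j + \<mu> j)(i := y + \<mu> i)) * ennreal (shift_weight v (\<mu> i - \<nu> i) y) \<partial>complex_normal) =
       (\<integral>\<^sup>+y. g ((\<lambda>j\<in>I. x j + \<mu> j)(i := sqrt v * y + \<nu> i)) \<partial>complex_normal)"
      unfolding shift_weight_def
      using nn_integral_complex_normal_shift[of "\<lambda>y. g ((\<lambda>j\<in>I. x j + \<mu> j)(i := y))" v "\<mu> i" "\<nu> i"] v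
      by (simp add: add_diff_eq)
    finally show "(\<integral>\<^sup>+y. g ((\<lambda>j\<in>I. x j + \<mu> j)(i := y + \<mu> i)) *
        ennreal (shift_weight v (\<mu> i - \<nu> i) y * (\<Prod>j\<in>I. shift_weight v (\<mu> j - \<nu> j) (x j))) \<partial>complex_normal) =
      (\<integral>\<^sup>+y. g ((\<lambda>j\<in>I. x j + \<mu> j)(i := sqrt v * y + \<nu> i)) \<partial>complex_normal) * ennreal (\<Prod>j\<in>I. shift_weight v (\<mu> j - \<nu> j) (x j))" .
  qed
  also have "\<dots> = (\<integral>\<^sup>+x. (\<integral>\<^sup>+y. g ((\<lambda>j\<in>I. sqrt v * x j + \<nu> j)(i := sqrt v * y + \<nu> i)) \<partial>complex_normal) \<partial>PiM I (\<lambda>_. complex_normal))"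
    by (rule insert.IH[where g="\<lambda>x. \<integral>\<^sup>+y. g (x(i := sqrt v * y + \<nu> i)) \<partial>complex_normal"]) measurable
  also have "\<dots> = (\<integral>\<^sup>+z. g (\<lambda>j\<in>insert i I. sqrt v * z j + \<nu> j) \<partial>PiM (insert i I) (\<lambda>_. complex_normal))"
    unfolding r[symmetric]
    by (rule CNP.product_nn_integral_insert[symmetric]) (use insert.hyps in auto)
  finally show ?case .
qed

lemma nn_integral_PiM_component_CN:
  assumes "i \<in> I" "f \<in> borel_measurable borel"
  shows "(\<integral>\<^sup>+z. f (z i) \<partial>PiM I (\<lambda>_. complex_normal)) = (\<integral>\<^sup>+z. f z \<partial>complex_normal)"
proof -
  have "(\<integral>\<^sup>+z. f z \<partial>complex_normal) = (\<integral>\<^sup>+z. f z \<partial>distr (PiM I (\<lambda>_. complex_normal)) complex_normal (\<lambda>z. z i))"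
    using assms(1) by (subst distr_PiM_component) (auto simp: prob_space_complex_normal)
  also have "\<dots> = (\<integral>\<^sup>+z. f (z i) \<partial>PiM I (\<lambda>_. complex_normal))"
    using assms by (subst nn_integral_distr) auto
  finally show ?thesis by simp
qed

lemma prob_space_PiM_CN: "prob_space (PiM I (\<lambda>_. complex_normal))"
  by (intro prob_space_PiM prob_space_complex_normal)

lemma nn_integral_CN_affine:
  "(\<integral>\<^sup>+z. ennreal ((cmod (\<delta> + \<beta> * z))\<^sup>2) \<partial>complex_normal) = ennreal ((cmod \<delta>)\<^sup>2 + (cmod \<beta>)\<^sup>2)"
  using complex_normal_cmod_sq_affine[of \<delta> \<beta>]
  by (subst nn_integral_eq_integral) (auto simp: has_bochner_integral_iff)

text \<open>The log-likelihood ratio of a letter is a combination of such squares and of constants,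
  with \<open>\<alpha>\<close> and \<open>\<beta>\<close> among 0, 1 and
  \<open>- \<kappa>\<close>.\<close>

lemma gaussian_pair_moment:
  assumes "i \<in> I"
  shows "has_bochner_integral (PiM I (\<lambda>_. complex_normal) \<Otimes>\<^sub>M PiM I (\<lambda>_. complex_normal))
    (\<lambda>(z1, z2). (cmod (\<delta> + \<alpha> * z1 i + \<beta> * z2 i))\<^sup>2) ((cmod \<delta>)\<^sup>2 + (cmod \<alpha>)\<^sup>2 + (cmod \<beta>)\<^sup>2)"
proof -
  let ?N = "PiM I (\<lambda>_. complex_normal)"
  interpret N: prob_space ?N by (rule prob_space_PiM_CN)
  have [measurable]: "(\<lambda>z. z i) \<in> ?N \<rightarrow>\<^sub>M borel"
    using measurable_component_singleton[OF assms, of "\<lambda>_. complex_normal"] by (simp cong: measurable_cong_sets)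
  have "(\<integral>\<^sup>+p. ennreal (case p of (z1, z2) \<Rightarrow> (cmod (\<delta> + \<alpha> * z1 i + \<beta> * z2 i))\<^sup>2) \<partial>(?N \<Otimes>\<^sub>M ?N)) =
      (\<integral>\<^sup>+z1. (\<integral>\<^sup>+z2. ennreal ((cmod (\<delta> + \<alpha> * z1 i + \<beta> * z2 i))\<^sup>2) \<partial>?N) \<partial>?N)"
    by (subst N.nn_integral_fst[symmetric]) auto
  also have "\<dots> = (\<integral>\<^sup>+z1. ennreal ((cmod (\<delta> + \<alpha> * z1 i))\<^sup>2) + ennreal ((cmod \<beta>)\<^sup>2) \<partial>?N)"
    by (intro nn_integral_cong, subst nn_integral_PiM_component_CN[OF assms, where f="\<lambda>z. ennreal ((cmod (_ + _ * z))\<^sup>2)"])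
      (auto simp: nn_integral_CN_affine)
  also have "\<dots> = ennreal ((cmod \<delta>)\<^sup>2 + (cmod \<alpha>)\<^sup>2 + (cmod \<beta>)\<^sup>2)"
    by (subst nn_integral_add)
      (auto simp: N.emeasure_space_1 nn_integral_PiM_component_CN[OF assms, where f="\<lambda>z. ennreal ((cmod (_ + _ * z))\<^sup>2)"]
        nn_integral_CN_affine)
  finally show ?thesis
    by (intro has_bochner_integral_nn_integral) (auto intro!: AE_I2)
qed

text \<open>
  The reference law makes \<open>y1\<close> centred of variance \<open>v1\<close> and, given \<open>y1\<close>, makes \<open>y2\<close> Gaussian with mean
  \<open>\<kappa> y1\<close> and variance \<open>v2\<close>. With \<open>\<kappa>\<close> the linear MMSE coefficient this loses nothing for two correlated outputs.
\<close>

lemma gaussian_fano: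
  fixes T M :: nat and \<mu>1 \<mu>2 :: "nat \<Rightarrow> nat \<Rightarrow> complex"
    and G :: "(nat \<Rightarrow> complex) \<Rightarrow> (nat \<Rightarrow> complex) \<Rightarrow> nat"
  defines "N \<equiv> PiM {..<T} (\<lambda>_. complex_normal)" and "B \<equiv> PiM {..<T} (\<lambda>_. borel :: complex measure)"
  assumes M: "0 < M" and v: "0 < v1" "0 < v2"
    and G: "(\<lambda>(y1, y2). G y1 y2) \<in> B \<Otimes>\<^sub>M B \<rightarrow>\<^sub>M count_space UNIV"
    and E1: "\<And>m. m < M \<Longrightarrow> (\<Sum>t<T. (cmod (\<mu>1 m t))\<^sup>2) + real T \<le> real T * v1"
    and E2: "\<And>m. m < M \<Longrightarrow> (\<Sum>t<T. (cmod (\<mu>2 m t - \<kappa> * \<mu>1 m t))\<^sup>2) + real T * (1 + (cmod \<kappa>)\<^sup>2) \<le> real T * v2"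
  shows "(\<Sum>m<M. measure (N \<Otimes>\<^sub>M N) {(z1, z2) \<in> space (N \<Otimes>\<^sub>M N).
      G (\<lambda>t\<in>{..<T}. z1 t + \<mu>1 m t) (\<lambda>t\<in>{..<T}. z2 t + \<mu>2 m t) = m}) / real M
    \<le> (real T * ln v1 + real T * ln v2 + ln 2) / ln (real M + 1)"
proof -
  interpret N: prob_space N unfolding N_def by (rule prob_space_PiM_CN)
  interpret NN: pair_prob_space N N ..
  have sN [measurable_cong]: "sets N = sets B"
    unfolding N_def B_def by (intro sets_PiM_cong) auto
  note [measurable] = G
  have indG [measurable]: "(\<lambda>(y1, y2). indicator {m} (G y1 y2) :: ennreal) \<in> borel_measurable (B \<Otimes>\<^sub>M B)" for m
    using measurable_compose[OF G, of "indicator {m} :: nat \<Rightarrow> ennreal" borel] by (simp add: split_beta')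
  have [measurable]: "(\<lambda>z. z t) \<in> B \<rightarrow>\<^sub>M borel" if "t < T" for t
    unfolding B_def using that by (intro measurable_component_singleton) auto
  have aff [measurable]: "(\<lambda>z. \<lambda>t\<in>{..<T}. c * z t + f t) \<in> B \<rightarrow>\<^sub>M B" for c f
    unfolding B_def by (intro measurable_restrict) auto
  have aff1 [measurable]: "(\<lambda>z. \<lambda>t\<in>{..<T}. z t + f t) \<in> B \<rightarrow>\<^sub>M B" for f
    using aff[of 1 f] by simp
  have [measurable]: "(\<lambda>(z, y). \<lambda>t\<in>{..<T}. c * z t + \<kappa> * y t) \<in> B \<Otimes>\<^sub>M B \<rightarrow>\<^sub>M B" for c
    unfolding B_def split_beta by (intro measurable_restrict) auto
  have [measurable]: "(\<lambda>z. shift_weight v \<delta> z) \<in> borel_measurable borel" for v \<delta>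
    unfolding shift_weight_def by measurable
  have [measurable]: "(\<lambda>(\<delta>, z). shift_weight v \<delta> z) \<in> borel_measurable (borel \<Otimes>\<^sub>M borel)" for v
    unfolding shift_weight_def split_beta by measurable
  have w0: "0 < v \<Longrightarrow> 0 < shift_weight v \<delta> z" for v \<delta> z by (simp add: shift_weight_def)
  define W1 where "W1 m z1 = (\<Prod>t<T. shift_weight v1 (\<mu>1 m t) (z1 t))" for m z1
  define W2 where "W2 m y1 z2 = (\<Prod>t<T. shift_weight v2 (\<mu>2 m t - \<kappa> * y1 t) (z2 t))" for m and y1 z2 :: "nat \<Rightarrow> complex"
  have [measurable]: "W1 m \<in> borel_measurable B" for m unfolding W1_def by measurable
  have [measurable]: "(\<lambda>(y1, z2). W2 m y1 z2) \<in> borel_measurable (B \<Otimes>\<^sub>M B)" for m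
    unfolding W2_def split_beta by measurable
  have W10: "0 < W1 m z" and W20: "0 < W2 m y z" for m y z
    unfolding W1_def W2_def using v by (auto intro!: prod_pos w0)
  define Y1 where "Y1 m z1 = (\<lambda>t\<in>{..<T}. z1 t + \<mu>1 m t)" for m z1
  have [measurable]: "Y1 m \<in> B \<rightarrow>\<^sub>M B" for m unfolding Y1_def by measurable
  \<comment> \<open>Chain rule: the weight of the first output times the conditional weight of the
    second output given the first.\<close>
  define W where "W m = (\<lambda>(z1, z2). W1 m z1 * W2 m (Y1 m z1) z2)" for m
  define A where "A m = {(z1, z2) \<in> space (N \<Otimes>\<^sub>M N). G (Y1 m z1) (\<lambda>t\<in>{..<T}. z2 t + \<mu>2 m t) = m}" for m
  have Wm [measurable]: "W m \<in> borel_measurable (N \<Otimes>\<^sub>M N)" for m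
    unfolding W_def by measurable
  have Am [measurable]: "A m \<in> sets (N \<Otimes>\<^sub>M N)" for m
  proof -
    have "(\<lambda>(z1, z2). G (Y1 m z1) (\<lambda>t\<in>{..<T}. z2 t + \<mu>2 m t)) \<in> N \<Otimes>\<^sub>M N \<rightarrow>\<^sub>M count_space UNIV"
      by measurable
    from measurable_sets[OF this, of "{m}"] show ?thesis
      unfolding A_def by (simp add: vimage_def split_beta' Int_def conj_commute)
  qed
  \<comment> \<open>Weighted integrals of a function of the two outputs do not depend on
    \<open>m\<close>: the right-hand side is the integral under the reference law.\<close>
  have change: "(\<integral>\<^sup>+p. ennreal (W m p) * (case p of (z1, z2) \<Rightarrow> g (Y1 m z1) (\<lambda>t\<in>{..<T}. z2 t + \<mu>2 m t)) \<partial>(N \<Otimes>\<^sub>M N)) =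
      (\<integral>\<^sup>+y1. (\<integral>\<^sup>+y2. g (\<lambda>t\<in>{..<T}. sqrt v1 * y1 t) (\<lambda>t\<in>{..<T}. sqrt v2 * y2 t + \<kappa> * (sqrt v1 * y1 t)) \<partial>N) \<partial>N)"
    if [measurable]: "(\<lambda>(y1, y2). g y1 y2) \<in> borel_measurable (B \<Otimes>\<^sub>M B)" for g m
  proof -
    have "(\<integral>\<^sup>+p. ennreal (W m p) * (case p of (z1, z2) \<Rightarrow> g (Y1 m z1) (\<lambda>t\<in>{..<T}. z2 t + \<mu>2 m t)) \<partial>(N \<Otimes>\<^sub>M N)) =
        (\<integral>\<^sup>+z1. (\<integral>\<^sup>+z2. ennreal (W1 m z1) * (g (Y1 m z1) (\<lambda>t\<in>{..<T}. z2 t + \<mu>2 m t) * ennreal (W2 m (Y1 m z1) z2)) \<partial>N) \<partial>N)"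
      by (subst N.nn_integral_fst[symmetric])
        (auto intro!: nn_integral_cong simp: W_def ennreal_mult W10 W20 less_imp_le mult_ac)
    also have "\<dots> = (\<integral>\<^sup>+z1. ennreal (W1 m z1) * (\<integral>\<^sup>+z2. g (Y1 m z1) (\<lambda>t\<in>{..<T}. z2 t + \<mu>2 m t) * ennreal (W2 m (Y1 m z1) z2) \<partial>N) \<partial>N)"
    proof (rule nn_integral_cong, goal_cases)
      case (1 z1) note z1 = this
      have [measurable]: "Y1 m z1 \<in> space B" using z1 by (auto simp: Y1_def B_def space_PiM)
      show "(\<integral>\<^sup>+z2. ennreal (W1 m z1) * (g (Y1 m z1) (\<lambda>t\<in>{..<T}. z2 t + \<mu>2 m t) * ennreal (W2 m (Y1 m z1) z2)) \<partial>N) =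
          ennreal (W1 m z1) * (\<integral>\<^sup>+z2. g (Y1 m z1) (\<lambda>t\<in>{..<T}. z2 t + \<mu>2 m t) * ennreal (W2 m (Y1 m z1) z2) \<partial>N)"
        by (rule nn_integral_cmult) measurable
    qed
    also have "\<dots> = (\<integral>\<^sup>+z1. ennreal (W1 m z1) * (\<integral>\<^sup>+y2. g (Y1 m z1) (\<lambda>t\<in>{..<T}. sqrt v2 * y2 t + \<kappa> * Y1 m z1 t) \<partial>N) \<partial>N)"
    proof (rule nn_integral_cong, rule arg_cong2[where f="(*)"], rule refl, goal_cases)
      case (1 z1) note z1 = this
      have "Y1 m z1 \<in> space B" using z1 by (auto simp: Y1_def B_def space_PiM)
      then have "(\<lambda>y2. g (Y1 m z1) y2) \<in> borel_measurable B" by measurable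
      then show "(\<integral>\<^sup>+z2. g (Y1 m z1) (\<lambda>t\<in>{..<T}. z2 t + \<mu>2 m t) * ennreal (W2 m (Y1 m z1) z2) \<partial>N) =
          (\<integral>\<^sup>+y2. g (Y1 m z1) (\<lambda>t\<in>{..<T}. sqrt v2 * y2 t + \<kappa> * Y1 m z1 t) \<partial>N)"
        unfolding N_def W2_def B_def
        by (intro nn_integral_PiM_complex_normal_shift v) auto
    qed
    \<comment> \<open>The reference mean of the first output is 0; \<open>- 0\<close> here and
      \<open>+ 0\<close> in the next step bring the integrals into the shape of the substitution
      lemma.\<close>
    also have "\<dots> = (\<integral>\<^sup>+z1. (\<lambda>y1. \<integral>\<^sup>+y2. g y1 (\<lambda>t\<in>{..<T}. sqrt v2 * y2 t + \<kappa> * y1 t) \<partial>N) (\<lambda>t\<in>{..<T}. z1 t + \<mu>1 m t)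
        * ennreal (\<Prod>t<T. shift_weight v1 (\<mu>1 m t - 0) (z1 t)) \<partial>N)"
      by (simp add: W1_def Y1_def mult.commute)
    also have "\<dots> = (\<integral>\<^sup>+y1. (\<lambda>y1. \<integral>\<^sup>+y2. g y1 (\<lambda>t\<in>{..<T}. sqrt v2 * y2 t + \<kappa> * y1 t) \<partial>N) (\<lambda>t\<in>{..<T}. sqrt v1 * y1 t + 0) \<partial>N)"
    proof -
      have [measurable]: "(\<lambda>(y1, y2). \<lambda>t\<in>{..<T}. sqrt v2 * y2 t + \<kappa> * y1 t) \<in> B \<Otimes>\<^sub>M B \<rightarrow>\<^sub>M B"
        unfolding B_def split_beta by (intro measurable_restrict) auto
      have "(\<lambda>y1. \<integral>\<^sup>+y2. g y1 (\<lambda>t\<in>{..<T}. sqrt v2 * y2 t + \<kappa> * y1 t) \<partial>N) \<in> borel_measurable B"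
        by measurable
      then show ?thesis
        unfolding N_def B_def by (intro nn_integral_PiM_complex_normal_shift v finite_lessThan)
    qed
    also have "\<dots> = (\<integral>\<^sup>+y1. (\<integral>\<^sup>+y2. g (\<lambda>t\<in>{..<T}. sqrt v1 * y1 t) (\<lambda>t\<in>{..<T}. sqrt v2 * y2 t + \<kappa> * (sqrt v1 * y1 t)) \<partial>N) \<partial>N)"
      by (auto intro!: nn_integral_cong arg_cong2[where f=g] ext)
    finally show ?thesis .
  qed
  \<comment> \<open>The coefficients 0 and 1 are padding that gives every square the shape of
    \<open>gaussian_pair_moment\<close>.\<close>
  have lnW: "ln (W m p) = (\<Sum>t<T. (cmod (0 + 1 * fst p t + 0 * snd p t))\<^sup>2 - (cmod (\<mu>1 m t + 1 * fst p t + 0 * snd p t))\<^sup>2 / v1 - ln v1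
      + ((cmod (0 + 0 * fst p t + 1 * snd p t))\<^sup>2 - (cmod ((\<mu>2 m t - \<kappa> * \<mu>1 m t) + (- \<kappa>) * fst p t + 1 * snd p t))\<^sup>2 / v2 - ln v2))" for m p
  proof -
    have "ln (W m p) = ln (W1 m (fst p)) + ln (W2 m (Y1 m (fst p)) (snd p))"
      unfolding W_def split_beta using W10 W20 by (simp add: ln_mult_pos)
    also have "ln (W1 m (fst p)) = (\<Sum>t<T. (cmod (fst p t))\<^sup>2 - (cmod (fst p t + \<mu>1 m t))\<^sup>2 / v1 - ln v1)"
      unfolding W1_def using v by (subst ln_prod) (auto simp: w0 shift_weight_def ln_div intro!: sum.cong)
    also have "ln (W2 m (Y1 m (fst p)) (snd p)) =
        (\<Sum>t<T. (cmod (snd p t))\<^sup>2 - (cmod (snd p t + (\<mu>2 m t - \<kappa> * (fst p t + \<mu>1 m t))))\<^sup>2 / v2 - ln v2)"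
      unfolding W2_def using v by (subst ln_prod) (auto simp: w0 shift_weight_def ln_div Y1_def intro!: sum.cong)
    finally show ?thesis
      unfolding sum.distrib[symmetric] by (auto intro!: sum.cong simp: algebra_simps)
  qed
  have hb: "has_bochner_integral (N \<Otimes>\<^sub>M N) (\<lambda>p. (cmod (\<delta> + \<alpha> * fst p t + \<beta> * snd p t))\<^sup>2)
      ((cmod \<delta>)\<^sup>2 + (cmod \<alpha>)\<^sup>2 + (cmod \<beta>)\<^sup>2)" if "t < T" for t \<delta> \<alpha> \<beta>
    using gaussian_pair_moment[of t "{..<T}" \<delta> \<alpha> \<beta>] that unfolding N_def split_beta by simp
  have hbc: "has_bochner_integral (N \<Otimes>\<^sub>M N) (\<lambda>_. c) (c::real)" for c
    using NN.P.prob_space by (simp add: has_bochner_integral_iff)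
  have hbW: "has_bochner_integral (N \<Otimes>\<^sub>M N) (\<lambda>p. ln (W m p))
     (\<Sum>t<T. 1 - ((cmod (\<mu>1 m t))\<^sup>2 + 1) / v1 - ln v1 + (1 - ((cmod (\<mu>2 m t - \<kappa> * \<mu>1 m t))\<^sup>2 + (cmod \<kappa>)\<^sup>2 + 1) / v2 - ln v2))" for m
    unfolding lnW
    apply (intro has_bochner_integral_sum has_bochner_integral_add has_bochner_integral_diff has_bochner_integral_divide_zero hbc)
    subgoal for t using hb[of t 0 1 0] by simp
    subgoal for t using hb[of t "\<mu>1 m t" 1 0] by simp
    subgoal for t using hb[of t 0 0 1] by simp
    subgoal for t using hb[of t "\<mu>2 m t - \<kappa> * \<mu>1 m t" "-\<kappa>" 1] by simp
    done
  have "(\<Sum>m<M. measure (N \<Otimes>\<^sub>M N) (A m)) / real M \<le> (real T * ln v1 + real T * ln v2 + ln 2) / ln (real M + 1)"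
  proof (rule fano_bound[where W=W])
    show "prob_space (N \<Otimes>\<^sub>M N)" by (rule NN.P.prob_space_axioms)
    show "0 < M" by fact
    show "A m \<in> sets (N \<Otimes>\<^sub>M N)" "W m \<in> borel_measurable (N \<Otimes>\<^sub>M N)" for m by measurable
    show "0 < W m p" for m p unfolding W_def using W10 W20 by (auto split: prod.split)
    show "(\<integral>\<^sup>+p. ennreal (W m p) \<partial>(N \<Otimes>\<^sub>M N)) \<le> 1" for m
      using change[of "\<lambda>_ _. 1" m] by (simp add: N.emeasure_space_1)
    show "integrable (N \<Otimes>\<^sub>M N) (\<lambda>p. ln (W m p))" for m
      using hbW[of m] by (simp add: has_bochner_integral_iff)
    \<comment> \<open>The power conditions bound each of the two quadratic means by
      \<open>T\<close>. Together they cancel the noise energy \<open>2 * T\<close>, and only the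
      logarithms of the variances remain.\<close>
    show "- (LINT p|(N \<Otimes>\<^sub>M N). ln (W m p)) \<le> real T * ln v1 + real T * ln v2" if "m < M" for m
    proof -
      have "(LINT p|(N \<Otimes>\<^sub>M N). ln (W m p)) = 
          2 * T - ((\<Sum>t<T. (cmod (\<mu>1 m t))\<^sup>2) + T) / v1 - T * ln v1
          - ((\<Sum>t<T. (cmod (\<mu>2 m t - \<kappa> * \<mu>1 m t))\<^sup>2) + T * (1 + (cmod \<kappa>)\<^sup>2)) / v2 - T * ln v2"
        unfolding has_bochner_integral_integral_eq[OF hbW]
        by (simp add: sum.distrib sum_subtractf sum_divide_distrib[symmetric] algebra_simps add_divide_distrib diff_divide_distrib)
      moreover have "((\<Sum>t<T. (cmod (\<mu>1 m t))\<^sup>2) + T) / v1 \<le> T"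
        using E1[OF that] v by (simp add: divide_le_eq)
      moreover have "((\<Sum>t<T. (cmod (\<mu>2 m t - \<kappa> * \<mu>1 m t))\<^sup>2) + T * (1 + (cmod \<kappa>)\<^sup>2)) / v2 \<le> T"
        using E2[OF that] v by (simp add: divide_le_eq)
      ultimately show ?thesis by linarith
    qed
    have "(\<Sum>m<M. \<integral>\<^sup>+p. ennreal (W m p) * indicator (A m) p \<partial>(N \<Otimes>\<^sub>M N)) =
        (\<Sum>m<M. \<integral>\<^sup>+y1. (\<integral>\<^sup>+y2. indicator {m} (G (\<lambda>t\<in>{..<T}. sqrt v1 * y1 t) (\<lambda>t\<in>{..<T}. sqrt v2 * y2 t + \<kappa> * (sqrt v1 * y1 t))) \<partial>N) \<partial>N)"
    proof (intro sum.cong refl)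
      fix m
      have "(\<integral>\<^sup>+p. ennreal (W m p) * indicator (A m) p \<partial>(N \<Otimes>\<^sub>M N)) =
        (\<integral>\<^sup>+p. ennreal (W m p) * (case p of (z1, z2) \<Rightarrow> indicator {m} (G (Y1 m z1) (\<lambda>t\<in>{..<T}. z2 t + \<mu>2 m t))) \<partial>(N \<Otimes>\<^sub>M N))"
        by (intro nn_integral_cong) (auto simp: A_def indicator_def)
      also have "\<dots> = (\<integral>\<^sup>+y1. (\<integral>\<^sup>+y2. indicator {m} (G (\<lambda>t\<in>{..<T}. sqrt v1 * y1 t) (\<lambda>t\<in>{..<T}. sqrt v2 * y2 t + \<kappa> * (sqrt v1 * y1 t))) \<partial>N) \<partial>N)"
        by (rule change) (rule indG)
      finally show "(\<integral>\<^sup>+p. ennreal (W m p) * indicator (A m) p \<partial>(N \<Otimes>\<^sub>M N)) = \<dots>" .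
    qed
    also have "\<dots> = (\<integral>\<^sup>+y1. (\<integral>\<^sup>+y2. (\<Sum>m<M. indicator {m} (G (\<lambda>t\<in>{..<T}. sqrt v1 * y1 t) (\<lambda>t\<in>{..<T}. sqrt v2 * y2 t + \<kappa> * (sqrt v1 * y1 t)))) \<partial>N) \<partial>N)"
    proof -
      have [measurable]: "(\<lambda>z. \<lambda>t\<in>{..<T}. c * z t) \<in> B \<rightarrow>\<^sub>M B" for c
        unfolding B_def by (intro measurable_restrict) auto
      have [measurable]: "(\<lambda>(y1, y2). \<lambda>t\<in>{..<T}. sqrt v2 * y2 t + \<kappa> * (sqrt v1 * y1 t)) \<in> B \<Otimes>\<^sub>M B \<rightarrow>\<^sub>M B"
        unfolding B_def split_beta by (intro measurable_restrict) auto
      define H where "H m y1 y2 = (indicator {m} (G (\<lambda>t\<in>{..<T}. sqrt v1 * y1 t) (\<lambda>t\<in>{..<T}. sqrt v2 * y2 t + \<kappa> * (sqrt v1 * y1 t))) :: ennreal)"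
        for m and y1 y2 :: "nat \<Rightarrow> complex"
      have "(\<lambda>p. (\<lambda>t\<in>{..<T}. sqrt v1 * fst p t, \<lambda>t\<in>{..<T}. sqrt v2 * snd p t + \<kappa> * (sqrt v1 * fst p t))) \<in> B \<Otimes>\<^sub>M B \<rightarrow>\<^sub>M B \<Otimes>\<^sub>M B"
        by measurable
      from measurable_compose[OF this indG]
      have [measurable]: "(\<lambda>(y1, y2). H m y1 y2) \<in> borel_measurable (B \<Otimes>\<^sub>M B)" for m
        by (simp add: H_def split_beta')
      have "(\<Sum>m<M. \<integral>\<^sup>+y1. (\<integral>\<^sup>+y2. H m y1 y2 \<partial>N) \<partial>N) = (\<integral>\<^sup>+y1. (\<Sum>m<M. \<integral>\<^sup>+y2. H m y1 y2 \<partial>N) \<partial>N)"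
        by (rule nn_integral_sum[symmetric]) measurable
      also have "\<dots> = (\<integral>\<^sup>+y1. (\<integral>\<^sup>+y2. (\<Sum>m<M. H m y1 y2) \<partial>N) \<partial>N)"
        by (intro nn_integral_cong nn_integral_sum[symmetric]) (measurable, simp_all add: sets_eq_imp_space_eq[OF sN] measurable_ident_sets[OF sN])
      finally show ?thesis unfolding H_def .
    qed
    \<comment> \<open>\<open>G\<close> takes a single value, so at most one of the indicators is
      1.\<close>
    also have "\<dots> \<le> (\<integral>\<^sup>+y1. (\<integral>\<^sup>+y2. 1 \<partial>N) \<partial>N)"
    proof (rule nn_integral_mono, rule nn_integral_mono, goal_cases)
      case (1 y1 y2)
      define k where "k = G (\<lambda>t\<in>{..<T}. sqrt v1 * y1 t) (\<lambda>t\<in>{..<T}. sqrt v2 * y2 t + \<kappa> * (sqrt v1 * y1 t))"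
      have "(\<Sum>m<M. indicator {m} k :: ennreal) = (\<Sum>m<M. if m = k then 1 else 0)"
        by (intro sum.cong) (auto split: split_indicator)
      also have "\<dots> \<le> 1" by (simp add: sum.delta)
      finally show ?case unfolding k_def .
    qed
    also have "\<dots> = 1" by (simp add: N.emeasure_space_1)
    finally show "(\<Sum>m<M. \<integral>\<^sup>+p. ennreal (W m p) * indicator (A m) p \<partial>(N \<Otimes>\<^sub>M N)) \<le> 1" .
  qed
  then show ?thesis unfolding A_def Y1_def .
qed

section \<open>Cut-set bounds for codes\<close>

lemma measurable_relay_received:
  assumes C: "measurable_code C" and t: "t \<le> block_len C"
  shows "(\<lambda>(u, h, z). relay_received a \<rho> C m u h z t) \<in>
    borel \<Otimes>\<^sub>M borel \<Otimes>\<^sub>M PiM {..<block_len C} (\<lambda>_. borel) \<rightarrow>\<^sub>M PiM {..<t} (\<lambda>_. borel)"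
  using t
proof (induction t)
  case 0
  then show ?case by (auto simp: space_PiM split_beta')
next
  case (Suc t)
  let ?S = "borel \<Otimes>\<^sub>M borel \<Otimes>\<^sub>M PiM {..<block_len C} (\<lambda>_. borel) :: (real \<times> complex \<times> (nat \<Rightarrow> complex)) measure"
  define y where "y = (\<lambda>p::real \<times> complex \<times> (nat \<Rightarrow> complex). case p of (u, h, z) \<Rightarrow> relay_received a \<rho> C m u h z t)"
  have t: "t < block_len C" using Suc by simp
  have y [measurable]: "y \<in> ?S \<rightarrow>\<^sub>M PiM {..<t} (\<lambda>_. borel)"
    unfolding y_def using Suc by simp
  have L: "(\<lambda>(u, h, y). listens C u h t y) \<in> borel \<Otimes>\<^sub>M borel \<Otimes>\<^sub>M PiM {..<t} (\<lambda>_. borel) \<rightarrow>\<^sub>M count_space UNIV"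
    using C t by (auto simp: measurable_code_def)
  have "(\<lambda>p. (fst p, fst (snd p), y p)) \<in> ?S \<rightarrow>\<^sub>M borel \<Otimes>\<^sub>M borel \<Otimes>\<^sub>M PiM {..<t} (\<lambda>_. borel)"
    by measurable
  from measurable_compose[OF this L]
  have [measurable]: "Measurable.pred ?S (\<lambda>p. listens C (fst p) (fst (snd p)) t (y p))"
    by simp
  have [measurable]: "(\<lambda>p. snd (snd p) t) \<in> ?S \<rightarrow>\<^sub>M borel"
    by (rule measurable_compose[OF measurable_compose[OF measurable_snd measurable_snd] measurable_component_singleton]) (use t in simp)
  have "(\<lambda>p. (y p)(t := if listens C (fst p) (fst (snd p)) t (y p)
      then fst (snd p) * complex_of_real (\<rho> powr (a / 2)) * codebook C m t + snd (snd p) t else 0))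
      \<in> ?S \<rightarrow>\<^sub>M PiM {..<Suc t} (\<lambda>_. borel)"
    by (rule measurable_fun_upd[where J="{..<t}"]) (auto simp: lessThan_Suc)
  then show ?case
    by (simp add: Let_def y_def split_beta' fun_upd_def)
qed

text \<open>The relay power constraint speaks of the prefixes of one sequence \<open>y\<close>. The
  signals received up to successive times are such prefixes, so the constraint applies to
  them.\<close>

lemma relay_received_restrict:
  "t \<le> s \<Longrightarrow> restrict (relay_received a \<rho> C m u h z s) {..<t} = relay_received a \<rho> C m u h z t"
proof (induction s)
  case 0
  then show ?case by (auto simp: restrict_def)
next
  case (Suc s)
  \<comment> \<open>Entries that have not arrived yet are \<open>undefined\<close>, exactly as
    \<open>restrict\<close> leaves them.\<close>
  have undef: "relay_received a \<rho> C m u h z n i = undefined" if "n \<le> i" for n i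
    using that by (induction n) (auto simp: Let_def)
  show ?case
  proof (cases "t = Suc s")
    case True
    then show ?thesis using undef[of "Suc s"] by (intro ext) (auto simp del: relay_received.simps)
  next
    case False
    then have "t \<le> s" using Suc.prems by simp
    then have "restrict (relay_received a \<rho> C m u h z (Suc s)) {..<t} = restrict (relay_received a \<rho> C m u h z s) {..<t}"
      by (intro ext) (auto simp: Let_def)
    then show ?thesis using Suc.IH \<open>t \<le> s\<close> by simp
  qed
qed

lemma relay_signal_power:
  assumes "unit_power_relay C"
  shows "(\<Sum>t<block_len C. (cmod (signal C u h t (relay_received a \<rho> C m u h z t)))\<^sup>2) \<le> real (block_len C)"
proof -
  have "(\<Sum>t<block_len C. (cmod (signal C u h t (restrict (relay_received a \<rho> C m u h z (block_len C)) {..<t})))\<^sup>2) \<le> real (block_len C)"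
    using assms unfolding unit_power_relay_def by blast
  then show ?thesis by (simp add: relay_received_restrict)
qed

lemma measurable_signal_received:
  assumes C: "measurable_code C" and t: "t < block_len C"
  shows "(\<lambda>(u, h, z). signal C u h t (relay_received a \<rho> C m u h z t)) \<in>
    borel \<Otimes>\<^sub>M borel \<Otimes>\<^sub>M PiM {..<block_len C} (\<lambda>_. borel) \<rightarrow>\<^sub>M borel"
proof -
  let ?S = "borel \<Otimes>\<^sub>M borel \<Otimes>\<^sub>M PiM {..<block_len C} (\<lambda>_. borel) :: (real \<times> complex \<times> (nat \<Rightarrow> complex)) measure"
  define y where "y = (\<lambda>p::real \<times> complex \<times> (nat \<Rightarrow> complex). case p of (u, h, z) \<Rightarrow> relay_received a \<rho> C m u h z t)"
  have y [measurable]: "y \<in> ?S \<rightarrow>\<^sub>M PiM {..<t} (\<lambda>_. borel)"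
    unfolding y_def using measurable_relay_received[OF C, of t] t by simp
  have L: "(\<lambda>(u, h, y). signal C u h t y) \<in> borel \<Otimes>\<^sub>M borel \<Otimes>\<^sub>M PiM {..<t} (\<lambda>_. borel) \<rightarrow>\<^sub>M borel"
    using C t by (auto simp: measurable_code_def)
  have "(\<lambda>p. (fst p, fst (snd p), y p)) \<in> ?S \<rightarrow>\<^sub>M borel \<Otimes>\<^sub>M borel \<Otimes>\<^sub>M PiM {..<t} (\<lambda>_. borel)"
    by measurable
  from measurable_compose[OF this L] show ?thesis by (simp add: y_def split_beta')
qed

lemma measurable_code_zero_codebook:
  "measurable_code C \<Longrightarrow> measurable_code (C\<lparr>codebook := \<lambda>_ _. 0\<rparr>)"
  by (simp add: measurable_code_def)

lemma relay_received_zero_codebook: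
  "t \<le> block_len C \<Longrightarrow>
    relay_received a \<rho> (C\<lparr>codebook := \<lambda>_ _. 0\<rparr>) 0 u h
      (\<lambda>t\<in>{..<block_len C}. z t + h * complex_of_real (\<rho> powr (a / 2)) * codebook C m t) t =
    relay_received a \<rho> C m u h z t"
  by (induction t) (auto simp: Let_def add.commute)

text \<open>Source and relay may transmit coherently, so the cross terms do not cancel; the factor 2
  pays for them and becomes the 4 in \<open>1 + 4 * \<theta>\<close>.\<close>

lemma sum_cmod_sq_add_le:
  "(\<Sum>t<T. (cmod (f t + g t))\<^sup>2) \<le> 2 * (\<Sum>t<T. (cmod (f t))\<^sup>2) + 2 * (\<Sum>t<T::nat. (cmod (g t))\<^sup>2)"
proof -
  have "(cmod (f t + g t))\<^sup>2 \<le> 2 * (cmod (f t))\<^sup>2 + 2 * (cmod (g t))\<^sup>2" for t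
  proof -
    have "(cmod (f t + g t))\<^sup>2 \<le> (cmod (f t) + cmod (g t))\<^sup>2"
      by (intro power_mono norm_triangle_ineq) auto
    also have "\<dots> \<le> 2 * (cmod (f t))\<^sup>2 + 2 * (cmod (g t))\<^sup>2"
      using sum_squares_bound[of "cmod (f t)" "cmod (g t)"] by (simp add: power2_sum)
    finally show ?thesis .
  qed
  then show ?thesis by (simp add: sum_distrib_left sum.distrib[symmetric] sum_mono)
qed

section \<open>The two cuts for fixed fading gains\<close>

abbreviation noise :: "nat \<Rightarrow> (nat \<Rightarrow> complex) measure" where
  "noise T \<equiv> PiM {..<T} (\<lambda>_. complex_normal)"

lemma sets_noise: "sets (noise T) = sets (PiM {..<T} (\<lambda>_. borel))"
  by (intro sets_PiM_cong) auto

lemma measurable_decoder_section: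
  assumes "measurable_code C"
  shows "decoder C h \<in> PiM {..<block_len C} (\<lambda>_. borel) \<rightarrow>\<^sub>M count_space UNIV"
proof -
  have D: "(\<lambda>(h, y). decoder C h y) \<in> borel \<Otimes>\<^sub>M PiM {..<block_len C} (\<lambda>_. borel) \<rightarrow>\<^sub>M count_space UNIV"
    using assms by (simp add: measurable_code_def)
  have "Pair h \<in> PiM {..<block_len C} (\<lambda>_. borel) \<rightarrow>\<^sub>M borel \<Otimes>\<^sub>M PiM {..<block_len C} (\<lambda>_. borel :: complex measure)"
    by measurable
  from measurable_compose[OF this D] show ?thesis by simp
qed

lemma cmod_gain_sq: "(cmod (h * complex_of_real (\<rho> powr (x / 2))))\<^sup>2 = (cmod h)\<^sup>2 * \<rho> powr x"
proof -
  have "(\<rho> powr (x / 2))\<^sup>2 = \<rho> powr x"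
    by (simp add: power2_eq_square flip: powr_add)
  then show ?thesis by (simp add: norm_mult power_mult_distrib)
qed

text \<open>
  The genie-aided relay sees \<open>z t + h x t\<close> also at times when it does not listen. Running the relay
  with codebook 0 on this sequence in the role of the noise reproduces what it really received.
\<close>

lemma source_cut:
  assumes C: "measurable_code C" "unit_power_source C" "0 < num_msgs C"
    and \<theta>: "(cmod hsr)\<^sup>2 * \<rho> powr a \<le> \<theta>" "(cmod hsd)\<^sup>2 * \<rho> powr c \<le> \<theta>"
  shows "(\<Sum>m<num_msgs C. measure (noise (block_len C) \<Otimes>\<^sub>M noise (block_len C))
      {(zr, zd) \<in> space (noise (block_len C) \<Otimes>\<^sub>M noise (block_len C)).
        decoder C (hsr, hrd, hsd) (dest_received a b c \<rho> C m u (hsr, hrd, hsd) zr zd) = m}) / real (num_msgs C)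
    \<le> (real (block_len C) * ln (1 + 4 * \<theta>) + ln 2) / ln (real (num_msgs C) + 1)"
proof -
  define T where "T = block_len C"
  define M where "M = num_msgs C"
  define s1 where "s1 = hsr * complex_of_real (\<rho> powr (a / 2))"
  define s2 where "s2 = hsd * complex_of_real (\<rho> powr (c / 2))"
  define C0 where "C0 = C\<lparr>codebook := \<lambda>_ _. 0\<rparr>"
  have C0: "measurable_code C0" "block_len C0 = T" "signal C0 = signal C"
    using C by (auto simp: C0_def measurable_code_zero_codebook T_def)
  have s1: "(cmod s1)\<^sup>2 \<le> \<theta>" and s2: "(cmod s2)\<^sup>2 \<le> \<theta>"
    using \<theta> by (auto simp: s1_def s2_def cmod_gain_sq)
  then have \<theta>0: "0 \<le> \<theta>" by (auto intro: order_trans[OF zero_le_power2])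
  define \<kappa> where "\<kappa> = s2 * cnj s1 / complex_of_real (1 + (cmod s1)\<^sup>2)"
  \<comment> \<open>\<open>v1\<close> is the variance of the relay's observation for Gaussian input,
    \<open>v2\<close> the residual variance at the destination after linear estimation from it.
    Their product is \<open>1 + (cmod s1)\<^sup>2 + (cmod s2)\<^sup>2\<close>, the capacity term of
    one input seen by two receivers.\<close>
  define v1 where "v1 = 1 + (cmod s1)\<^sup>2"
  define v2 where "v2 = 1 + (cmod s2)\<^sup>2 / v1"
  have v: "0 < v1" "0 < v2" by (auto simp: v1_def v2_def add_pos_nonneg)
  \<comment> \<open>\<open>yd\<close> stands for the destination's signal without the relay's
    contribution. \<open>G\<close> computes that contribution from \<open>yr\<close> and adds it
    before decoding.\<close>
  define G where "G yr yd = decoder C (hsr, hrd, hsd) (\<lambda>t\<in>{..<T}. yd t +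
      hrd * complex_of_real (\<rho> powr (b / 2)) * signal C u hsr t (relay_received a \<rho> C0 0 u hsr yr t))" for yr yd
  have pw: "(\<Sum>t<T. (cmod (codebook C m t))\<^sup>2) \<le> T" if "m < M" for m
    using C that by (auto simp: unit_power_source_def T_def M_def)
  have "(\<Sum>m<M. measure (noise T \<Otimes>\<^sub>M noise T) {(z1, z2) \<in> space (noise T \<Otimes>\<^sub>M noise T).
      G (\<lambda>t\<in>{..<T}. z1 t + s1 * codebook C m t) (\<lambda>t\<in>{..<T}. z2 t + s2 * codebook C m t) = m}) / real M
    \<le> (real T * ln v1 + real T * ln v2 + ln 2) / ln (real M + 1)"
  proof (rule gaussian_fano[where \<kappa>=\<kappa>])
    show "0 < M" "0 < v1" "0 < v2" using C v by (auto simp: M_def)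
    have B: "(\<lambda>p. \<lambda>t\<in>{..<T}. snd p t + hrd * complex_of_real (\<rho> powr (b / 2)) *
          signal C u hsr t (relay_received a \<rho> C0 0 u hsr (fst p) t))
        \<in> PiM {..<T} (\<lambda>_. borel) \<Otimes>\<^sub>M PiM {..<T} (\<lambda>_. borel) \<rightarrow>\<^sub>M PiM {..<T} (\<lambda>_. borel)"
    proof (intro measurable_restrict)
      fix t assume t: "t \<in> {..<T}"
      have "(\<lambda>p. (u, hsr, fst p)) \<in> PiM {..<T} (\<lambda>_. borel) \<Otimes>\<^sub>M PiM {..<T} (\<lambda>_. borel :: complex measure) \<rightarrow>\<^sub>M borel \<Otimes>\<^sub>M borel \<Otimes>\<^sub>M PiM {..<T} (\<lambda>_. borel :: complex measure)"
        by measurable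
      from measurable_compose[OF this measurable_signal_received[OF C0(1), of t a \<rho> 0, unfolded C0(2,3)]]
      have [measurable]: "(\<lambda>p. signal C u hsr t (relay_received a \<rho> C0 0 u hsr (fst p) t))
          \<in> PiM {..<T} (\<lambda>_. borel) \<Otimes>\<^sub>M PiM {..<T} (\<lambda>_. borel :: complex measure) \<rightarrow>\<^sub>M borel"
        using t by simp
      show "(\<lambda>p. snd p t + hrd * complex_of_real (\<rho> powr (b / 2)) * signal C u hsr t (relay_received a \<rho> C0 0 u hsr (fst p) t))
        \<in> PiM {..<T} (\<lambda>_. borel) \<Otimes>\<^sub>M PiM {..<T} (\<lambda>_. borel :: complex measure) \<rightarrow>\<^sub>M borel"
        using t by measurable
    qed
    from measurable_compose[OF this measurable_decoder_section[OF C(1), folded T_def]]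
    show "(\<lambda>(yr, yd). G yr yd) \<in> PiM {..<T} (\<lambda>_. borel) \<Otimes>\<^sub>M PiM {..<T} (\<lambda>_. borel) \<rightarrow>\<^sub>M count_space UNIV"
      unfolding G_def split_beta' .
    show "(\<Sum>t<T. (cmod (s1 * codebook C m t))\<^sup>2) + real T \<le> real T * v1" if "m < M" for m
      using mult_left_mono[OF pw[OF that], of "(cmod s1)\<^sup>2"]
      by (simp add: norm_mult power_mult_distrib sum_distrib_left[symmetric] v1_def algebra_simps)
    show "(\<Sum>t<T. (cmod (s2 * codebook C m t - \<kappa> * (s1 * codebook C m t)))\<^sup>2) + real T * (1 + (cmod \<kappa>)\<^sup>2)
        \<le> real T * v2" if "m < M" for m
    proof -
      have ks: "s2 - \<kappa> * s1 = s2 / complex_of_real v1"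
      proof -
        have "\<kappa> * s1 = s2 * complex_of_real ((cmod s1)\<^sup>2) / complex_of_real v1"
          unfolding complex_norm_square \<kappa>_def v1_def by (simp add: mult_ac)
        also have "\<dots> = s2 * (complex_of_real v1 - 1) / complex_of_real v1"
          by (simp add: v1_def)
        also have "\<dots> = s2 - s2 / complex_of_real v1"
          using v(1) by (simp add: field_simps)
        finally show ?thesis by simp
      qed
      have 1: "(cmod (s2 * codebook C m t - \<kappa> * (s1 * codebook C m t)))\<^sup>2 = (cmod s2)\<^sup>2 / v1\<^sup>2 * (cmod (codebook C m t))\<^sup>2" for t
      proof -
        have "s2 * codebook C m t - \<kappa> * (s1 * codebook C m t) = s2 / complex_of_real v1 * codebook C m t"
          unfolding ks[symmetric] by (simp add: algebra_simps)
        then show ?thesis by (simp add: norm_mult norm_divide power_mult_distrib power_divide)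
      qed
      have 2: "(cmod \<kappa>)\<^sup>2 = (cmod s2)\<^sup>2 * (v1 - 1) / v1\<^sup>2"
        unfolding \<kappa>_def v1_def[symmetric] by (simp add: norm_mult norm_divide power_mult_distrib power_divide) (simp add: v1_def)
      have "(\<Sum>t<T. (cmod (s2 * codebook C m t - \<kappa> * (s1 * codebook C m t)))\<^sup>2) \<le> (cmod s2)\<^sup>2 / v1\<^sup>2 * T"
        unfolding 1 sum_distrib_left[symmetric] using pw[OF that] by (intro mult_left_mono) auto
      also have "(cmod s2)\<^sup>2 / v1\<^sup>2 * T + real T * (1 + (cmod \<kappa>)\<^sup>2) = real T * v2"
        unfolding 2 v2_def using v(1) by (simp add: field_simps power2_eq_square)
      finally show ?thesis by simp
    qed
  qed
  also have "\<dots> \<le> (real T * ln (1 + 4 * \<theta>) + ln 2) / ln (real M + 1)"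
  proof (intro divide_right_mono add_right_mono)
    have "real T * ln v1 + real T * ln v2 = real T * ln (v1 * v2)"
      using v by (simp add: ln_mult_pos algebra_simps)
    also have "v1 * v2 = 1 + (cmod s1)\<^sup>2 + (cmod s2)\<^sup>2"
      using v(1) by (simp add: v2_def algebra_simps) (simp add: v1_def)
    \<comment> \<open>The sum is at most \<open>1 + 2 * \<theta>\<close>; the larger constant lets
      both cuts share one bound.\<close>
    also have "real T * ln (1 + (cmod s1)\<^sup>2 + (cmod s2)\<^sup>2) \<le> real T * ln (1 + 4 * \<theta>)"
    proof (intro mult_left_mono ln_mono)
      show "1 + (cmod s1)\<^sup>2 + (cmod s2)\<^sup>2 \<le> 1 + 4 * \<theta>" using s1 s2 \<theta>0 by linarith
    qed (auto simp: add_pos_nonneg)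
    finally show "real T * ln v1 + real T * ln v2 \<le> real T * ln (1 + 4 * \<theta>)" .
  qed (auto)
  also have "(\<Sum>m<M. measure (noise T \<Otimes>\<^sub>M noise T) {(z1, z2) \<in> space (noise T \<Otimes>\<^sub>M noise T).
      G (\<lambda>t\<in>{..<T}. z1 t + s1 * codebook C m t) (\<lambda>t\<in>{..<T}. z2 t + s2 * codebook C m t) = m}) =
    (\<Sum>m<M. measure (noise T \<Otimes>\<^sub>M noise T) {(zr, zd) \<in> space (noise T \<Otimes>\<^sub>M noise T).
        decoder C (hsr, hrd, hsd) (dest_received a b c \<rho> C m u (hsr, hrd, hsd) zr zd) = m})"
  proof -
    have "G (\<lambda>t\<in>{..<T}. z1 t + s1 * codebook C m t) (\<lambda>t\<in>{..<T}. z2 t + s2 * codebook C m t) =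
        decoder C (hsr, hrd, hsd) (dest_received a b c \<rho> C m u (hsr, hrd, hsd) z1 z2)" for z1 z2 m
    proof -
      have r: "relay_received a \<rho> C0 0 u hsr (\<lambda>t\<in>{..<T}. z1 t + s1 * codebook C m t) t = relay_received a \<rho> C m u hsr z1 t" if "t < T" for t
        unfolding C0_def T_def s1_def using that by (intro relay_received_zero_codebook) (simp add: T_def)
      show ?thesis
        unfolding G_def dest_received_def T_def[symmetric] s2_def prod.case
        by (rule arg_cong[where f="decoder C (hsr, hrd, hsd)"], rule restrict_ext) (auto simp: r algebra_simps)
    qed
    then show ?thesis by simp
  qed
  finally show ?thesis unfolding T_def M_def .
qed

text \<open>For a fixed relay noise the relay signal is a function of the message, so source and
  relay act as one transmitter with two antennas. The first output of \<open>gaussian_fano\<close>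
  is a dummy, pure noise with \<open>v1 = 1\<close> and \<open>\<kappa> = 0\<close>.\<close>

lemma destination_cut:
  assumes C: "measurable_code C" "unit_power_source C" "unit_power_relay C" "0 < num_msgs C"
    and \<theta>: "(cmod hrd)\<^sup>2 * \<rho> powr b \<le> \<theta>" "(cmod hsd)\<^sup>2 * \<rho> powr c \<le> \<theta>"
  shows "(\<Sum>m<num_msgs C. measure (noise (block_len C))
      {zd \<in> space (noise (block_len C)).
        decoder C (hsr, hrd, hsd) (dest_received a b c \<rho> C m u (hsr, hrd, hsd) zr zd) = m}) / real (num_msgs C)
    \<le> (real (block_len C) * ln (1 + 4 * \<theta>) + ln 2) / ln (real (num_msgs C) + 1)"
proof -
  define T where "T = block_len C"
  define M where "M = num_msgs C"
  interpret N: prob_space "noise T" by (rule prob_space_PiM_CN)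
  define s2 where "s2 = hsd * complex_of_real (\<rho> powr (c / 2))"
  define s3 where "s3 = hrd * complex_of_real (\<rho> powr (b / 2))"
  define x where "x m t = signal C u hsr t (relay_received a \<rho> C m u hsr zr t)" for m t
  have s3: "(cmod s3)\<^sup>2 \<le> \<theta>" and s2: "(cmod s2)\<^sup>2 \<le> \<theta>"
    using \<theta> by (auto simp: s3_def s2_def cmod_gain_sq)
  then have \<theta>0: "0 \<le> \<theta>" by (auto intro: order_trans[OF zero_le_power2])
  have pw: "(\<Sum>t<T. (cmod (codebook C m t))\<^sup>2) \<le> T" if "m < M" for m
    using C that by (auto simp: unit_power_source_def T_def M_def)
  have pr: "(\<Sum>t<T. (cmod (x m t))\<^sup>2) \<le> T" for m
    unfolding x_def T_def by (rule relay_signal_power[OF C(3)])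
  have D: "decoder C (hsr, hrd, hsd) \<in> PiM {..<T} (\<lambda>_. borel) \<rightarrow>\<^sub>M count_space UNIV"
    using measurable_decoder_section[OF C(1)] by (simp add: T_def)
  have "(\<Sum>m<M. measure (noise T \<Otimes>\<^sub>M noise T) {(z1, z2) \<in> space (noise T \<Otimes>\<^sub>M noise T).
      decoder C (hsr, hrd, hsd) (\<lambda>t\<in>{..<T}. z2 t + (s2 * codebook C m t + s3 * x m t)) = m}) / real M
    \<le> (real T * ln 1 + real T * ln (1 + 4 * \<theta>) + ln 2) / ln (real M + 1)"
  proof (rule gaussian_fano[where \<kappa>=0 and ?\<mu>1.0="\<lambda>_ _. 0" and G="\<lambda>_ y. decoder C (hsr, hrd, hsd) y"])
    show "0 < M" "0 < 1 + 4 * \<theta>" using C \<theta>0 by (auto simp: M_def)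
    show "(\<lambda>(y1, y2). decoder C (hsr, hrd, hsd) y2) \<in> PiM {..<T} (\<lambda>_. borel) \<Otimes>\<^sub>M PiM {..<T} (\<lambda>_. borel) \<rightarrow>\<^sub>M count_space UNIV"
      using measurable_compose[OF measurable_snd D] by (simp add: split_beta')
    show "(\<Sum>t<T. (cmod (s2 * codebook C m t + s3 * x m t - 0 * 0))\<^sup>2) + real T * (1 + (cmod 0)\<^sup>2) \<le> real T * (1 + 4 * \<theta>)"
      if "m < M" for m
    proof -
      have "(\<Sum>t<T. (cmod (s2 * codebook C m t + s3 * x m t))\<^sup>2) \<le>
          2 * (\<Sum>t<T. (cmod (s2 * codebook C m t))\<^sup>2) + 2 * (\<Sum>t<T. (cmod (s3 * x m t))\<^sup>2)"
        by (rule sum_cmod_sq_add_le)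
      also have "\<dots> = 2 * ((cmod s2)\<^sup>2 * (\<Sum>t<T. (cmod (codebook C m t))\<^sup>2)) + 2 * ((cmod s3)\<^sup>2 * (\<Sum>t<T. (cmod (x m t))\<^sup>2))"
        by (simp add: norm_mult power_mult_distrib sum_distrib_left[symmetric])
      also have "\<dots> \<le> 2 * (\<theta> * T) + 2 * (\<theta> * T)"
        using pw[OF that] pr[of m] s2 s3 \<theta>0 by (intro add_mono mult_left_mono mult_mono sum_nonneg) auto
      finally show ?thesis by (simp add: algebra_simps)
    qed
  qed auto
  also have "(\<Sum>m<M. measure (noise T \<Otimes>\<^sub>M noise T) {(z1, z2) \<in> space (noise T \<Otimes>\<^sub>M noise T).
      decoder C (hsr, hrd, hsd) (\<lambda>t\<in>{..<T}. z2 t + (s2 * codebook C m t + s3 * x m t)) = m}) =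
    (\<Sum>m<M. measure (noise T) {zd \<in> space (noise T).
        decoder C (hsr, hrd, hsd) (dest_received a b c \<rho> C m u (hsr, hrd, hsd) zr zd) = m})"
  proof (intro sum.cong refl)
    fix m
    let ?A = "{zd \<in> space (noise T). decoder C (hsr, hrd, hsd) (dest_received a b c \<rho> C m u (hsr, hrd, hsd) zr zd) = m}"
    have dr: "dest_received a b c \<rho> C m u (hsr, hrd, hsd) zr zd = (\<lambda>t\<in>{..<T}. zd t + (s2 * codebook C m t + s3 * x m t))" for zd
      unfolding dest_received_def T_def s2_def s3_def x_def by (auto simp: algebra_simps)
    have "(\<lambda>zd. \<lambda>t\<in>{..<T}. zd t + (s2 * codebook C m t + s3 * x m t)) \<in> noise T \<rightarrow>\<^sub>M PiM {..<T} (\<lambda>_. borel)"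
    proof (intro measurable_restrict)
      fix t assume "t \<in> {..<T}"
      then have [measurable]: "(\<lambda>z. z t) \<in> noise T \<rightarrow>\<^sub>M borel"
        using measurable_component_singleton[of t "{..<T}" "\<lambda>_. complex_normal"] by (simp cong: measurable_cong_sets)
      show "(\<lambda>zd. zd t + (s2 * codebook C m t + s3 * x m t)) \<in> noise T \<rightarrow>\<^sub>M borel" by measurable
    qed
    from measurable_sets[OF measurable_compose[OF this D], of "{m}"]
    have A: "?A \<in> sets (noise T)" unfolding dr by (simp add: vimage_def Int_def conj_commute)
    have eq: "{(z1, z2) \<in> space (noise T \<Otimes>\<^sub>M noise T).
        decoder C (hsr, hrd, hsd) (\<lambda>t\<in>{..<T}. z2 t + (s2 * codebook C m t + s3 * x m t)) = m} = space (noise T) \<times> ?A"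
      unfolding dr by (auto simp: space_pair_measure)
    show "measure (noise T \<Otimes>\<^sub>M noise T) {(z1, z2) \<in> space (noise T \<Otimes>\<^sub>M noise T).
        decoder C (hsr, hrd, hsd) (\<lambda>t\<in>{..<T}. z2 t + (s2 * codebook C m t + s3 * x m t)) = m} = measure (noise T) ?A"
      unfolding eq measure_def using A by (subst N.emeasure_pair_measure_Times) (auto simp: N.emeasure_space_1)
  qed
  finally show ?thesis unfolding T_def M_def by simp
qed

section \<open>From fixed gains to the error probability\<close>

type_synonym gain_triple = "complex \<times> complex \<times> complex"

abbreviation gains :: "gain_triple measure" where
  "gains \<equiv> complex_normal \<Otimes>\<^sub>M complex_normal \<Otimes>\<^sub>M complex_normal"

abbreviation seed :: "real measure" where
  "seed \<equiv> uniform_measure lborel {0..1}"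

lemma prob_space_seed: "prob_space seed"
  by (rule prob_space_uniform_measure) auto

lemma prob_space_gains: "prob_space gains"
  by (intro prob_space_pair prob_space_complex_normal)

lemma prob_space_noise: "prob_space (noise T)"
  by (rule prob_space_PiM_CN)

lemma prob_space_noise_pair: "prob_space (noise T \<Otimes>\<^sub>M noise T)"
  by (intro prob_space_pair prob_space_noise)

lemma prob_space_channel_space: "prob_space (channel_space T)"
  unfolding channel_space_def
  by (intro prob_space_pair prob_space_noise prob_space_gains prob_space_seed)

lemma sets_gains: "sets gains = sets (borel :: gain_triple measure)"
proof -
  have "sets gains = sets (borel \<Otimes>\<^sub>M borel \<Otimes>\<^sub>M borel :: gain_triple measure)"
    by (intro sets_pair_measure_cong) auto
  also have "\<dots> = sets borel" by (subst borel_prod)+ (rule refl)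
  finally show ?thesis .
qed

lemma sets_channel_space:
  "sets (channel_space T) = sets ((borel :: gain_triple measure) \<Otimes>\<^sub>M borel \<Otimes>\<^sub>M
      PiM {..<T} (\<lambda>_. borel) \<Otimes>\<^sub>M PiM {..<T} (\<lambda>_. borel))"
  unfolding channel_space_def by (intro sets_pair_measure_cong sets_gains sets_noise) auto

lemma measurable_dest_received:
  assumes C: "measurable_code C"
  shows "(\<lambda>(h, u, zr, zd). dest_received a b c \<rho> C m u h zr zd) \<in>
    borel \<Otimes>\<^sub>M borel \<Otimes>\<^sub>M PiM {..<block_len C} (\<lambda>_. borel) \<Otimes>\<^sub>M PiM {..<block_len C} (\<lambda>_. borel) \<rightarrow>\<^sub>M
    PiM {..<block_len C} (\<lambda>_. borel)"
proof -
  let ?B = "PiM {..<block_len C} (\<lambda>_. borel :: complex measure)"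
  let ?S = "(borel :: gain_triple measure) \<Otimes>\<^sub>M (borel :: real measure) \<Otimes>\<^sub>M ?B \<Otimes>\<^sub>M ?B"
  have [measurable]: "fst \<in> (borel :: gain_triple measure) \<rightarrow>\<^sub>M borel"
    "snd \<in> (borel :: gain_triple measure) \<rightarrow>\<^sub>M (borel :: (complex \<times> complex) measure)"
    "fst \<in> (borel :: (complex \<times> complex) measure) \<rightarrow>\<^sub>M borel"
    "snd \<in> (borel :: (complex \<times> complex) measure) \<rightarrow>\<^sub>M borel"
    by (simp_all add: borel_prod[symmetric])
  have "(\<lambda>p. \<lambda>t\<in>{..<block_len C}. snd (snd (fst p)) * complex_of_real (\<rho> powr (c / 2)) * codebook C m t +
       fst (snd (fst p)) * complex_of_real (\<rho> powr (b / 2)) *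
        signal C (fst (snd p)) (fst (fst p)) t (relay_received a \<rho> C m (fst (snd p)) (fst (fst p)) (fst (snd (snd p))) t) +
       snd (snd (snd p)) t) \<in> ?S \<rightarrow>\<^sub>M ?B"
  proof (intro measurable_restrict)
    fix t assume t: "t \<in> {..<block_len C}"
    have "(\<lambda>p. (fst (snd p), fst (fst p), fst (snd (snd p)))) \<in> ?S \<rightarrow>\<^sub>M borel \<Otimes>\<^sub>M borel \<Otimes>\<^sub>M ?B"
      by measurable
    from measurable_compose[OF this measurable_signal_received[OF C, of t a \<rho> m]] t
    have [measurable]: "(\<lambda>p. signal C (fst (snd p)) (fst (fst p)) t (relay_received a \<rho> C m (fst (snd p)) (fst (fst p)) (fst (snd (snd p))) t)) \<in> ?S \<rightarrow>\<^sub>M borel"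
      by simp
    have [measurable]: "(\<lambda>p. snd (snd (snd p)) t) \<in> ?S \<rightarrow>\<^sub>M borel"
      by (rule measurable_compose[OF measurable_compose[OF measurable_compose[OF measurable_snd measurable_snd] measurable_snd] measurable_component_singleton]) (use t in simp)
    show "(\<lambda>p. snd (snd (fst p)) * complex_of_real (\<rho> powr (c / 2)) * codebook C m t +
       fst (snd (fst p)) * complex_of_real (\<rho> powr (b / 2)) *
        signal C (fst (snd p)) (fst (fst p)) t (relay_received a \<rho> C m (fst (snd p)) (fst (fst p)) (fst (snd (snd p))) t) +
       snd (snd (snd p)) t) \<in> ?S \<rightarrow>\<^sub>M borel"
      by measurable
  qed
  then show ?thesis
    by (rule back_subst[where P="\<lambda>f. f \<in> _"]) (rule ext, clarsimp simp only: dest_received_def prod.case fst_conv snd_conv split_paired_all)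
qed

lemma measurable_decoded:
  assumes C: "measurable_code C"
  shows "(\<lambda>(h, u, zr, zd). decoder C h (dest_received a b c \<rho> C m u h zr zd)) \<in>
    channel_space (block_len C) \<rightarrow>\<^sub>M count_space UNIV"
proof -
  let ?B = "PiM {..<block_len C} (\<lambda>_. borel :: complex measure)"
  let ?S = "(borel :: gain_triple measure) \<Otimes>\<^sub>M (borel :: real measure) \<Otimes>\<^sub>M ?B \<Otimes>\<^sub>M ?B"
  have [measurable]: "(\<lambda>(h, u, zr, zd). dest_received a b c \<rho> C m u h zr zd) \<in> ?S \<rightarrow>\<^sub>M ?B"
    by (rule measurable_dest_received[OF C])
  have D: "(\<lambda>(h, y). decoder C h y) \<in> borel \<Otimes>\<^sub>M ?B \<rightarrow>\<^sub>M count_space UNIV"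
    using C by (simp add: measurable_code_def)
  have "(\<lambda>p. (fst p, (case p of (h, u, zr, zd) \<Rightarrow> dest_received a b c \<rho> C m u h zr zd))) \<in> ?S \<rightarrow>\<^sub>M borel \<Otimes>\<^sub>M ?B"
    by measurable
  from measurable_compose[OF this D]
  have "(\<lambda>(h, u, zr, zd). decoder C h (dest_received a b c \<rho> C m u h zr zd)) \<in> ?S \<rightarrow>\<^sub>M count_space UNIV"
    by (simp add: split_beta')
  then show ?thesis by (subst measurable_cong_sets[OF sets_channel_space refl])
qed

lemma sets_decoding_error:
  assumes C: "measurable_code C"
  shows "{(h, u, zr, zd) \<in> space (channel_space (block_len C)).
    decoder C h (dest_received a b c \<rho> C m u h zr zd) \<noteq> m} \<in> sets (channel_space (block_len C))"
proof -
  have *: "{(h, u, zr, zd) \<in> space (channel_space (block_len C)).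
    decoder C h (dest_received a b c \<rho> C m u h zr zd) \<noteq> m} =
    (\<lambda>(h, u, zr, zd). decoder C h (dest_received a b c \<rho> C m u h zr zd)) -` (- {m}) \<inter> space (channel_space (block_len C))"
    by auto
  show ?thesis unfolding * by (rule measurable_sets[OF measurable_decoded[OF C]]) auto
qed

text \<open>Integration in the order gains, seed, noise: for gains in \<open>H\<close> the bound on
  success applies to every seed, and for other gains the error is bounded below by 0.\<close>

lemma error_prob_ge:
  assumes C: "measurable_code C" "0 < num_msgs C"
    and H: "H \<in> sets gains"
    and \<beta>: "\<And>h u. h \<in> H \<Longrightarrow> (\<Sum>m<num_msgs C. measure (noise (block_len C) \<Otimes>\<^sub>M noise (block_len C))
      {(zr, zd) \<in> space (noise (block_len C) \<Otimes>\<^sub>M noise (block_len C)).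
        decoder C h (dest_received a b c \<rho> C m u h zr zd) = m}) / real (num_msgs C) \<le> \<beta>"
    and \<beta>1: "\<beta> \<le> 1"
  shows "(1 - \<beta>) * measure gains H \<le> error_prob a b c \<rho> C"
proof -
  define T where "T = block_len C"
  define M where "M = num_msgs C"
  let ?N = "noise T \<Otimes>\<^sub>M noise T"
  interpret N: prob_space ?N by (rule prob_space_noise_pair)
  interpret U: prob_space seed by (rule prob_space_seed)
  interpret UN: pair_prob_space seed ?N ..
  interpret G: prob_space gains by (rule prob_space_gains)
  interpret CS: prob_space "channel_space T" by (rule prob_space_channel_space)
  define E where "E m = {(h, u, zr, zd) \<in> space (channel_space T). decoder C h (dest_received a b c \<rho> C m u h zr zd) \<noteq> m}" for m
  have E: "E m \<in> sets (channel_space T)" for m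
    unfolding E_def T_def by (rule sets_decoding_error[OF C(1)])
  then have E': "E m \<in> sets (gains \<Otimes>\<^sub>M (seed \<Otimes>\<^sub>M ?N))" for m unfolding channel_space_def .
  have em: "emeasure (channel_space T) (E m) = (\<integral>\<^sup>+h. \<integral>\<^sup>+u. emeasure ?N (Pair u -` Pair h -` E m) \<partial>seed \<partial>gains)" for m
    unfolding channel_space_def
    by (subst UN.emeasure_pair_measure_alt[OF E'], intro nn_integral_cong, subst N.emeasure_pair_measure_alt)
      (use E' in \<open>auto intro: sets_Pair1\<close>)
  have meas: "(\<lambda>u. emeasure ?N (Pair u -` Pair h -` E m)) \<in> borel_measurable seed" for h m
    by (rule N.measurable_emeasure_Pair) (rule sets_Pair1[OF E'])
  have meas2: "(\<lambda>h. \<integral>\<^sup>+u. emeasure ?N (Pair u -` Pair h -` E m) \<partial>seed) \<in> borel_measurable gains" for m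
  proof -
    have "(\<lambda>h. emeasure (seed \<Otimes>\<^sub>M ?N) (Pair h -` E m)) \<in> borel_measurable gains"
      by (rule UN.measurable_emeasure_Pair[OF E'])
    also have "(\<lambda>h. emeasure (seed \<Otimes>\<^sub>M ?N) (Pair h -` E m)) = (\<lambda>h. \<integral>\<^sup>+u. emeasure ?N (Pair u -` Pair h -` E m) \<partial>seed)"
      by (intro ext N.emeasure_pair_measure_alt sets_Pair1[OF E'])
    finally show ?thesis .
  qed
  have low: "ennreal (real M * (1 - \<beta>)) * indicator H h \<le> (\<Sum>m<M. emeasure ?N (Pair u -` Pair h -` E m))"
    if hu: "h \<in> space gains" "u \<in> space seed" for h u
  proof (cases "h \<in> H")
    case True
    let ?S = "\<lambda>m. {(zr, zd) \<in> space ?N. decoder C h (dest_received a b c \<rho> C m u h zr zd) = m}"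
    have eq: "Pair u -` Pair h -` E m = space ?N - ?S m" for m
      using hu by (auto simp: E_def channel_space_def space_pair_measure)
    have S: "?S m \<in> sets ?N" for m
    proof -
      have "space ?N - (space ?N - ?S m) \<in> sets ?N"
        unfolding eq[symmetric] by (intro sets.Diff sets.top sets_Pair1[OF sets_Pair1[OF E']])
      also have "space ?N - (space ?N - ?S m) = ?S m" by auto
      finally show ?thesis .
    qed
    have "(\<Sum>m<M. emeasure ?N (Pair u -` Pair h -` E m)) = (\<Sum>m<M. ennreal (1 - measure ?N (?S m)))"
      unfolding eq by (intro sum.cong refl) (simp add: N.emeasure_eq_measure N.prob_compl[OF S])
    also have "\<dots> = ennreal (real M - (\<Sum>m<M. measure ?N (?S m)))"
      by (subst sum_ennreal) (auto simp: sum_subtractf)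
    also have "\<dots> \<ge> ennreal (real M * (1 - \<beta>))"
      using \<beta>[OF True, of u] C(2) unfolding T_def M_def
      by (intro ennreal_leI) (simp add: divide_le_eq algebra_simps)
    finally show ?thesis using True by simp
  qed simp
  have "ennreal (real M * (1 - \<beta>) * measure gains H) = (\<integral>\<^sup>+h. \<integral>\<^sup>+u. ennreal (real M * (1 - \<beta>)) * indicator H h \<partial>seed \<partial>gains)"
    using H \<beta>1 by (simp add: U.emeasure_space_1[simplified] nn_integral_cmult_indicator G.emeasure_eq_measure ennreal_mult)
  also have "\<dots> \<le> (\<integral>\<^sup>+h. \<integral>\<^sup>+u. (\<Sum>m<M. emeasure ?N (Pair u -` Pair h -` E m)) \<partial>seed \<partial>gains)"
    by (rule nn_integral_mono, rule nn_integral_mono, rule low)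
  also have "\<dots> = (\<integral>\<^sup>+h. (\<Sum>m<M. \<integral>\<^sup>+u. emeasure ?N (Pair u -` Pair h -` E m) \<partial>seed) \<partial>gains)"
    by (intro nn_integral_cong nn_integral_sum meas)
  also have "\<dots> = (\<Sum>m<M. \<integral>\<^sup>+h. \<integral>\<^sup>+u. emeasure ?N (Pair u -` Pair h -` E m) \<partial>seed \<partial>gains)"
    by (intro nn_integral_sum meas2)
  also have "\<dots> = (\<Sum>m<M. ennreal (measure (channel_space T) (E m)))"
    by (simp add: em[symmetric] CS.emeasure_eq_measure)
  also have "\<dots> = ennreal (\<Sum>m<M. measure (channel_space T) (E m))"
    by (rule sum_ennreal) simp
  finally have "real M * (1 - \<beta>) * measure gains H \<le> (\<Sum>m<M. measure (channel_space T) (E m))"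
    by (subst (asm) ennreal_le_iff) (auto intro: sum_nonneg)
  moreover have "error_prob a b c \<rho> C = (\<Sum>m<M. measure (channel_space T) (E m)) / real M"
    by (simp add: error_prob_def E_def T_def M_def)
  ultimately show ?thesis using C(2) by (simp add: M_def pos_le_divide_eq mult_ac)
qed

text \<open>The destination cut holds for each relay noise separately; this integrates it over that
  noise.\<close>

lemma avg_success_pair_le:
  assumes "prob_space N" and A: "\<And>m. m < M \<Longrightarrow> A m \<in> sets (N \<Otimes>\<^sub>M N)"
    and le: "\<And>z. (\<Sum>m<M. measure N (Pair z -` A m)) / real M \<le> \<beta>"
    and M: "0 < M"
  shows "(\<Sum>m<M::nat. measure (N \<Otimes>\<^sub>M N) (A m)) / real M \<le> \<beta>"
proof -
  interpret prob_space N by fact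
  interpret NN: pair_prob_space N N ..
  have \<beta>0: "0 \<le> \<beta>" by (rule order_trans[OF _ le[of undefined]]) (auto intro!: divide_nonneg_nonneg sum_nonneg)
  have "ennreal (\<Sum>m<M. measure (N \<Otimes>\<^sub>M N) (A m)) = (\<Sum>m<M. emeasure (N \<Otimes>\<^sub>M N) (A m))"
    by (simp add: NN.P.emeasure_eq_measure sum_ennreal)
  also have "\<dots> = (\<Sum>m<M. \<integral>\<^sup>+z. emeasure N (Pair z -` A m) \<partial>N)"
    by (intro sum.cong refl emeasure_pair_measure_alt A) auto
  also have "\<dots> = (\<integral>\<^sup>+z. (\<Sum>m<M. emeasure N (Pair z -` A m)) \<partial>N)"
    by (intro nn_integral_sum[symmetric] measurable_emeasure_Pair A) auto
  also have "\<dots> \<le> (\<integral>\<^sup>+z. ennreal (\<beta> * M) \<partial>N)"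
  proof (rule nn_integral_mono)
    fix z
    have "(\<Sum>m<M. emeasure N (Pair z -` A m)) = ennreal (\<Sum>m<M. measure N (Pair z -` A m))"
      by (simp add: emeasure_eq_measure sum_ennreal)
    also have "\<dots> \<le> ennreal (\<beta> * M)"
      using le[of z] M by (intro ennreal_leI) (simp add: divide_le_eq)
    finally show "(\<Sum>m<M. emeasure N (Pair z -` A m)) \<le> ennreal (\<beta> * M)" .
  qed
  also have "\<dots> = ennreal (\<beta> * M)" by (simp add: emeasure_space_1)
  finally have "(\<Sum>m<M. measure (N \<Otimes>\<^sub>M N) (A m)) \<le> \<beta> * M"
    using \<beta>0 by (subst (asm) ennreal_le_iff) auto
  then show ?thesis using M by (simp add: divide_le_eq)
qed

lemma small_gain_prob_ge:
  assumes "0 < \<rho>" "0 \<le> \<theta>"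
  shows "min 1 (\<theta> * \<rho> powr (- x)) / exp 1 \<le> measure complex_normal {h. (cmod h)\<^sup>2 * \<rho> powr x \<le> \<theta>}"
proof -
  have "{h. (cmod h)\<^sup>2 * \<rho> powr x \<le> \<theta>} = {h. (cmod h)\<^sup>2 \<le> \<theta> * \<rho> powr (- x)}"
    using assms by (auto simp: powr_minus field_simps)
  then show ?thesis using complex_normal_small_ge[of "\<theta> * \<rho> powr (- x)"] assms by simp
qed

lemma measure_gains_Times:
  assumes [measurable]: "A \<in> sets borel" "B \<in> sets borel" "D \<in> sets borel"
  shows "A \<times> B \<times> D \<in> sets gains"
    "measure gains (A \<times> B \<times> D) = measure complex_normal A * measure complex_normal B * measure complex_normal D"
proof -
  interpret P: pair_prob_space complex_normal complex_normal ..
  show "A \<times> B \<times> D \<in> sets gains" by measurable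
  show "measure gains (A \<times> B \<times> D) = measure complex_normal A * measure complex_normal B * measure complex_normal D"
    unfolding measure_def
    by (subst P.emeasure_pair_measure_Times, simp, simp, subst CN.emeasure_pair_measure_Times)
      (simp_all add: enn2real_mult)
qed

text \<open>A cut fails when both of its links are weak: the cut around the source for
  \<open>x = a\<close>, the one around the destination for \<open>x = b\<close>. The direct link
  crosses both cuts, whence the common factor with \<open>c\<close>.\<close>

lemma error_prob_cut_ge:
  assumes C: "relay_channel_code D C" and \<rho>: "0 < \<rho>" and \<theta>: "0 \<le> \<theta>" and x: "x = a \<or> x = b"
    and \<beta>: "(real (block_len C) * ln (1 + 4 * \<theta>) + ln 2) / ln (real (num_msgs C) + 1) \<le> \<beta>" "\<beta> \<le> 1"
  shows "(1 - \<beta>) * (min 1 (\<theta> * \<rho> powr (- x)) / exp 1 * (min 1 (\<theta> * \<rho> powr (- c)) / exp 1)) \<le> error_prob a b c \<rho> C"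
proof -
  have C': "measurable_code C" "0 < num_msgs C" "unit_power_source C" "unit_power_relay C"
    using C by (auto simp: relay_channel_code_def)
  define Sm where "Sm y = {h. (cmod h)\<^sup>2 * \<rho> powr y \<le> \<theta>}" for y
  have [measurable]: "Sm y \<in> sets borel" for y unfolding Sm_def by measurable
  \<comment> \<open>The gain of the link that does not cross the cut is left free.\<close>
  define H where "H = (if x = a then Sm a \<times> UNIV \<times> Sm c else UNIV \<times> Sm b \<times> Sm c)"
  have Hs: "H \<in> sets gains" by (auto simp: H_def intro!: measure_gains_Times(1))
  have "(1 - \<beta>) * measure gains H \<le> error_prob a b c \<rho> C"
  proof (rule error_prob_ge[OF C'(1,2) Hs _ \<beta>(2)])
    fix h u assume h: "h \<in> H"
    obtain hsr hrd hsd where hh: "h = (hsr, hrd, hsd)" by (cases h) auto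
    define T where "T = block_len C"
    show "(\<Sum>m<num_msgs C. measure (noise (block_len C) \<Otimes>\<^sub>M noise (block_len C))
      {(zr, zd) \<in> space (noise (block_len C) \<Otimes>\<^sub>M noise (block_len C)).
        decoder C h (dest_received a b c \<rho> C m u h zr zd) = m}) / real (num_msgs C) \<le> \<beta>"
    proof (cases "x = a")
      case True
      then show ?thesis
        using h unfolding hh by (intro order_trans[OF source_cut[where \<theta>=\<theta>] \<beta>(1)] C') (auto simp: H_def Sm_def)
    next
      case False
      show ?thesis
      proof (rule avg_success_pair_le[OF prob_space_noise _ _ C'(2)])
        fix m
        have E: "{(h, u, zr, zd) \<in> space (channel_space T). decoder C h (dest_received a b c \<rho> C m u h zr zd) \<noteq> m}
            \<in> sets (gains \<Otimes>\<^sub>M (seed \<Otimes>\<^sub>M (noise T \<Otimes>\<^sub>M noise T)))"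
          using sets_decoding_error[OF C'(1)] unfolding T_def channel_space_def .
        have "space (noise T \<Otimes>\<^sub>M noise T) - Pair u -` Pair h -` {(h, u, zr, zd) \<in> space (channel_space T). decoder C h (dest_received a b c \<rho> C m u h zr zd) \<noteq> m}
          \<in> sets (noise T \<Otimes>\<^sub>M noise T)"
          by (intro sets.Diff sets.top sets_Pair1[OF sets_Pair1[OF E]])
        also have "space (noise T \<Otimes>\<^sub>M noise T) - Pair u -` Pair h -` {(h, u, zr, zd) \<in> space (channel_space T). decoder C h (dest_received a b c \<rho> C m u h zr zd) \<noteq> m} =
          {(zr, zd) \<in> space (noise T \<Otimes>\<^sub>M noise T). decoder C h (dest_received a b c \<rho> C m u h zr zd) = m}"
          by (auto simp: channel_space_def space_pair_measure)
        finally show "{(zr, zd) \<in> space (noise (block_len C) \<Otimes>\<^sub>M noise (block_len C)).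
          decoder C h (dest_received a b c \<rho> C m u h zr zd) = m} \<in> sets (noise (block_len C) \<Otimes>\<^sub>M noise (block_len C))"
          unfolding T_def .
      next
        fix zr
        have "(\<Sum>m<num_msgs C. measure (noise T) (Pair zr -` {(zr, zd) \<in> space (noise T \<Otimes>\<^sub>M noise T).
            decoder C h (dest_received a b c \<rho> C m u h zr zd) = m})) \<le>
          (\<Sum>m<num_msgs C. measure (noise T) {zd \<in> space (noise T). decoder C h (dest_received a b c \<rho> C m u h zr zd) = m})"
        \<comment> \<open>The bound is asked for at every \<open>zr\<close>; outside the space the
          section is empty.\<close>
        proof (cases "zr \<in> space (noise T)")
          case True
          then show ?thesis
            by (intro sum_mono eq_refl arg_cong[where f="measure (noise T)"]) (auto simp: space_pair_measure)
        next
          case False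
          then have "Pair zr -` {(zr, zd) \<in> space (noise T \<Otimes>\<^sub>M noise T). decoder C h (dest_received a b c \<rho> C m u h zr zd) = m} = {}" for m
            by (auto simp: space_pair_measure)
          then show ?thesis by (simp only: measure_empty sum.neutral_const) (intro sum_nonneg measure_nonneg)
        qed
        also have "\<dots> / real (num_msgs C) \<le> \<beta>"
          using h False x unfolding hh T_def
          by (intro order_trans[OF destination_cut[where \<theta>=\<theta>] \<beta>(1)] C') (auto simp: H_def Sm_def)
        finally show "(\<Sum>m<num_msgs C. measure (noise (block_len C)) (Pair zr -` {(zr, zd) \<in> space (noise (block_len C) \<Otimes>\<^sub>M noise (block_len C)).
            decoder C h (dest_received a b c \<rho> C m u h zr zd) = m})) / real (num_msgs C) \<le> \<beta>"
          unfolding T_def by (simp add: divide_right_mono)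
      qed
    qed
  qed
  moreover have "measure gains H = measure complex_normal (Sm x) * measure complex_normal (Sm c)"
    using x CN.prob_space by (auto simp: H_def measure_gains_Times)
  moreover have "min 1 (\<theta> * \<rho> powr (- x)) / exp 1 * (min 1 (\<theta> * \<rho> powr (- c)) / exp 1) \<le> measure complex_normal (Sm x) * measure complex_normal (Sm c)"
    unfolding Sm_def using \<theta> by (intro mult_mono small_gain_prob_ge \<rho>) auto
  ultimately show ?thesis
    using \<beta>(2) mult_left_mono[of "min 1 (\<theta> * \<rho> powr (- x)) / exp 1 * (min 1 (\<theta> * \<rho> powr (- c)) / exp 1)" "measure gains H" "1 - \<beta>"]
    by simp
qed

section \<open>Converse\<close>

text \<open>A link of strength \<open>\<rho> powr x\<close> fails to carry multiplexing gain
  \<open>r\<close> with exponent \<open>max 0 (x - r)\<close>. The exponents of the two independent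
  links of a cut add up, and the cut with the weaker relay link dominates.\<close>

definition cutset_exponent :: "real \<Rightarrow> real \<Rightarrow> real \<Rightarrow> real \<Rightarrow> real" where
  "cutset_exponent a b c r = max 0 (c - r) + max 0 (min a b - r)"

text \<open>Since \<open>2 ^ 20 \<le> 3 ^ 13\<close>. When \<open>r = 0\<close> there may be only
  two messages, and then the Fano term is as large as this quotient; a capacity share of 1/4 on top
  still leaves a success bound of 9/10.\<close>

lemma ln2_div_ln3: "ln 2 / ln 3 \<le> (13/20 :: real)"
proof -
  have "20 * ln (2::real) = ln (2 ^ 20)" by (subst ln_realpow) auto
  also have "\<dots> \<le> ln (3 ^ 13)" by (subst ln_le_cancel_iff) auto
  also have "\<dots> = 13 * ln (3::real)" by (subst ln_realpow) auto
  finally show ?thesis by (simp add: divide_le_eq)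
qed

lemma code_rate:
  assumes "relay_channel_code D C" "rate C = R" "0 < R"
  shows "real (block_len C) * R = ln (real (num_msgs C))" "R \<le> ln (real (num_msgs C))" "2 \<le> num_msgs C"
proof -
  have C: "0 < block_len C" "0 < num_msgs C" using assms by (auto simp: relay_channel_code_def)
  show *: "real (block_len C) * R = ln (real (num_msgs C))"
    using assms(2) C by (auto simp: rate_def)
  have "1 * R \<le> real (block_len C) * R" using C assms(3) by (intro mult_right_mono) auto
  then show "R \<le> ln (real (num_msgs C))" using * by simp
  then have "0 < ln (real (num_msgs C))" using assms(3) by simp
  then show "2 \<le> num_msgs C" using C(2) by simp
qed

text \<open>The level \<open>\<theta>\<close> must be high enough for such gains not to be too rare,
  and low enough for the success bound to stay below 1 at every block length. If
  \<open>r > 0\<close>, the rate tends to infinity, the Fano term vanishes, and nearly the whole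
  rate may be granted to the cut. If \<open>r = 0\<close>, the rate may stay bounded, and a quarter
  of it is granted.\<close>

lemma outage_level:
  assumes r: "0 \<le> r" and R: "has_multiplexing_gain R r" and \<epsilon>: "0 < \<epsilon>"
  shows "\<exists>\<beta> \<theta>. \<beta> < 1 \<and> (\<forall>\<^sub>F \<rho> in at_top. 0 \<le> \<theta> \<rho> \<and> \<rho> powr (r - \<epsilon>) \<le> \<theta> \<rho> \<and>
    (\<forall>D C. relay_channel_code D C \<and> rate C = R \<rho> \<longrightarrow>
      (real (block_len C) * ln (1 + 4 * \<theta> \<rho>) + ln 2) / ln (real (num_msgs C) + 1) \<le> \<beta>))"
proof -
  obtain R0 where R0: "0 < R0" "\<forall>\<^sub>F \<rho> in at_top. R0 \<le> R \<rho>" and lim: "((\<lambda>\<rho>. R \<rho> / ln \<rho>) \<longlongrightarrow> r) at_top"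
    using R by (auto simp: has_multiplexing_gain_def)
  \<comment> \<open>Solves \<open>ln (1 + 4 * \<theta>) = \<kappa> * R\<close>: a cut at this level
    carries the fraction \<open>\<kappa>\<close> of the rate, and the block length then cancels in
    the Fano bound.\<close>
  define \<theta> where "\<theta> \<kappa> \<rho> = (exp (\<kappa> * R \<rho>) - 1) / 4" for \<kappa> \<rho>
  have \<theta>ln: "ln (1 + 4 * \<theta> \<kappa> \<rho>) = \<kappa> * R \<rho>" for \<kappa> \<rho>
  proof -
    have "1 + 4 * \<theta> \<kappa> \<rho> = exp (\<kappa> * R \<rho>)" unfolding \<theta>_def by (subst times_divide_eq_right, subst nonzero_mult_div_cancel_left) auto
    then show ?thesis by simp
  qed
  have \<beta>: "(real (block_len C) * ln (1 + 4 * \<theta> \<kappa> \<rho>) + ln 2) / ln (real (num_msgs C) + 1) \<le> \<kappa> + ln 2 / ln (real (num_msgs C) + 1)"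
    if "relay_channel_code D C" "rate C = R \<rho>" "R0 \<le> R \<rho>" "0 \<le> \<kappa>" for D C \<kappa> \<rho>
  proof -
    note cr = code_rate[OF that(1,2)]
    have M: "0 < R \<rho>" "2 \<le> num_msgs C" using that R0 cr by auto
    have "real (block_len C) * ln (1 + 4 * \<theta> \<kappa> \<rho>) = \<kappa> * (real (block_len C) * R \<rho>)" by (simp add: \<theta>ln)
    also have "\<dots> = \<kappa> * ln (real (num_msgs C))" using cr(1) M by simp
    also have "\<dots> \<le> \<kappa> * ln (real (num_msgs C) + 1)" using that M by (intro mult_left_mono) auto
    finally show ?thesis using M by (simp add: add_divide_distrib divide_le_eq)
  qed
  show ?thesis
  proof (cases "r = 0")
    case True
    have "\<forall>\<^sub>F \<rho> in at_top. \<rho> powr (r - \<epsilon>) \<le> R0 / 16"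
    proof -
      have "((\<lambda>\<rho>. \<rho> powr (- \<epsilon>)) \<longlongrightarrow> 0) at_top" using \<epsilon> by (intro tendsto_neg_powr filterlim_ident) auto
      then have "\<forall>\<^sub>F \<rho> in at_top. \<rho> powr (- \<epsilon>) < R0 / 16" using R0 by (intro order_tendstoD) auto
      then show ?thesis by (rule eventually_mono) (simp add: True)
    qed
    then have "\<forall>\<^sub>F \<rho> in at_top. 0 \<le> \<theta> (1/4) \<rho> \<and> \<rho> powr (r - \<epsilon>) \<le> \<theta> (1/4) \<rho> \<and>
      (\<forall>D C. relay_channel_code D C \<and> rate C = R \<rho> \<longrightarrow>
        (real (block_len C) * ln (1 + 4 * \<theta> (1/4) \<rho>) + ln 2) / ln (real (num_msgs C) + 1) \<le> 9/10)"
      using R0(2)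
    proof eventually_elim
      case (elim \<rho>)
      \<comment> \<open>The level is at least the constant \<open>(R0 / 4) / 4\<close>, below which
        \<open>\<rho> powr (- \<epsilon>)\<close> eventually falls.\<close>
      have "1 + 1/4 * R \<rho> \<le> exp (1/4 * R \<rho>)" by (rule exp_ge_add_one_self)
      moreover have "R0 / 16 \<le> (t - 1) / 4" if "1 + 1/4 * R \<rho> \<le> t" for t :: real
        using that elim(2) by simp
      ultimately have *: "R0 / 16 \<le> \<theta> (1/4) \<rho>" unfolding \<theta>_def by blast
      moreover have "(real (block_len C) * ln (1 + 4 * \<theta> (1/4) \<rho>) + ln 2) / ln (real (num_msgs C) + 1) \<le> 9/10"
        if C: "relay_channel_code D C" "rate C = R \<rho>" for D C
      proof -
        have M: "2 \<le> num_msgs C" using code_rate(3)[OF C] elim R0 by simp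
        have "ln 2 / ln (real (num_msgs C) + 1) \<le> ln 2 / ln 3"
          using M by (intro divide_left_mono) auto
        then show ?thesis using \<beta>[OF C elim(2), of "1/4"] ln2_div_ln3 by linarith
      qed
      ultimately show ?case using elim R0 by auto
    qed
    then show ?thesis by (intro exI[of _ "9/10"] exI[of _ "\<theta> (1/4)"]) auto
  next
    case False
    then have r: "0 < r" using r by simp
    \<comment> \<open>Capping by \<open>r\<close> keeps \<open>r - 3 * e / 4\<close> positive, so
      that the \<open>- 1\<close> and the division by 4 in \<open>\<theta>\<close> cost only a
      constant factor.\<close>
    define e where "e = min \<epsilon> r"
    have e: "0 < e" "e \<le> \<epsilon>" "e \<le> r" using \<epsilon> r by (auto simp: e_def)
    \<comment> \<open>Chosen so that \<open>(1 - \<delta>) * r = r - e / 2\<close>. A further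
      \<open>e / 4\<close> absorbs the limit of \<open>R \<rho> / ln \<rho>\<close>, and the last
      \<open>e / 4\<close> the constants in \<open>\<theta>\<close>.\<close>
    define \<delta> where "\<delta> = e / (2 * r)"
    have \<delta>: "0 < \<delta>" "\<delta> \<le> 1/2" using e r by (auto simp: \<delta>_def field_simps)
    have Rlim: "filterlim R at_top at_top"
    proof -
      have "filterlim (\<lambda>\<rho>. R \<rho> / ln \<rho> * ln \<rho>) at_top at_top"
        by (rule filterlim_tendsto_pos_mult_at_top[OF lim r ln_at_top])
      then show ?thesis
        by (rule filterlim_mono_eventually[OF _ order_refl order_refl])
          (auto intro!: eventually_mono[OF eventually_gt_at_top[of 1]])
    qed
    \<comment> \<open>From here on \<open>ln M \<ge> R\<close> pushes the Fano term below
      \<open>\<delta> / 2\<close>.\<close>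
    then have ev1: "\<forall>\<^sub>F \<rho> in at_top. 2 * ln 2 / \<delta> \<le> R \<rho>" by (simp add: filterlim_at_top)
    have "((\<lambda>\<rho>. (1 - \<delta>) * (R \<rho> / ln \<rho>)) \<longlongrightarrow> (1 - \<delta>) * r) at_top"
      by (intro tendsto_intros lim)
    moreover have "(1 - \<delta>) * r = r - e / 2" using r by (simp add: \<delta>_def field_simps)
    ultimately have "\<forall>\<^sub>F \<rho> in at_top. r - 3 * e / 4 < (1 - \<delta>) * (R \<rho> / ln \<rho>)"
      using e by (intro order_tendstoD) auto
    then have ev2: "\<forall>\<^sub>F \<rho> in at_top. \<rho> powr (r - 3 * e / 4) \<le> exp ((1 - \<delta>) * R \<rho>)"
      using eventually_gt_at_top[of 1]
    proof eventually_elim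
      case (elim \<rho>)
      then have "(r - 3 * e / 4) * ln \<rho> \<le> (1 - \<delta>) * R \<rho>"
        by (simp add: field_simps)
      then show ?case using elim by (simp add: powr_def)
    qed
    have ev3: "\<forall>\<^sub>F \<rho> in at_top. \<rho> powr (r - \<epsilon>) \<le> (\<rho> powr (r - 3 * e / 4) - 1) / 4"
    proof -
      have pos: "0 < r - 3 * e / 4" using e by linarith
      have "filterlim (\<lambda>\<rho>::real. \<rho> powr (r - 3 * e / 4)) at_top at_top" using pos by real_asymp
      then have 1: "\<forall>\<^sub>F \<rho> in at_top. 2 \<le> \<rho> powr (r - 3 * e / 4)" by (simp add: filterlim_at_top)
      have "filterlim (\<lambda>\<rho>::real. \<rho> powr (e / 4)) at_top at_top" using e by real_asymp
      then have 2: "\<forall>\<^sub>F \<rho> in at_top. 8 \<le> \<rho> powr (e / 4)" by (simp add: filterlim_at_top)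
      show ?thesis using 1 2 eventually_gt_at_top[of 1]
      proof eventually_elim
        case (elim \<rho>)
        have "8 * \<rho> powr (r - \<epsilon>) \<le> \<rho> powr (e / 4) * \<rho> powr (r - \<epsilon>)" using elim by (intro mult_right_mono) auto
        also have "\<dots> = \<rho> powr (e / 4 + (r - \<epsilon>))" by (simp add: powr_add)
        also have "\<dots> \<le> \<rho> powr (r - 3 * e / 4)" using elim e by (intro powr_mono) auto
        finally show ?case using elim(1) by simp
      qed
    qed
    have "\<forall>\<^sub>F \<rho> in at_top. 0 \<le> \<theta> (1 - \<delta>) \<rho> \<and> \<rho> powr (r - \<epsilon>) \<le> \<theta> (1 - \<delta>) \<rho> \<and>
      (\<forall>D C. relay_channel_code D C \<and> rate C = R \<rho> \<longrightarrow>
        (real (block_len C) * ln (1 + 4 * \<theta> (1 - \<delta>) \<rho>) + ln 2) / ln (real (num_msgs C) + 1) \<le> 1 - \<delta> / 2)"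
      using ev1 ev2 ev3 R0(2) eventually_gt_at_top[of 0]
    proof eventually_elim
      case (elim \<rho>)
      have *: "\<rho> powr (r - \<epsilon>) \<le> \<theta> (1 - \<delta>) \<rho>" using elim by (simp add: \<theta>_def)
      moreover have "0 \<le> \<theta> (1 - \<delta>) \<rho>" by (rule order_trans[OF _ *]) simp
      moreover have "(real (block_len C) * ln (1 + 4 * \<theta> (1 - \<delta>) \<rho>) + ln 2) / ln (real (num_msgs C) + 1) \<le> 1 - \<delta> / 2"
        if C: "relay_channel_code D C" "rate C = R \<rho>" for D C
      proof -
        have Rp: "0 < R \<rho>" using elim R0 by simp
        note cr = code_rate[OF C Rp]
        have "2 * ln 2 / \<delta> \<le> ln (real (num_msgs C))" using cr elim by simp
        also have "\<dots> \<le> ln (real (num_msgs C) + 1)" using cr(3) by auto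
        finally have "ln 2 \<le> \<delta> / 2 * ln (real (num_msgs C) + 1)" using \<delta> by (simp add: field_simps)
        then have "ln 2 / ln (real (num_msgs C) + 1) \<le> \<delta> / 2" using cr(3) by (simp add: divide_le_eq)
        then show ?thesis using \<beta>[OF C elim(4), of "1 - \<delta>"] \<delta> by simp
      qed
      ultimately show ?case by auto
    qed
    then show ?thesis using \<delta> by (intro exI[of _ "1 - \<delta>/2"] exI[of _ "\<theta> (1 - \<delta>)"]) auto
  qed
qed

text \<open>\<open>K\<close> and the threshold for \<open>\<rho>\<close> come before the code. The
  bound therefore holds for all codes of the given rate at once, in both duplex modes, and survives
  averaging over random codes.\<close>

lemma converse:
  assumes r: "0 \<le> r" and R: "has_multiplexing_gain R r" and \<epsilon>: "0 < \<epsilon>"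
  shows "\<exists>K>0. \<forall>\<^sub>F \<rho> in at_top. \<forall>D C. relay_channel_code D C \<and> rate C = R \<rho> \<longrightarrow>
    K * \<rho> powr (- (cutset_exponent a b c r + \<epsilon>)) \<le> error_prob a b c \<rho> C"
proof -
  obtain \<beta> \<theta> where \<beta>: "\<beta> < 1" and ev: "\<forall>\<^sub>F \<rho> in at_top. 0 \<le> \<theta> \<rho> \<and> \<rho> powr (r - \<epsilon> / 2) \<le> \<theta> \<rho> \<and>
    (\<forall>D C. relay_channel_code D C \<and> rate C = R \<rho> \<longrightarrow>
      (real (block_len C) * ln (1 + 4 * \<theta> \<rho>) + ln 2) / ln (real (num_msgs C) + 1) \<le> \<beta>)"
    using outage_level[OF r R, of "\<epsilon> / 2"] \<epsilon> by auto
  define K where "K = (1 - \<beta>) / (exp 1 * exp 1)"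
  have "\<forall>\<^sub>F \<rho> in at_top. \<forall>D C. relay_channel_code D C \<and> rate C = R \<rho> \<longrightarrow>
    K * \<rho> powr (- (cutset_exponent a b c r + \<epsilon>)) \<le> error_prob a b c \<rho> C"
    using ev eventually_gt_at_top[of 1]
  proof eventually_elim
    case (elim \<rho>)
    \<comment> \<open>Each of the two links gets half of \<open>\<epsilon>\<close>; the
      \<open>min\<close> with 1 corresponds to the \<open>max\<close> with 0 in the
      exponent.\<close>
    have m: "\<rho> powr (- (max 0 (y - r) + \<epsilon> / 2)) \<le> min 1 (\<theta> \<rho> * \<rho> powr (- y))" for y
    proof (rule min.boundedI)
      have "\<rho> powr (- (max 0 (y - r) + \<epsilon> / 2)) \<le> \<rho> powr 0"
        using elim(2) \<epsilon> max.cobounded1[of 0 "y - r"] by (intro powr_mono) linarith+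
      then show "\<rho> powr (- (max 0 (y - r) + \<epsilon> / 2)) \<le> 1" using elim by simp
      have "\<rho> powr (- (max 0 (y - r) + \<epsilon> / 2)) \<le> \<rho> powr (r - \<epsilon> / 2 + - y)"
        using elim(2) max.cobounded2[of "y - r" 0] by (intro powr_mono) linarith+
      also have "\<dots> = \<rho> powr (r - \<epsilon> / 2) * \<rho> powr (- y)" by (rule powr_add)
      also have "\<dots> \<le> \<theta> \<rho> * \<rho> powr (- y)" using elim by (intro mult_right_mono) auto
      finally show "\<rho> powr (- (max 0 (y - r) + \<epsilon> / 2)) \<le> \<theta> \<rho> * \<rho> powr (- y)" .
    qed
    show ?case
    proof (intro allI impI, elim conjE)
      fix D C assume C: "relay_channel_code D C" "rate C = R \<rho>"
      let ?x = "min a b"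
      have "\<rho> powr (- (cutset_exponent a b c r + \<epsilon>)) =
          \<rho> powr (- (max 0 (?x - r) + \<epsilon> / 2)) * \<rho> powr (- (max 0 (c - r) + \<epsilon> / 2))"
        unfolding powr_add[symmetric] by (rule arg_cong[where f="\<lambda>y. \<rho> powr y"]) (simp add: cutset_exponent_def)
      then have "K * \<rho> powr (- (cutset_exponent a b c r + \<epsilon>)) =
          (1 - \<beta>) * (\<rho> powr (- (max 0 (?x - r) + \<epsilon> / 2)) / exp 1 * (\<rho> powr (- (max 0 (c - r) + \<epsilon> / 2)) / exp 1))"
        by (simp add: K_def)
      also have "\<dots> \<le> (1 - \<beta>) * (min 1 (\<theta> \<rho> * \<rho> powr (- ?x)) / exp 1 * (min 1 (\<theta> \<rho> * \<rho> powr (- c)) / exp 1))"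
        using \<beta> elim by (intro mult_left_mono mult_mono divide_right_mono m) auto
      also have "\<dots> \<le> error_prob a b c \<rho> C"
        using elim C \<beta> by (intro error_prob_cut_ge[where D=D]) (auto simp: min_def)
      finally show "K * \<rho> powr (- (cutset_exponent a b c r + \<epsilon>)) \<le> error_prob a b c \<rho> C" .
    qed
  qed
  then show ?thesis using \<beta> by (intro exI[of _ K]) (simp add: K_def)
qed

section \<open>Random codewords\<close>

text \<open>A bound for one resampled coordinate that is uniform in all others bounds the whole
  integral. The index set may be infinite, as it is for the relay codebook, so the coordinate is
  split off by \<open>distr_pair_PiM_eq_PiM\<close>.\<close>

lemma nn_integral_PiM_section_le:
  fixes f :: "('i \<Rightarrow> 'a) \<Rightarrow> ennreal"
  assumes M: "\<And>j. j \<in> I \<Longrightarrow> prob_space (M j)" and i: "i \<in> I"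
    and f [measurable]: "f \<in> borel_measurable (PiM I M)"
    and le: "\<And>X. X \<in> space (PiM (I - {i}) M) \<Longrightarrow> (\<integral>\<^sup>+x. f (X(i := x)) \<partial>M i) \<le> c"
  shows "(\<integral>\<^sup>+X. f X \<partial>PiM I M) \<le> c"
proof -
  have ins: "insert i (I - {i}) = I" using i by auto
  interpret Mi: prob_space "M i" by (rule M[OF i])
  interpret R: prob_space "PiM (I - {i}) M" using M by (intro prob_space_PiM) auto
  interpret P: pair_prob_space "M i" "PiM (I - {i}) M" ..
  have upd [measurable]: "(\<lambda>(x, X). X(i := x)) \<in> M i \<Otimes>\<^sub>M PiM (I - {i}) M \<rightarrow>\<^sub>M PiM I M"
    unfolding split_beta by (rule measurable_fun_upd[where J="I - {i}"]) (use i in auto)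
  have "(\<integral>\<^sup>+X. f X \<partial>PiM I M) = (\<integral>\<^sup>+X. f X \<partial>distr (M i \<Otimes>\<^sub>M PiM (I - {i}) M) (PiM I M) (\<lambda>(x, X). X(i := x)))"
    by (subst distr_pair_PiM_eq_PiM[of "I - {i}" M i, unfolded ins]) (use M i in auto)
  also have "\<dots> = (\<integral>\<^sup>+p. f ((\<lambda>(x, X). X(i := x)) p) \<partial>(M i \<Otimes>\<^sub>M PiM (I - {i}) M))"
    by (rule nn_integral_distr[OF upd]) simp
  also have "\<dots> = (\<integral>\<^sup>+X. \<integral>\<^sup>+x. f (X(i := x)) \<partial>M i \<partial>PiM (I - {i}) M)"
    using P.nn_integral_snd[of "\<lambda>p. f ((\<lambda>(x, X). X(i := x)) p)"] by simp
  also have "\<dots> \<le> (\<integral>\<^sup>+X. c \<partial>PiM (I - {i}) M)"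
    by (rule nn_integral_mono) (rule le)
  also have "\<dots> = c" by (simp add: R.emeasure_space_1)
  finally show ?thesis .
qed

lemma emeasure_PiM_section_le:
  assumes M: "\<And>j. j \<in> I \<Longrightarrow> prob_space (M j)" and i: "i \<in> I"
    and A: "A \<in> sets (PiM I M)"
    and le: "\<And>X. X \<in> space (PiM (I - {i}) M) \<Longrightarrow> emeasure (M i) {x \<in> space (M i). X(i := x) \<in> A} \<le> c"
  shows "emeasure (PiM I M) A \<le> c"
proof -
  have "emeasure (PiM I M) A = (\<integral>\<^sup>+X. indicator A X \<partial>PiM I M)" using A by simp
  also have "\<dots> \<le> c"
  proof (rule nn_integral_PiM_section_le[OF M i])
    fix X assume X: "X \<in> space (PiM (I - {i}) M)"
    have "(\<lambda>x. X(i := x)) \<in> M i \<rightarrow>\<^sub>M PiM (insert i (I - {i})) M"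
      using X by (intro measurable_component_update) auto
    then have upd: "(\<lambda>x. X(i := x)) \<in> M i \<rightarrow>\<^sub>M PiM I M"
      using i by (simp add: insert_absorb)
    have S: "{x \<in> space (M i). X(i := x) \<in> A} \<in> sets (M i)"
      using measurable_sets[OF upd A] by (simp add: vimage_def Int_def conj_commute)
    have "(\<integral>\<^sup>+x. indicator A (X(i := x)) \<partial>M i) = (\<integral>\<^sup>+x. indicator {x \<in> space (M i). X(i := x) \<in> A} x \<partial>M i)"
      by (intro nn_integral_cong) (auto split: split_indicator)
    also have "\<dots> \<le> c" using S le[OF X] by simp
    finally show "(\<integral>\<^sup>+x. indicator A (X(i := x)) \<partial>M i) \<le> c" .
  qed (use A in auto)
  finally show ?thesis .
qed

section \<open>Codewords with letters uniform on the unit disc\<close>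

abbreviation disc :: "complex measure" where
  "disc \<equiv> uniform_measure lborel (cball 0 1)"

lemma prob_space_disc: "prob_space disc"
  by (rule prob_space_uniform_measure) (auto simp: emeasure_cball_complex)

lemma prob_space_random_codeword: "prob_space (random_codeword k)"
  unfolding random_codeword_def by (intro prob_space_PiM prob_space_disc)

lemma prob_space_qmf_ensemble: "prob_space (qmf_ensemble n M)"
  unfolding qmf_ensemble_def by (intro prob_space_pair prob_space_PiM prob_space_random_codeword)

text \<open>With \<open>max\<close>, the bound is 1 for weak gains, and \<open>g = 0\<close> causes no division by 0.\<close>

definition hit_bound :: "real \<Rightarrow> complex \<Rightarrow> real" where
  "hit_bound t g = t\<^sup>2 / max (t\<^sup>2) ((cmod g)\<^sup>2)"

lemma hit_bound: "0 < t \<Longrightarrow> 0 < hit_bound t g" "hit_bound t g \<le> 1"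
  by (auto simp: hit_bound_def divide_le_eq less_max_iff_disj)

text \<open>The letters in question fill a disc of radius \<open>t / cmod g\<close>, whose area
  relative to the unit disc is \<open>(t / cmod g)\<^sup>2\<close>. For
  \<open>cmod g \<le> t\<close> the bound is 1.\<close>

lemma emeasure_disc_le:
  assumes t: "0 < t"
  shows "emeasure disc {x. cmod (w - g * x) \<le> t} \<le> ennreal (hit_bound t g)"
proof (cases "(cmod g)\<^sup>2 \<le> t\<^sup>2")
  case True
  interpret prob_space disc by (rule prob_space_disc)
  have "hit_bound t g = 1" using True t by (simp add: hit_bound_def)
  then show ?thesis using emeasure_le_1 by (simp only: ennreal_1)
next
  case False
  then have g: "g \<noteq> 0" using t by auto
  have eq: "{x. cmod (w - g * x) \<le> t} = cball (w / g) (t / cmod g)"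
  proof -
    have "cmod (w - g * x) = cmod g * cmod (w / g - x)" for x
      using g by (simp flip: norm_mult add: right_diff_distrib)
    then show ?thesis using g by (auto simp: dist_norm field_simps)
  qed
  have "emeasure disc (cball (w / g) (t / cmod g)) = emeasure lborel (cball 0 1 \<inter> cball (w / g) (t / cmod g)) / emeasure lborel (cball 0 1 :: complex set)"
    by (rule emeasure_uniform_measure) auto
  also have "\<dots> \<le> emeasure lborel (cball (w / g) (t / cmod g)) / emeasure lborel (cball 0 1 :: complex set)"
    by (intro divide_right_mono_ennreal emeasure_mono) auto
  also have "\<dots> = ennreal (pi * (t / cmod g)\<^sup>2) / ennreal pi"
    using t by (simp add: emeasure_cball_complex)
  also have "\<dots> = ennreal (hit_bound t g)"
    using False by (subst divide_ennreal) (auto simp: hit_bound_def max_def power_divide)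
  finally show ?thesis unfolding eq .
qed

lemma space_random_codeword: "space (random_codeword k) = {..<k} \<rightarrow>\<^sub>E UNIV"
  unfolding random_codeword_def by (simp add: space_PiM)

lemma emeasure_random_codeword:
  assumes A: "\<And>i. i < k \<Longrightarrow> A i \<in> sets borel"
  shows "emeasure (random_codeword k) {x \<in> space (random_codeword k). \<forall>i<k. x i \<in> A i} = (\<Prod>i<k. emeasure disc (A i))"
    "{x \<in> space (random_codeword k). \<forall>i<k. x i \<in> A i} \<in> sets (random_codeword k)"
proof -
  interpret product_sigma_finite "\<lambda>_::nat. disc"
    by (rule product_sigma_finite.intro) (rule prob_space_imp_sigma_finite[OF prob_space_disc])
  have eq: "{x \<in> space (random_codeword k). \<forall>i<k. x i \<in> A i} = PiE {..<k} A"
    unfolding space_random_codeword PiE_def Pi_def by blast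
  show "emeasure (random_codeword k) {x \<in> space (random_codeword k). \<forall>i<k. x i \<in> A i} = (\<Prod>i<k. emeasure disc (A i))"
    unfolding eq unfolding random_codeword_def using A by (intro emeasure_PiM) auto
  show "{x \<in> space (random_codeword k). \<forall>i<k. x i \<in> A i} \<in> sets (random_codeword k)"
    unfolding eq unfolding random_codeword_def using A by (intro sets_PiM_I_finite) auto
qed

lemma prod_double: "(\<Prod>i<2 * n. f i) = (\<Prod>i<n. f i) * (\<Prod>i<n. f (n + i :: nat) :: 'a :: comm_monoid_mult)"
proof -
  have "{..<2 * n} = {..<n} \<union> {n..<2 * n}" by auto
  then have "(\<Prod>i<2 * n. f i) = prod f ({..<n} \<union> {n..<2 * n})" by (rule arg_cong)
  also have "\<dots> = (\<Prod>i<n. f i) * (\<Prod>i\<in>{n..<2 * n}. f i)"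
    by (rule prod.union_disjoint) auto
  also have "(\<Prod>i\<in>{n..<2 * n}. f i) = (\<Prod>i<n. f (n + i))"
    by (rule prod.reindex_bij_witness[of _ "\<lambda>i. n + i" "\<lambda>i. i - n"]) auto
  finally show ?thesis .
qed

text \<open>Letter \<open>n + i\<close> is paired with letter \<open>i\<close> because a match tests
  both in one clause.\<close>

lemma emeasure_random_codeword_halves:
  assumes A: "\<And>i. i < n \<Longrightarrow> A i \<in> sets borel" and B: "\<And>i. i < n \<Longrightarrow> B i \<in> sets borel"
  shows "emeasure (random_codeword (2 * n)) {x \<in> space (random_codeword (2 * n)). \<forall>i<n. x i \<in> A i \<and> x (n + i) \<in> B i} =
      (\<Prod>i<n. emeasure disc (A i)) * (\<Prod>i<n. emeasure disc (B i))"
    "{x \<in> space (random_codeword (2 * n)). \<forall>i<n. x i \<in> A i \<and> x (n + i) \<in> B i} \<in> sets (random_codeword (2 * n))"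
proof -
  define C where "C i = (if i < n then A i else B (i - n))" for i
  have C: "C i \<in> sets borel" if "i < 2 * n" for i using A B that by (auto simp: C_def)
  have all: "(\<forall>i<2 * n. x i \<in> C i) \<longleftrightarrow> (\<forall>i<n. x i \<in> A i \<and> x (n + i) \<in> B i)" for x
  proof safe
    fix i assume *: "\<forall>i<2 * n. x i \<in> C i" "i < n"
    show "x i \<in> A i" using *(1)[rule_format, of i] *(2) by (simp add: C_def)
    show "x (n + i) \<in> B i" using *(1)[rule_format, of "n + i"] *(2) by (simp add: C_def)
  next
    fix i assume *: "\<forall>i<n. x i \<in> A i \<and> x (n + i) \<in> B i" "i < 2 * n"
    show "x i \<in> C i" using *(1)[rule_format, of i] *(1)[rule_format, of "i - n"] *(2) by (auto simp: C_def)
  qed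
  show "emeasure (random_codeword (2 * n)) {x \<in> space (random_codeword (2 * n)). \<forall>i<n. x i \<in> A i \<and> x (n + i) \<in> B i} =
      (\<Prod>i<n. emeasure disc (A i)) * (\<Prod>i<n. emeasure disc (B i))"
  proof -
    have "emeasure (random_codeword (2 * n)) {x \<in> space (random_codeword (2 * n)). \<forall>i<2 * n. x i \<in> C i} = (\<Prod>i<2 * n. emeasure disc (C i))"
      by (rule emeasure_random_codeword) (rule C)
    also have "\<dots> = (\<Prod>i<n. emeasure disc (A i)) * (\<Prod>i<n. emeasure disc (B i))"
      unfolding prod_double by (intro arg_cong2[where f="(*)"] prod.cong) (auto simp: C_def)
    finally show ?thesis unfolding all .
  qed
  show "{x \<in> space (random_codeword (2 * n)). \<forall>i<n. x i \<in> A i \<and> x (n + i) \<in> B i} \<in> sets (random_codeword (2 * n))"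
    unfolding all[symmetric] by (rule emeasure_random_codeword(2)[OF C])
qed

lemma prod_ennreal_le_power:
  assumes "\<And>i. i < n \<Longrightarrow> f i \<le> ennreal p" "0 \<le> p"
  shows "(\<Prod>i<n::nat. f i) \<le> ennreal (p ^ n)"
proof -
  have "(\<Prod>i<n. f i) \<le> (\<Prod>i<n. ennreal p)" using assms by (intro prod_mono_ennreal) auto
  then show ?thesis using assms by (simp add: ennreal_power)
qed

section \<open>Quantized sequences and their number\<close>

lemma quantize_error: "cmod (quantize z - z) \<le> 1"
proof -
  have 1: "\<bar>of_int (round x) - x\<bar> \<le> 1/2" for x :: real by (rule of_int_round_abs_le)
  have "(of_int (round x) - x)\<^sup>2 \<le> (1/2)\<^sup>2" for x :: real
    using power_mono[OF 1[of x] abs_ge_zero, of 2] by simp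
  from add_mono[OF this[of "Re z"] this[of "Im z"]]
  have "(cmod (quantize z - z))\<^sup>2 \<le> 1\<^sup>2"
    unfolding cmod_power2 by (simp add: quantize_def power2_eq_square)
  then show ?thesis by (rule power2_le_imp_le) simp
qed

lemma range_quantize: "range quantize \<subseteq> (\<lambda>(x, y). Complex (of_int x) (of_int y)) ` UNIV"
  by (auto simp: quantize_def)

lemma countable_range_quantize: "countable (range quantize)"
  by (rule countable_subset[OF range_quantize]) auto

lemma card_int_interval:
  "finite {k::int. \<bar>of_int k - w\<bar> \<le> (t::real)}" "0 \<le> t \<Longrightarrow> real (card {k::int. \<bar>of_int k - w\<bar> \<le> t}) \<le> 2 * t + 1"
proof -
  have eq: "{k::int. \<bar>of_int k - w\<bar> \<le> t} = {\<lceil>w - t\<rceil>..\<lfloor>w + t\<rfloor>}"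
    by (auto simp: ceiling_le_iff le_floor_iff)
  show "finite {k::int. \<bar>of_int k - w\<bar> \<le> t}" unfolding eq by simp
  assume "0 \<le> t"
  have "real_of_int \<lfloor>w + t\<rfloor> \<le> w + t" "w - t \<le> real_of_int \<lceil>w - t\<rceil>" by auto
  note fl = this
  show "real (card {k::int. \<bar>of_int k - w\<bar> \<le> t}) \<le> 2 * t + 1"
  proof (cases "0 \<le> \<lfloor>w + t\<rfloor> - \<lceil>w - t\<rceil> + 1")
    case True
    then have "real (card {k::int. \<bar>of_int k - w\<bar> \<le> t}) = real_of_int \<lfloor>w + t\<rfloor> - real_of_int \<lceil>w - t\<rceil> + 1"
      unfolding eq by simp
    then show ?thesis using fl by linarith
  next
    case False
    then show ?thesis unfolding eq using \<open>0 \<le> t\<close> by simp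
  qed
qed

lemma card_quantize_ball:
  assumes "0 \<le> t"
  shows "finite {k \<in> range quantize. cmod (k - w) \<le> t}"
    "real (card {k \<in> range quantize. cmod (k - w) \<le> t}) \<le> (2 * t + 1)\<^sup>2"
proof -
  let ?A = "{k::int. \<bar>of_int k - Re w\<bar> \<le> t}" and ?B = "{k::int. \<bar>of_int k - Im w\<bar> \<le> t}"
  let ?f = "\<lambda>(x, y). Complex (of_int x) (of_int y)"
  have sub: "{k \<in> range quantize. cmod (k - w) \<le> t} \<subseteq> ?f ` (?A \<times> ?B)"
  proof
    fix k assume "k \<in> {k \<in> range quantize. cmod (k - w) \<le> t}"
    then obtain x y where k: "k = Complex (of_int x) (of_int y)" and le: "cmod (k - w) \<le> t"
      using range_quantize by auto
    have "\<bar>of_int x - Re w\<bar> \<le> t" "\<bar>of_int y - Im w\<bar> \<le> t"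
      using abs_Re_le_cmod[of "k - w"] abs_Im_le_cmod[of "k - w"] le by (auto simp: k)
    then show "k \<in> ?f ` (?A \<times> ?B)" unfolding k by (intro image_eqI[where x="(x, y)"]) auto
  qed
  have fin: "finite (?A \<times> ?B)" by (intro finite_cartesian_product card_int_interval)
  show "finite {k \<in> range quantize. cmod (k - w) \<le> t}"
    by (rule finite_subset[OF sub]) (intro finite_imageI fin)
  have "card {k \<in> range quantize. cmod (k - w) \<le> t} \<le> card (?A \<times> ?B)"
    by (rule order_trans[OF card_mono[OF _ sub] card_image_le[OF fin]]) (intro finite_imageI fin)
  then have "real (card {k \<in> range quantize. cmod (k - w) \<le> t}) \<le> real (card ?A) * real (card ?B)"
    unfolding card_cartesian_product of_nat_mult[symmetric] of_nat_le_iff .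
  also have "\<dots> \<le> (2 * t + 1) * (2 * t + 1)"
    using assms by (intro mult_mono card_int_interval(2)) auto
  finally show "real (card {k \<in> range quantize. cmod (k - w) \<le> t}) \<le> (2 * t + 1)\<^sup>2"
    by (simp add: power2_eq_square)
qed

abbreviation quantized :: "nat \<Rightarrow> (nat \<Rightarrow> complex) set" where
  "quantized n \<equiv> {..<n} \<rightarrow>\<^sub>E range quantize"

lemma countable_quantized: "countable (quantized n)"
  by (intro countable_PiE countable_range_quantize) auto

text \<open>A source codeword explains only this many relay sequences. With \<open>t\<close>
  logarithmic in \<open>\<rho>\<close>, the count per letter is below every power of
  \<open>\<rho>\<close>, so quantizing at noise level costs no multiplexing gain.\<close>

lemma card_quantized_near:
  assumes "0 \<le> t"
  shows "finite {q \<in> quantized n. \<forall>i<n. cmod (q i - w i) \<le> t}"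
    "real (card {q \<in> quantized n. \<forall>i<n. cmod (q i - w i) \<le> t}) \<le> ((2 * t + 1)\<^sup>2) ^ n"
proof -
  have eq: "{q \<in> quantized n. \<forall>i<n. cmod (q i - w i) \<le> t} = (\<Pi>\<^sub>E i\<in>{..<n}. {k \<in> range quantize. cmod (k - w i) \<le> t})"
    unfolding PiE_def Pi_def by blast
  show "finite {q \<in> quantized n. \<forall>i<n. cmod (q i - w i) \<le> t}"
    unfolding eq by (intro finite_PiE card_quantize_ball assms) auto
  have "real (card {q \<in> quantized n. \<forall>i<n. cmod (q i - w i) \<le> t}) = (\<Prod>i<n. real (card {k \<in> range quantize. cmod (k - w i) \<le> t}))"
    unfolding eq by (subst card_PiE) auto
  also have "\<dots> \<le> (\<Prod>i<n. (2 * t + 1)\<^sup>2)"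
    using assms by (intro prod_mono conjI card_quantize_ball) auto
  finally show "real (card {q \<in> quantized n. \<forall>i<n. cmod (q i - w i) \<le> t}) \<le> ((2 * t + 1)\<^sup>2) ^ n" by simp
qed

section \<open>Codebook confusion\<close>

text \<open>The first conjunct confines \<open>q\<close> to a finite set that does not depend on the
  codeword, so that union bounds over \<open>q\<close> are finite sums.\<close>

definition qmf_match ::
  "real \<Rightarrow> nat \<Rightarrow> complex \<Rightarrow> complex \<Rightarrow> complex \<Rightarrow> (nat \<Rightarrow> complex) \<Rightarrow> ((nat \<Rightarrow> complex) \<Rightarrow> nat \<Rightarrow> complex) \<Rightarrow>
    (nat \<Rightarrow> complex) \<Rightarrow> (nat \<Rightarrow> complex) \<Rightarrow> bool"
where
  "qmf_match t n gs gr gd x F y q \<longleftrightarrow>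
    (\<forall>i<n. cmod (q i) \<le> cmod gs + t \<and> cmod (q i - gs * x i) \<le> t \<and> cmod (y i - gd * x i) \<le> t \<and>
      cmod (y (n + i) - gr * F q i - gd * x (n + i)) \<le> t)"

definition relay_word :: "nat \<Rightarrow> complex \<Rightarrow> (nat \<Rightarrow> complex) \<Rightarrow> (nat \<Rightarrow> complex) \<Rightarrow> nat \<Rightarrow> complex" where
  "relay_word n gs z x = (\<lambda>i\<in>{..<n}. quantize (gs * x i + z i))"

text \<open>Closed form of the signal at the destination when a QMF code is used;
  \<open>dest_received_qmf_code\<close> identifies the two.\<close>

definition qmf_output ::
  "nat \<Rightarrow> complex \<Rightarrow> complex \<Rightarrow> complex \<Rightarrow> (nat \<Rightarrow> complex) \<Rightarrow> (nat \<Rightarrow> complex) \<Rightarrow> (nat \<Rightarrow> complex) \<Rightarrow>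
    ((nat \<Rightarrow> complex) \<Rightarrow> nat \<Rightarrow> complex) \<Rightarrow> nat \<Rightarrow> complex"
where
  "qmf_output n gs gr gd zr zd x F i =
    gd * x i + (if i < n then 0 else gr * F (relay_word n gs zr x) (i - n)) + zd i"

lemma relay_word_quantized: "relay_word n gs z x \<in> quantized n"
  by (auto simp: relay_word_def)

lemma measurable_quantize [measurable]: "quantize \<in> borel \<rightarrow>\<^sub>M borel"
proof -
  have "quantize = (\<lambda>z. complex_of_real (real_of_int \<lfloor>Re z + 1/2\<rfloor>) + \<i> * complex_of_real (real_of_int \<lfloor>Im z + 1/2\<rfloor>))"
    by (auto simp: quantize_def round_def complex_eq_iff fun_eq_iff)
  also have "\<dots> \<in> borel \<rightarrow>\<^sub>M borel" by measurable
  finally show ?thesis .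
qed

text \<open>The relay codebook is read at this random index. Since the index takes countably many
  values, reading preserves measurability.\<close>

lemma measurable_relay_word:
  assumes gs [measurable]: "gs \<in> borel_measurable S"
    and x: "\<And>i. i < n \<Longrightarrow> (\<lambda>p. x p i) \<in> borel_measurable S"
    and z: "\<And>i. i < n \<Longrightarrow> (\<lambda>p. z p i) \<in> borel_measurable S"
  shows "(\<lambda>p. relay_word n (gs p) (z p) (x p)) \<in> S \<rightarrow>\<^sub>M count_space (quantized n)"
proof (subst measurable_count_space_eq_countable[OF countable_quantized], intro conjI ballI)
  show "(\<lambda>p. relay_word n (gs p) (z p) (x p)) \<in> space S \<rightarrow> quantized n"
    using relay_word_quantized by auto
  fix k assume k: "k \<in> quantized n"
  have "(\<lambda>p. relay_word n (gs p) (z p) (x p)) -` {k} \<inter> space S =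
      {p \<in> space S. \<forall>i\<in>{..<n}. quantize (gs p * x p i + z p i) = k i}"
    using k by (auto simp: relay_word_def PiE_iff extensional_def fun_eq_iff)
  also have "\<dots> \<in> sets S"
  proof (rule sets.sets_Collect_finite_All)
    fix i assume "i \<in> {..<n}"
    then have [measurable]: "(\<lambda>p. x p i) \<in> borel_measurable S" "(\<lambda>p. z p i) \<in> borel_measurable S"
      using x z by auto
    show "{p \<in> space S. quantize (gs p * x p i + z p i) = k i} \<in> sets S" by measurable
  qed auto
  finally show "(\<lambda>p. relay_word n (gs p) (z p) (x p)) -` {k} \<inter> space S \<in> sets S" .
qed

lemma measurable_qmf_output:
  assumes gs [measurable]: "gs \<in> borel_measurable S" "gr \<in> borel_measurable S" "gd \<in> borel_measurable S"
    and x: "\<And>i. i < 2 * n \<Longrightarrow> (\<lambda>p. x p i) \<in> borel_measurable S"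
    and zr: "\<And>i. i < n \<Longrightarrow> (\<lambda>p. zr p i) \<in> borel_measurable S"
    and zd: "\<And>i. i < 2 * n \<Longrightarrow> (\<lambda>p. zd p i) \<in> borel_measurable S"
    and F: "\<And>q i. q \<in> quantized n \<Longrightarrow> i < n \<Longrightarrow> (\<lambda>p. F p q i) \<in> borel_measurable S"
    and i: "i < 2 * n"
  shows "(\<lambda>p. qmf_output n (gs p) (gr p) (gd p) (zr p) (zd p) (x p) (F p) i) \<in> borel_measurable S"
proof -
  note [measurable] = x[OF i] zd[OF i]
  show ?thesis
  proof (cases "i < n")
    case True
    then show ?thesis unfolding qmf_output_def by simp
  next
    case False
    have [measurable]: "(\<lambda>p. F p (relay_word n (gs p) (zr p) (x p)) (i - n)) \<in> borel_measurable S"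
    proof (rule measurable_compose_countable'[where I="quantized n" and f="\<lambda>q p. F p q (i - n)"])
      show "(\<lambda>p. F p q (i - n)) \<in> borel_measurable S" if "q \<in> quantized n" for q
        by (rule F[OF that]) (use False i in simp)
      show "(\<lambda>p. relay_word n (gs p) (zr p) (x p)) \<in> S \<rightarrow>\<^sub>M count_space (quantized n)"
        by (rule measurable_relay_word[OF gs(1)], rule x, simp, rule zr, simp)
      show "countable (quantized n)" by (rule countable_quantized)
    qed
    show ?thesis unfolding qmf_output_def using False by simp
  qed
qed

lemma measurable_qmf_match:
  assumes gs [measurable]: "gs \<in> borel_measurable S" "gr \<in> borel_measurable S" "gd \<in> borel_measurable S"
    and x: "\<And>i. i < 2 * n \<Longrightarrow> (\<lambda>p. x p i) \<in> borel_measurable S"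
    and y: "\<And>i. i < 2 * n \<Longrightarrow> (\<lambda>p. y p i) \<in> borel_measurable S"
    and F: "\<And>i. i < n \<Longrightarrow> (\<lambda>p. F p q i) \<in> borel_measurable S"
  shows "Measurable.pred S (\<lambda>p. qmf_match t n (gs p) (gr p) (gd p) (x p) (F p) (y p) q)"
proof -
  have "Measurable.pred S (\<lambda>p. \<forall>i\<in>{..<n}. cmod (q i) \<le> cmod (gs p) + t \<and> cmod (q i - gs p * x p i) \<le> t \<and>
      cmod (y p i - gd p * x p i) \<le> t \<and> cmod (y p (n + i) - gr p * F p q i - gd p * x p (n + i)) \<le> t)"
  proof (rule pred_intros_finite)
    fix i assume i: "i \<in> {..<n}"
    have [measurable]: "(\<lambda>p. x p i) \<in> borel_measurable S" "(\<lambda>p. x p (n + i)) \<in> borel_measurable S"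
      "(\<lambda>p. y p i) \<in> borel_measurable S" "(\<lambda>p. y p (n + i)) \<in> borel_measurable S" "(\<lambda>p. F p q i) \<in> borel_measurable S"
      using x[of i] x[of "n + i"] y[of i] y[of "n + i"] F[of i] i by simp_all
    show "Measurable.pred S (\<lambda>p. cmod (q i) \<le> cmod (gs p) + t \<and> cmod (q i - gs p * x p i) \<le> t \<and>
      cmod (y p i - gd p * x p i) \<le> t \<and> cmod (y p (n + i) - gr p * F p q i - gd p * x p (n + i)) \<le> t)"
      by measurable
  qed auto
  then show ?thesis unfolding qmf_match_def by (simp only: Ball_def lessThan_iff)
qed

lemma sets_near:
  "{x. cmod (w - g * x) \<le> t} \<in> sets borel"
  by measurable

text \<open>In the first half a fresh letter is tested twice, against \<open>q\<close> and against
  \<open>y\<close>, and the stronger test counts. In the second half only the direct link tests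
  it.\<close>

lemma match_prob_same:
  assumes t: "0 < t"
  shows "emeasure (random_codeword (2 * n)) {x \<in> space (random_codeword (2 * n)). qmf_match t n gs gr gd x F y q}
    \<le> ennreal ((min (hit_bound t gs) (hit_bound t gd)) ^ n * hit_bound t gd ^ n)"
proof -
  define A where "A i = {x. cmod (q i - gs * x) \<le> t} \<inter> {x. cmod (y i - gd * x) \<le> t}" for i
  define B where "B i = {x. cmod (y (n + i) - gr * F q i - gd * x) \<le> t}" for i
  have [measurable]: "A i \<in> sets borel" "B i \<in> sets borel" for i
    unfolding A_def B_def by (auto intro: sets_near)
  note h = emeasure_random_codeword_halves[of n A B]
  have "emeasure (random_codeword (2 * n)) {x \<in> space (random_codeword (2 * n)). qmf_match t n gs gr gd x F y q}
    \<le> emeasure (random_codeword (2 * n)) {x \<in> space (random_codeword (2 * n)). \<forall>i<n. x i \<in> A i \<and> x (n + i) \<in> B i}"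
  proof (rule emeasure_mono)
    show "{x \<in> space (random_codeword (2 * n)). qmf_match t n gs gr gd x F y q} \<subseteq>
        {x \<in> space (random_codeword (2 * n)). \<forall>i<n. x i \<in> A i \<and> x (n + i) \<in> B i}"
      by (auto simp: qmf_match_def A_def B_def)
  qed (rule h(2), auto)
  also have "\<dots> = (\<Prod>i<n. emeasure disc (A i)) * (\<Prod>i<n. emeasure disc (B i))" by (rule h(1)) auto
  also have "\<dots> \<le> ennreal ((min (hit_bound t gs) (hit_bound t gd)) ^ n) * ennreal (hit_bound t gd ^ n)"
  proof (intro mult_mono prod_ennreal_le_power)
    fix i
    have "emeasure disc (A i) \<le> emeasure disc {x. cmod (q i - gs * x) \<le> t}"
      unfolding A_def by (rule emeasure_mono, blast, simp add: sets_near)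
    moreover have "emeasure disc (A i) \<le> emeasure disc {x. cmod (y i - gd * x) \<le> t}"
      unfolding A_def by (rule emeasure_mono, blast, simp add: sets_near)
    ultimately have "emeasure disc (A i) \<le> ennreal (hit_bound t gs)" "emeasure disc (A i) \<le> ennreal (hit_bound t gd)"
      using emeasure_disc_le[OF t] by (meson order_trans)+
    then show "emeasure disc (A i) \<le> ennreal (min (hit_bound t gs) (hit_bound t gd))" by (auto simp: min_def)
    show "emeasure disc (B i) \<le> ennreal (hit_bound t gd)"
      unfolding B_def by (rule emeasure_disc_le[OF t])
  qed (use hit_bound(1)[OF t] in \<open>auto intro: less_imp_le\<close>)
  also have "\<dots> = ennreal ((min (hit_bound t gs) (hit_bound t gd)) ^ n * hit_bound t gd ^ n)"
    using hit_bound(1)[OF t] by (subst ennreal_mult) (auto intro: less_imp_le)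
  finally show ?thesis .
qed

lemma near_prob_first_half:
  assumes t: "0 < t"
  shows "emeasure (random_codeword (2 * n)) {x \<in> space (random_codeword (2 * n)). \<forall>i<n. cmod (y i - gd * x i) \<le> t}
      \<le> ennreal (hit_bound t gd ^ n)"
    "{x \<in> space (random_codeword (2 * n)). \<forall>i<n. cmod (y i - gd * x i) \<le> t} \<in> sets (random_codeword (2 * n))"
proof -
  interpret D: prob_space disc by (rule prob_space_disc)
  define A where "A i = {x. cmod (y i - gd * x) \<le> t}" for i
  have A: "A i \<in> sets borel" for i unfolding A_def by (rule sets_near)
  note h = emeasure_random_codeword_halves[of n A "\<lambda>_. UNIV"]
  have eq: "{x \<in> space (random_codeword (2 * n)). \<forall>i<n. cmod (y i - gd * x i) \<le> t} =
      {x \<in> space (random_codeword (2 * n)). \<forall>i<n. x i \<in> A i \<and> x (n + i) \<in> UNIV}"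
    by (auto simp: A_def)
  show "{x \<in> space (random_codeword (2 * n)). \<forall>i<n. cmod (y i - gd * x i) \<le> t} \<in> sets (random_codeword (2 * n))"
    unfolding eq by (rule h(2)) (auto intro: A)
  have "emeasure (random_codeword (2 * n)) {x \<in> space (random_codeword (2 * n)). \<forall>i<n. x i \<in> A i \<and> x (n + i) \<in> UNIV} =
      (\<Prod>i<n. emeasure disc (A i)) * (\<Prod>i<n. emeasure disc UNIV)"
    by (rule h(1)) (auto intro: A)
  also have "emeasure disc UNIV = 1" using D.emeasure_space_1 by simp
  also have "(\<Prod>i<n. emeasure disc (A i)) * (\<Prod>i<n. 1) \<le> ennreal (hit_bound t gd ^ n)"
    using prod_ennreal_le_power[of n "\<lambda>i. emeasure disc (A i)" "hit_bound t gd"] emeasure_disc_le[OF t] hit_bound(1)[OF t, of gd]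
    by (auto simp: A_def less_imp_le)
  finally show "emeasure (random_codeword (2 * n)) {x \<in> space (random_codeword (2 * n)). \<forall>i<n. cmod (y i - gd * x i) \<le> t}
      \<le> ennreal (hit_bound t gd ^ n)" unfolding eq .
qed

lemma finite_match_words: "0 < t \<Longrightarrow> finite {q \<in> quantized n. \<forall>i<n. cmod (q i) \<le> cmod gs + t}"
  using card_quantized_near(1)[of "cmod gs + t" n "\<lambda>_. 0"] by simp

text \<open>The candidates \<open>q\<close> lie near the random codeword itself, so their set is
  random too. It is governed by the first half of the codeword; the second half is independent of it
  and contributes its own factor.\<close>

lemma match_prob_direct:
  assumes t: "0 < t"
  shows "emeasure (random_codeword (2 * n)) {x \<in> space (random_codeword (2 * n)). \<exists>q\<in>quantized n. qmf_match t n gs gr gd x F y q}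
    \<le> ennreal (((2 * t + 1)\<^sup>2) ^ n * hit_bound t gd ^ n * hit_bound t gd ^ n)"
proof -
  let ?R = "random_codeword (2 * n)"
  define Q where "Q = {q \<in> quantized n. \<forall>i<n. cmod (q i) \<le> cmod gs + t}"
  have Q: "finite Q" unfolding Q_def by (rule finite_match_words[OF t])
  define A where "A q i = {x. cmod (q i - gs * x) \<le> t} \<inter> {x. cmod (y i - gd * x) \<le> t}" for q :: "nat \<Rightarrow> complex" and i
  define B where "B q i = {x. cmod (y (n + i) - gr * F q i - gd * x) \<le> t}" for q i
  define H where "H q = {x \<in> space ?R. \<forall>i<n. x i \<in> A q i \<and> x (n + i) \<in> B q i}" for q
  \<comment> \<open>\<open>H\<close> with the test of the second half dropped.\<close>
  define G where "G q = {x \<in> space ?R. \<forall>i<n. x i \<in> A q i \<and> x (n + i) \<in> UNIV}" for q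
  interpret D: prob_space disc by (rule prob_space_disc)
  have A: "A q i \<in> sets borel" and B: "B q i \<in> sets borel" for q i
    unfolding A_def B_def by (auto intro: sets_near)
  have Hs: "H q \<in> sets ?R" for q unfolding H_def by (rule emeasure_random_codeword_halves(2)) (auto intro: A B)
  have Gs: "G q \<in> sets ?R" for q unfolding G_def by (rule emeasure_random_codeword_halves(2)) (auto intro: A)
  have HG: "emeasure ?R (H q) \<le> emeasure ?R (G q) * ennreal (hit_bound t gd ^ n)" for q
  proof -
    have "emeasure ?R (H q) = (\<Prod>i<n. emeasure disc (A q i)) * (\<Prod>i<n. emeasure disc (B q i))"
      unfolding H_def by (rule emeasure_random_codeword_halves(1)) (auto intro: A B)
    also have "\<dots> \<le> (\<Prod>i<n. emeasure disc (A q i)) * ennreal (hit_bound t gd ^ n)"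
      unfolding B_def using hit_bound(1)[OF t, of gd]
      by (intro mult_left_mono prod_ennreal_le_power emeasure_disc_le t) auto
    also have "(\<Prod>i<n. emeasure disc (A q i)) = (\<Prod>i<n. emeasure disc (A q i)) * (\<Prod>i<n. emeasure disc UNIV)"
      using D.emeasure_space_1 by simp
    also have "\<dots> = emeasure ?R (G q)"
      unfolding G_def by (rule emeasure_random_codeword_halves(1)[symmetric]) (auto intro: A)
    finally show ?thesis .
  qed
  have "emeasure ?R {x \<in> space ?R. \<exists>q\<in>quantized n. qmf_match t n gs gr gd x F y q} \<le> emeasure ?R (\<Union>q\<in>Q. H q)"
  proof (rule emeasure_mono)
    show "{x \<in> space ?R. \<exists>q\<in>quantized n. qmf_match t n gs gr gd x F y q} \<subseteq> (\<Union>q\<in>Q. H q)"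
    proof
      fix x assume "x \<in> {x \<in> space ?R. \<exists>q\<in>quantized n. qmf_match t n gs gr gd x F y q}"
      then obtain q where q: "x \<in> space ?R" "q \<in> quantized n" "qmf_match t n gs gr gd x F y q" by blast
      then have "q \<in> Q" "x \<in> H q" by (simp_all add: qmf_match_def Q_def H_def A_def B_def)
      then show "x \<in> (\<Union>q\<in>Q. H q)" by blast
    qed
    show "(\<Union>q\<in>Q. H q) \<in> sets ?R" by (rule sets.finite_UN[OF Q Hs])
  qed
  also have "\<dots> \<le> (\<Sum>q\<in>Q. emeasure ?R (H q))"
    by (rule emeasure_subadditive_finite[OF Q]) (use Hs in auto)
  also have "\<dots> \<le> (\<Sum>q\<in>Q. emeasure ?R (G q)) * ennreal (hit_bound t gd ^ n)"
    unfolding sum_distrib_right by (intro sum_mono HG)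
  \<comment> \<open>Sum and integral are exchanged in order to count, for each \<open>x\<close>,
    only the candidates near \<open>x\<close>. The size of \<open>Q\<close> would not do, as it
    grows with the gain.\<close>
  also have "(\<Sum>q\<in>Q. emeasure ?R (G q)) = (\<integral>\<^sup>+x. (\<Sum>q\<in>Q. indicator (G q) x) \<partial>?R)"
    by (subst nn_integral_sum) (use Gs in auto)
  also have "\<dots> \<le> (\<integral>\<^sup>+x. ennreal (((2 * t + 1)\<^sup>2) ^ n) * indicator {x \<in> space ?R. \<forall>i<n. cmod (y i - gd * x i) \<le> t} x \<partial>?R)"
  proof (rule nn_integral_mono)
    fix x assume x: "x \<in> space ?R"
    show "(\<Sum>q\<in>Q. indicator (G q) x) \<le> ennreal (((2 * t + 1)\<^sup>2) ^ n) * indicator {x \<in> space ?R. \<forall>i<n. cmod (y i - gd * x i) \<le> t} x"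
    proof (cases "\<forall>i<n. cmod (y i - gd * x i) \<le> t")
      case False
      then have "indicator (G q) x = (0 :: ennreal)" for q by (auto simp: G_def A_def indicator_def)
      then show ?thesis by simp
    next
      case True
      have "(\<Sum>q\<in>Q. indicator (G q) x) = (\<Sum>q\<in>Q. if q \<in> {q. x \<in> G q} then 1 else 0 :: ennreal)"
        by (intro sum.cong) (auto split: split_indicator)
      also have "\<dots> = of_nat (card (Q \<inter> {q. x \<in> G q}))"
        using Q by (simp add: sum.If_cases)
      also have "\<dots> \<le> of_nat (card {q \<in> quantized n. \<forall>i<n. cmod (q i - gs * x i) \<le> t})"
        using t by (intro of_nat_mono card_mono card_quantized_near(1)) (auto simp: Q_def G_def A_def)
      also have "\<dots> \<le> ennreal (((2 * t + 1)\<^sup>2) ^ n)"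
        unfolding ennreal_of_nat_eq_real_of_nat using t by (intro ennreal_leI card_quantized_near) auto
      finally show ?thesis using True x by simp
    qed
  qed
  also have "\<dots> = ennreal (((2 * t + 1)\<^sup>2) ^ n) * emeasure ?R {x \<in> space ?R. \<forall>i<n. cmod (y i - gd * x i) \<le> t}"
    by (rule nn_integral_cmult_indicator) (rule near_prob_first_half(2)[OF t])
  also have "\<dots> \<le> ennreal (((2 * t + 1)\<^sup>2) ^ n) * ennreal (hit_bound t gd ^ n)"
    by (intro mult_left_mono near_prob_first_half(1) t) auto
  finally have "emeasure ?R {x \<in> space ?R. \<exists>q\<in>quantized n. qmf_match t n gs gr gd x F y q}
      \<le> ennreal (((2 * t + 1)\<^sup>2) ^ n) * ennreal (hit_bound t gd ^ n) * ennreal (hit_bound t gd ^ n)"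
    by (simp only: mult_right_mono zero_le)
  also have "\<dots> = ennreal (((2 * t + 1)\<^sup>2) ^ n * hit_bound t gd ^ n * hit_bound t gd ^ n)"
    using hit_bound(1)[OF t, of gd] by (simp add: ennreal_mult less_imp_le)
  finally show ?thesis .
qed

section \<open>Confusion of messages in the ensemble of both codebooks\<close>

abbreviation source_books :: "nat \<Rightarrow> nat \<Rightarrow> (nat \<Rightarrow> nat \<Rightarrow> complex) measure" where
  "source_books n M \<equiv> PiM {..<M} (\<lambda>_. random_codeword (2 * n))"

abbreviation relay_books :: "nat \<Rightarrow> ((nat \<Rightarrow> complex) \<Rightarrow> nat \<Rightarrow> complex) measure" where
  "relay_books n \<equiv> PiM (quantized n) (\<lambda>_. random_codeword n)"

lemma prob_space_source_books: "prob_space (source_books n M)"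
  by (intro prob_space_PiM prob_space_random_codeword)

lemma prob_space_relay_books: "prob_space (relay_books n)"
  by (intro prob_space_PiM prob_space_random_codeword)

lemma measurable_random_codeword_component:
  "i < k \<Longrightarrow> (\<lambda>x. x i) \<in> borel_measurable (random_codeword k)"
  using measurable_component_singleton[of i "{..<k}" "\<lambda>_. disc"]
  by (simp add: random_codeword_def cong: measurable_cong_sets)

lemma measurable_source_books_component:
  assumes "m < M" "i < 2 * n"
  shows "(\<lambda>X. X m i) \<in> borel_measurable (source_books n M)"
  using measurable_compose[OF measurable_component_singleton[of m "{..<M}" "\<lambda>_. random_codeword (2 * n)"]
    measurable_random_codeword_component[of i "2 * n"]] assms by simp

lemma measurable_relay_books_component:
  assumes "q \<in> quantized n" "i < n"
  shows "(\<lambda>F. F q i) \<in> borel_measurable (relay_books n)"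
  using measurable_compose[OF measurable_component_singleton[of q "quantized n" "\<lambda>_. random_codeword n"]
    measurable_random_codeword_component[of i n]] assms by simp

lemma measurable_ensemble_components:
  assumes S: "sets S = sets (qmf_ensemble n M)"
  shows "m < M \<Longrightarrow> i < 2 * n \<Longrightarrow> (\<lambda>XF. fst XF m i) \<in> borel_measurable S"
    "q \<in> quantized n \<Longrightarrow> j < n \<Longrightarrow> (\<lambda>XF. snd XF q j) \<in> borel_measurable S"
proof -
  have f: "fst \<in> S \<rightarrow>\<^sub>M source_books n M" and s: "snd \<in> S \<rightarrow>\<^sub>M relay_books n"
    by (simp_all add: measurable_cong_sets[OF S refl] qmf_ensemble_def)
  show "m < M \<Longrightarrow> i < 2 * n \<Longrightarrow> (\<lambda>XF. fst XF m i) \<in> borel_measurable S"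
    by (rule measurable_compose[OF f measurable_source_books_component])
  show "q \<in> quantized n \<Longrightarrow> j < n \<Longrightarrow> (\<lambda>XF. snd XF q j) \<in> borel_measurable S"
    by (rule measurable_compose[OF s measurable_relay_books_component])
qed

text \<open>The output reads the relay codebook only at the true relay sequence; the codeword of any
  other sequence is fresh randomness.\<close>

lemma qmf_output_fun_upd:
  "q \<noteq> relay_word n gs zr x \<Longrightarrow>
    qmf_output n gs gr gd zr zd x (F(q := f)) = qmf_output n gs gr gd zr zd x F"
  by (auto simp: qmf_output_def fun_eq_iff)

text \<open>Only the source codeword \<open>m'\<close> is resampled; the other source codewords and
  the relay codebook stay fixed.\<close>

lemma ensemble_section_le:
  assumes S: "S \<in> sets (qmf_ensemble n M)" and m': "m' < M"
    and le: "\<And>X F. emeasure (random_codeword (2 * n)) {x \<in> space (random_codeword (2 * n)). (X(m' := x), F) \<in> S} \<le> c"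
  shows "emeasure (qmf_ensemble n M) S \<le> c"
proof -
  interpret X: prob_space "source_books n M" by (rule prob_space_source_books)
  interpret F: prob_space "relay_books n" by (rule prob_space_relay_books)
  interpret XF: pair_prob_space "source_books n M" "relay_books n" ..
  have S': "S \<in> sets (source_books n M \<Otimes>\<^sub>M relay_books n)" using S by (simp add: qmf_ensemble_def)
  have "emeasure (qmf_ensemble n M) S = (\<integral>\<^sup>+F. emeasure (source_books n M) ((\<lambda>X. (X, F)) -` S) \<partial>relay_books n)"
    unfolding qmf_ensemble_def by (rule XF.emeasure_pair_measure_alt2[OF S'])
  also have "\<dots> \<le> (\<integral>\<^sup>+F. c \<partial>relay_books n)"
  proof (intro nn_integral_mono emeasure_PiM_section_le)
    show "m' \<in> {..<M}" using m' by simp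
    show "(\<lambda>X. (X, F)) -` S \<in> sets (source_books n M)" for F by (rule sets_Pair2[OF S'])
  qed (use le in \<open>auto intro: prob_space_random_codeword\<close>)
  also have "\<dots> = c" by (simp add: F.emeasure_space_1)
  finally show ?thesis .
qed

text \<open>
  The two terms of the sum belong to the cuts at the source and at the destination; the first factor
  counts the quantized sequences near a codeword.
\<close>

definition confusion_bound :: "real \<Rightarrow> nat \<Rightarrow> complex \<Rightarrow> complex \<Rightarrow> complex \<Rightarrow> real" where
  "confusion_bound t n gs gr gd =
    ((2 * t + 1)\<^sup>2) ^ n * hit_bound t gd ^ n *
      (min (hit_bound t gs) (hit_bound t gd) ^ n + min (hit_bound t gd) (hit_bound t gr) ^ n)"

text \<open>The event splits into \<open>A\<close>, where the matching sequence is the true relay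
  word, and \<open>B\<close>, where it is another one. \<open>B\<close> is bounded twice, since
  either the wrong source codeword or the relay codeword can supply the randomness of the second
  half; the smaller bound counts.\<close>

lemma wrong_codeword_prob:
  assumes t: "0 < t" and m: "m < M" "m' < M" "m \<noteq> m'"
  shows "emeasure (qmf_ensemble n M) {XF \<in> space (qmf_ensemble n M).
      \<exists>q\<in>quantized n. qmf_match t n gs gr gd (fst XF m') (snd XF) (qmf_output n gs gr gd zr zd (fst XF m) (snd XF)) q}
    \<le> ennreal (confusion_bound t n gs gr gd)"
proof -
  let ?Q = "qmf_ensemble n M" and ?X = "source_books n M" and ?F = "relay_books n" and ?R = "random_codeword (2 * n)"
  let ?N = "((2 * t + 1)\<^sup>2) ^ n" and ?p = "hit_bound t"
  interpret F: prob_space ?F by (rule prob_space_relay_books)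
  define Y where "Y X F = qmf_output n gs gr gd zr zd (X m) F" for X :: "nat \<Rightarrow> nat \<Rightarrow> complex" and F
  define w where "w X = relay_word n gs zr (X m)" for X :: "nat \<Rightarrow> nat \<Rightarrow> complex"
  have w: "w X \<in> quantized n" for X unfolding w_def by (rule relay_word_quantized)
  define P where "P XF q \<longleftrightarrow> qmf_match t n gs gr gd (fst XF m') (snd XF) (Y (fst XF) (snd XF)) q" for XF q
  note comp = measurable_ensemble_components(1)[OF refl, of _ M _ n] measurable_ensemble_components(2)[OF refl, of _ n _ M]
  have Ym: "(\<lambda>XF. Y (fst XF) (snd XF) i) \<in> borel_measurable ?Q" if "i < 2 * n" for i
    unfolding Y_def by (rule measurable_qmf_output) (use m that in \<open>auto intro: comp\<close>)
  have Pm: "Measurable.pred ?Q (\<lambda>XF. P XF q)" if "q \<in> quantized n" for q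
    unfolding P_def by (rule measurable_qmf_match) (use m that in \<open>auto intro: comp Ym\<close>)
  have wm: "(\<lambda>XF. w (fst XF)) \<in> ?Q \<rightarrow>\<^sub>M count_space (quantized n)"
    unfolding w_def by (rule measurable_relay_word) (use m in \<open>auto intro: comp\<close>)
  have weq: "Measurable.pred ?Q (\<lambda>XF. w (fst XF) = q)" if "q \<in> quantized n" for q
  proof -
    have "(\<lambda>XF. w (fst XF)) -` {q} \<inter> space ?Q \<in> sets ?Q"
      using that by (intro measurable_sets[OF wm]) auto
    then show ?thesis by (simp add: pred_def vimage_def Int_def conj_commute)
  qed
  define A where "A = {XF \<in> space ?Q. \<exists>q\<in>quantized n. w (fst XF) = q \<and> P XF q}"
  define B where "B = {XF \<in> space ?Q. \<exists>q\<in>quantized n. w (fst XF) \<noteq> q \<and> P XF q}"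
  have A: "A \<in> sets ?Q" unfolding A_def
    by (rule predE, rule measurable_pred_countable[OF countable_quantized], intro pred_intros_logic weq Pm)
  have B: "B \<in> sets ?Q" unfolding B_def
    by (rule predE, rule measurable_pred_countable[OF countable_quantized], intro pred_intros_logic weq Pm)
  have hp: "0 < ?p g" for g by (rule hit_bound(1)[OF t])
  have N1: "1 \<le> ?N" using t by (intro one_le_power) auto
  have EA: "emeasure ?Q A \<le> ennreal (min (?p gs) (?p gd) ^ n * ?p gd ^ n)"
  proof (rule ensemble_section_le[OF A m(2)])
    fix X F
    have "Measurable.pred ?R (\<lambda>x. qmf_match t n gs gr gd x F (Y X F) (w X))"
      by (rule measurable_qmf_match) (auto intro: measurable_random_codeword_component)
    then have "emeasure ?R {x \<in> space ?R. (X(m' := x), F) \<in> A} \<le>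
        emeasure ?R {x \<in> space ?R. qmf_match t n gs gr gd x F (Y X F) (w X)}"
      using m by (intro emeasure_mono predE) (auto simp: A_def P_def w_def Y_def)
    also have "\<dots> \<le> ennreal (min (?p gs) (?p gd) ^ n * ?p gd ^ n)" by (rule match_prob_same[OF t])
    finally show "emeasure ?R {x \<in> space ?R. (X(m' := x), F) \<in> A} \<le> ennreal (min (?p gs) (?p gd) ^ n * ?p gd ^ n)" .
  qed
  have EB1: "emeasure ?Q B \<le> ennreal (?N * ?p gd ^ n * ?p gd ^ n)"
  proof (rule ensemble_section_le[OF B m(2)])
    fix X F
    have "Measurable.pred ?R (\<lambda>x. \<exists>q\<in>quantized n. qmf_match t n gs gr gd x F (Y X F) q)"
      by (rule measurable_pred_countable[OF countable_quantized], rule measurable_qmf_match)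
        (auto intro: measurable_random_codeword_component)
    then have "emeasure ?R {x \<in> space ?R. (X(m' := x), F) \<in> B} \<le>
        emeasure ?R {x \<in> space ?R. \<exists>q\<in>quantized n. qmf_match t n gs gr gd x F (Y X F) q}"
      using m by (intro emeasure_mono predE) (auto simp: B_def P_def w_def Y_def)
    also have "\<dots> \<le> ennreal (?N * ?p gd ^ n * ?p gd ^ n)" by (rule match_prob_direct[OF t])
    finally show "emeasure ?R {x \<in> space ?R. (X(m' := x), F) \<in> B} \<le> ennreal (?N * ?p gd ^ n * ?p gd ^ n)" .
  qed
  \<comment> \<open>The source codebook is fixed first. The first-half test on the direct link
    confines it to \<open>D\<close>, an event without the relay codebook, so that the factors for
    \<open>D\<close> and for the relay codewords multiply.\<close>
  have EB2: "emeasure ?Q B \<le> ennreal (?N * ?p gd ^ n * ?p gr ^ n)"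
  proof -
    define D where "D = {X \<in> space ?X. \<forall>i<n. cmod ((gd * X m i + zd i) - gd * X m' i) \<le> t}"
    have D: "D \<in> sets ?X"
    proof -
      have "{X \<in> space ?X. \<forall>i\<in>{..<n}. cmod ((gd * X m i + zd i) - gd * X m' i) \<le> t} \<in> sets ?X"
      proof (rule sets.sets_Collect_finite_All)
        fix i assume "i \<in> {..<n}"
        then have [measurable]: "(\<lambda>X. X m i) \<in> borel_measurable ?X" "(\<lambda>X. X m' i) \<in> borel_measurable ?X"
          using m measurable_source_books_component[of m M i n] measurable_source_books_component[of m' M i n] by simp_all
        show "{X \<in> space ?X. cmod ((gd * X m i + zd i) - gd * X m' i) \<le> t} \<in> sets ?X" by measurable
      qed auto
      then show ?thesis by (simp only: D_def Ball_def lessThan_iff)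
    qed
    have "emeasure ?Q B = (\<integral>\<^sup>+X. emeasure ?F (Pair X -` B) \<partial>?X)"
      unfolding qmf_ensemble_def by (rule F.emeasure_pair_measure_alt) (use B in \<open>simp add: qmf_ensemble_def\<close>)
    also have "\<dots> \<le> (\<integral>\<^sup>+X. ennreal (?N * ?p gr ^ n) * indicator D X \<partial>?X)"
    proof (rule nn_integral_mono)
      fix X assume X: "X \<in> space ?X"
      show "emeasure ?F (Pair X -` B) \<le> ennreal (?N * ?p gr ^ n) * indicator D X"
      proof (cases "X \<in> D")
        case False
        then have "Pair X -` B = {}"
          using X by (auto simp: B_def D_def P_def qmf_match_def Y_def qmf_output_def)
        then show ?thesis by simp
      next
        case True
        \<comment> \<open>Without \<open>w X\<close>, every remaining sequence has a relay codeword
          that does not influence the output.\<close>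
        define Q where "Q = {q \<in> quantized n. \<forall>i<n. cmod (q i - gs * X m' i) \<le> t} - {w X}"
        have Q: "finite Q" "real (card Q) \<le> ?N" unfolding Q_def
          using card_quantized_near[of t n "\<lambda>i. gs * X m' i"] t
          by (auto intro: order_trans[OF of_nat_mono[OF card_Diff1_le]])
        define E where "E q = {F \<in> space ?F. \<forall>i<n. cmod (Y X F (n + i) - gr * F q i - gd * X m' (n + i)) \<le> t}" for q
        have Es: "E q \<in> sets ?F" if "q \<in> quantized n" for q
        proof -
          have "{F \<in> space ?F. \<forall>i\<in>{..<n}. cmod (Y X F (n + i) - gr * F q i - gd * X m' (n + i)) \<le> t} \<in> sets ?F"
          proof (rule sets.sets_Collect_finite_All)
            fix i assume i: "i \<in> {..<n}"
            have [measurable]: "(\<lambda>F. F q i) \<in> borel_measurable ?F"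
              using measurable_relay_books_component[OF that] i by simp
            have [measurable]: "(\<lambda>F. Y X F (n + i)) \<in> borel_measurable ?F"
              unfolding Y_def
            proof (rule measurable_qmf_output)
              show "(\<lambda>F. F q j) \<in> borel_measurable ?F" if "q \<in> quantized n" "j < n" for q j
                by (rule measurable_relay_books_component[OF that])
            qed (use i in simp_all)
            show "{F \<in> space ?F. cmod (Y X F (n + i) - gr * F q i - gd * X m' (n + i)) \<le> t} \<in> sets ?F" by measurable
          qed auto
          then show ?thesis by (simp only: E_def Ball_def lessThan_iff)
        qed
        have Ele: "emeasure ?F (E q) \<le> ennreal (?p gr ^ n)" if q: "q \<in> quantized n" "q \<noteq> w X" for q
        proof (rule emeasure_PiM_section_le[where i=q])
          show "E q \<in> sets ?F" by (rule Es[OF q(1)])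
          fix F assume "F \<in> space (PiM (quantized n - {q}) (\<lambda>_. random_codeword n))"
          let ?A = "\<lambda>i. {f. cmod ((Y X F (n + i) - gd * X m' (n + i)) - gr * f) \<le> t}"
          have "{f \<in> space (random_codeword n). F(q := f) \<in> E q} \<subseteq> {f \<in> space (random_codeword n). \<forall>i<n. f i \<in> ?A i}"
            using q(2) by (auto simp: E_def Y_def w_def qmf_output_fun_upd algebra_simps)
          then have "emeasure (random_codeword n) {f \<in> space (random_codeword n). F(q := f) \<in> E q} \<le>
              emeasure (random_codeword n) {f \<in> space (random_codeword n). \<forall>i<n. f i \<in> ?A i}"
            by (rule emeasure_mono) (rule emeasure_random_codeword(2), rule sets_near)
          also have "\<dots> = (\<Prod>i<n. emeasure disc (?A i))"
            by (rule emeasure_random_codeword(1), rule sets_near)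
          also have "\<dots> \<le> ennreal (?p gr ^ n)"
            by (intro prod_ennreal_le_power emeasure_disc_le t less_imp_le[OF hp])
          finally show "emeasure (random_codeword n) {f \<in> space (random_codeword n). F(q := f) \<in> E q} \<le> ennreal (?p gr ^ n)" .
        qed (use q in \<open>auto intro: prob_space_random_codeword\<close>)
        have "emeasure ?F (Pair X -` B) \<le> emeasure ?F (\<Union>q\<in>Q. E q)"
        proof (rule emeasure_mono)
          show "Pair X -` B \<subseteq> (\<Union>q\<in>Q. E q)"
          proof
            fix F assume "F \<in> Pair X -` B"
            then obtain q where q: "q \<in> quantized n" "w X \<noteq> q" "P (X, F) q" and F: "(X, F) \<in> space ?Q"
              by (auto simp: B_def)
            have "q \<in> Q" using q by (auto simp: Q_def P_def qmf_match_def)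
            moreover have "F \<in> E q"
              using q F by (auto simp: E_def P_def qmf_match_def qmf_ensemble_def space_pair_measure)
            ultimately show "F \<in> (\<Union>q\<in>Q. E q)" by blast
          qed
          show "(\<Union>q\<in>Q. E q) \<in> sets ?F" by (rule sets.finite_UN[OF Q(1)]) (auto simp: Q_def intro: Es)
        qed
        also have "\<dots> \<le> (\<Sum>q\<in>Q. emeasure ?F (E q))"
          by (rule emeasure_subadditive_finite[OF Q(1)]) (auto simp: Q_def intro: Es)
        also have "\<dots> \<le> (\<Sum>q\<in>Q. ennreal (?p gr ^ n))"
          by (rule sum_mono, rule Ele) (auto simp: Q_def)
        also have "\<dots> = ennreal (real (card Q) * ?p gr ^ n)"
          using hp by (simp add: ennreal_of_nat_eq_real_of_nat ennreal_mult less_imp_le)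
        also have "\<dots> \<le> ennreal (?N * ?p gr ^ n)"
          by (intro ennreal_leI mult_right_mono Q(2) zero_le_power less_imp_le[OF hp])
        finally show ?thesis using True by simp
      qed
    qed
    also have "\<dots> = ennreal (?N * ?p gr ^ n) * emeasure ?X D"
      by (rule nn_integral_cmult_indicator[OF D])
    also have "emeasure ?X D \<le> ennreal (?p gd ^ n)"
    proof (rule emeasure_PiM_section_le[where i=m', OF _ _ D])
      fix X assume "X \<in> space (PiM ({..<M} - {m'}) (\<lambda>_. ?R))"
      have "{x \<in> space ?R. X(m' := x) \<in> D} \<subseteq>
          {x \<in> space ?R. \<forall>i<n. cmod ((gd * X m i + zd i) - gd * x i) \<le> t}"
        using m by (auto simp: D_def)
      then have "emeasure ?R {x \<in> space ?R. X(m' := x) \<in> D} \<le>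
          emeasure ?R {x \<in> space ?R. \<forall>i<n. cmod ((gd * X m i + zd i) - gd * x i) \<le> t}"
        by (rule emeasure_mono) (rule near_prob_first_half(2)[OF t])
      also have "\<dots> \<le> ennreal (?p gd ^ n)" by (rule near_prob_first_half(1)[OF t])
      finally show "emeasure ?R {x \<in> space ?R. X(m' := x) \<in> D} \<le> ennreal (?p gd ^ n)" .
    qed (use m in \<open>auto intro: prob_space_random_codeword\<close>)
    then have "ennreal (?N * ?p gr ^ n) * emeasure ?X D \<le> ennreal (?N * ?p gr ^ n) * ennreal (?p gd ^ n)"
      by (rule mult_left_mono) simp
    also have "\<dots> = ennreal (?N * ?p gd ^ n * ?p gr ^ n)"
      using less_imp_le[OF hp] N1 by (subst ennreal_mult[symmetric]) (auto simp: mult_ac)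
    finally show ?thesis .
  qed
  have "{XF \<in> space ?Q. \<exists>q\<in>quantized n. P XF q} \<subseteq> A \<union> B" unfolding A_def B_def by blast
  then have "emeasure ?Q {XF \<in> space ?Q. \<exists>q\<in>quantized n. P XF q} \<le> emeasure ?Q (A \<union> B)"
    by (rule emeasure_mono) (use A B in auto)
  also have "\<dots> \<le> emeasure ?Q A + emeasure ?Q B" by (rule emeasure_subadditive[OF A B])
  also have "\<dots> \<le> ennreal (min (?p gs) (?p gd) ^ n * ?p gd ^ n) +
      ennreal (?N * ?p gd ^ n * min (?p gd) (?p gr) ^ n)"
  proof (rule add_mono[OF EA])
    show "emeasure ?Q B \<le> ennreal (?N * ?p gd ^ n * min (?p gd) (?p gr) ^ n)"
      using EB1 EB2 by (auto simp: min_def)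
  qed
  also have "\<dots> = ennreal (min (?p gs) (?p gd) ^ n * ?p gd ^ n +
      ?N * ?p gd ^ n * min (?p gd) (?p gr) ^ n)"
    using less_imp_le[OF hp] N1 by (intro ennreal_plus[symmetric]) auto
  also have "\<dots> \<le> ennreal (confusion_bound t n gs gr gd)"
  proof (rule ennreal_leI)
    \<comment> \<open>The term of \<open>A\<close> carries no count; as the count is at least 1,
      both terms may share it.\<close>
    have "1 * (min (?p gs) (?p gd) ^ n * ?p gd ^ n) \<le> ?N * (min (?p gs) (?p gd) ^ n * ?p gd ^ n)"
      using less_imp_le[OF hp] by (intro mult_right_mono N1) auto
    then show "min (?p gs) (?p gd) ^ n * ?p gd ^ n +
      ?N * ?p gd ^ n * min (?p gd) (?p gr) ^ n \<le> confusion_bound t n gs gr gd"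
      unfolding confusion_bound_def by (simp add: algebra_simps)
  qed
  finally show ?thesis unfolding P_def Y_def .
qed

section \<open>Decoding error of static quantize-map-forward\<close>

abbreviation gain :: "real \<Rightarrow> real \<Rightarrow> complex \<Rightarrow> complex" where
  "gain \<rho> x h \<equiv> h * complex_of_real (\<rho> powr (x / 2))"

text \<open>The disjunct \<open>M \<le> m\<close> makes the \<open>LEAST\<close> well defined when no message matches.\<close>

definition qmf_dec :: "real \<Rightarrow> real \<Rightarrow> real \<Rightarrow> real \<Rightarrow> real \<Rightarrow> nat \<Rightarrow> nat \<Rightarrow> qmf_decoder" where
  "qmf_dec a b c \<rho> t n M XF h y = (case h of (hsr, hrd, hsd) \<Rightarrow>
    LEAST m. M \<le> m \<or> (\<exists>q\<in>quantized n.
      qmf_match t n (gain \<rho> a hsr) (gain \<rho> b hrd) (gain \<rho> c hsd) (fst XF m) (snd XF) y q))"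

lemma qmf_code_simps [simp]:
  "block_len (qmf_code n M X F dec) = 2 * n" "num_msgs (qmf_code n M X F dec) = M"
  "codebook (qmf_code n M X F dec) = X" "decoder (qmf_code n M X F dec) = dec"
  "listens (qmf_code n M X F dec) u h t y \<longleftrightarrow> t < n"
  "signal (qmf_code n M X F dec) u h t y = (if t < n then 0 else F (\<lambda>i\<in>{..<n}. quantize (y i)) (t - n))"
  by (simp_all add: qmf_code_def)

text \<open>Stated for any code that listens before time \<open>n\<close>, so that it covers the QMF
  code as well as its full-duplex version.\<close>

lemma relay_received_listening:
  assumes "\<And>t y. t < n \<Longrightarrow> listens C u h t y"
  shows "i < t \<Longrightarrow> i < n \<Longrightarrow> relay_received a \<rho> C m u h z t i = gain \<rho> a h * codebook C m i + z i"
  using assms by (induction t) (auto simp: Let_def less_Suc_eq)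

lemma dest_received_qmf_code:
  "dest_received a b c \<rho> (qmf_code n M X F dec) m u (hsr, hrd, hsd) zr zd =
    (\<lambda>i\<in>{..<2 * n}. qmf_output n (gain \<rho> a hsr) (gain \<rho> b hrd) (gain \<rho> c hsd) zr zd (X m) F i)"
proof -
  have "(\<lambda>i\<in>{..<n}. quantize (relay_received a \<rho> (qmf_code n M X F dec) m u hsr zr t i)) =
      relay_word n (gain \<rho> a hsr) zr (X m)" if "n \<le> t" for t
    unfolding relay_word_def using that by (intro restrict_ext) (simp add: relay_received_listening[where n=n])
  then show ?thesis
    unfolding dest_received_def prod.case qmf_code_simps
    by (intro restrict_ext) (simp add: qmf_output_def mult.assoc)
qed

lemma measurable_gain_components:
  "(\<lambda>h::gain_triple. gain \<rho> x (fst h)) \<in> borel_measurable borel"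
  "(\<lambda>h::gain_triple. gain \<rho> x (fst (snd h))) \<in> borel_measurable borel"
  "(\<lambda>h::gain_triple. gain \<rho> x (snd (snd h))) \<in> borel_measurable borel"
proof -
  have [measurable]: "fst \<in> (borel :: gain_triple measure) \<rightarrow>\<^sub>M borel"
    "snd \<in> (borel :: gain_triple measure) \<rightarrow>\<^sub>M (borel :: (complex \<times> complex) measure)"
    "fst \<in> (borel :: (complex \<times> complex) measure) \<rightarrow>\<^sub>M borel"
    "snd \<in> (borel :: (complex \<times> complex) measure) \<rightarrow>\<^sub>M borel"
    by (simp_all add: borel_prod[symmetric])
  show "(\<lambda>h::gain_triple. gain \<rho> x (fst h)) \<in> borel_measurable borel"
    "(\<lambda>h::gain_triple. gain \<rho> x (fst (snd h))) \<in> borel_measurable borel"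
    "(\<lambda>h::gain_triple. gain \<rho> x (snd (snd h))) \<in> borel_measurable borel"
    by measurable
qed

lemma measurable_qmf_dec: "measurable_qmf_decoder n M (qmf_dec a b c \<rho> t n M)"
proof -
  let ?S = "qmf_ensemble n M \<Otimes>\<^sub>M (borel :: gain_triple measure) \<Otimes>\<^sub>M PiM {..<2 * n} (\<lambda>_. borel :: complex measure)"
  have XF: "fst \<in> ?S \<rightarrow>\<^sub>M qmf_ensemble n M" by simp
  have h: "(\<lambda>p. fst (snd p)) \<in> ?S \<rightarrow>\<^sub>M borel" by simp
  have y: "(\<lambda>p. snd (snd p)) \<in> ?S \<rightarrow>\<^sub>M PiM {..<2 * n} (\<lambda>_. borel)" by simp
  note comp = measurable_ensemble_components(1)[OF refl, of _ M _ n] measurable_ensemble_components(2)[OF refl, of _ n _ M]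
  have "(\<lambda>p. LEAST m. M \<le> m \<or> (\<exists>q\<in>quantized n.
      qmf_match t n (gain \<rho> a (fst (fst (snd p)))) (gain \<rho> b (fst (snd (fst (snd p))))) (gain \<rho> c (snd (snd (fst (snd p)))))
        (fst (fst p) m) (snd (fst p)) (snd (snd p)) q)) \<in> ?S \<rightarrow>\<^sub>M count_space UNIV"
  proof (rule measurable_Least)
    fix m
    show "Measurable.pred ?S (\<lambda>p. M \<le> m \<or> (\<exists>q\<in>quantized n.
      qmf_match t n (gain \<rho> a (fst (fst (snd p)))) (gain \<rho> b (fst (snd (fst (snd p))))) (gain \<rho> c (snd (snd (fst (snd p)))))
        (fst (fst p) m) (snd (fst p)) (snd (snd p)) q))"
    \<comment> \<open>For \<open>M \<le> m\<close> there is no codeword to be measurable, but the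
      predicate is constantly true.\<close>
    proof (cases "M \<le> m")
      case False
      have "Measurable.pred ?S (\<lambda>p. \<exists>q\<in>quantized n.
        qmf_match t n (gain \<rho> a (fst (fst (snd p)))) (gain \<rho> b (fst (snd (fst (snd p))))) (gain \<rho> c (snd (snd (fst (snd p)))))
          (fst (fst p) m) (snd (fst p)) (snd (snd p)) q)"
      proof (rule measurable_pred_countable[OF countable_quantized], rule measurable_qmf_match)
        show "(\<lambda>p. gain \<rho> a (fst (fst (snd p)))) \<in> borel_measurable ?S"
          by (rule measurable_compose[OF h measurable_gain_components(1)])
        show "(\<lambda>p. gain \<rho> b (fst (snd (fst (snd p))))) \<in> borel_measurable ?S"
          by (rule measurable_compose[OF h measurable_gain_components(2)])
        show "(\<lambda>p. gain \<rho> c (snd (snd (fst (snd p))))) \<in> borel_measurable ?S"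
          by (rule measurable_compose[OF h measurable_gain_components(3)])
        show "(\<lambda>p. fst (fst p) m i) \<in> borel_measurable ?S" if "i < 2 * n" for i
          by (rule measurable_compose[OF XF comp(1)]) (use False that in auto)
        show "(\<lambda>p. snd (snd p) i) \<in> borel_measurable ?S" if "i < 2 * n" for i
          by (rule measurable_compose[OF y measurable_component_singleton]) (use that in simp)
        show "(\<lambda>p. snd (fst p) q i) \<in> borel_measurable ?S" if "q \<in> quantized n" "i < n" for q i
          by (rule measurable_compose[OF XF comp(2)]) (use that in auto)
      qed
      then show ?thesis using False by simp
    qed simp
  qed
  also have "(\<lambda>p. LEAST m. M \<le> m \<or> (\<exists>q\<in>quantized n.
      qmf_match t n (gain \<rho> a (fst (fst (snd p)))) (gain \<rho> b (fst (snd (fst (snd p))))) (gain \<rho> c (snd (snd (fst (snd p)))))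
        (fst (fst p) m) (snd (fst p)) (snd (snd p)) q)) = (\<lambda>(XF, h, y). qmf_dec a b c \<rho> t n M XF h y)"
    by (rule ext) (simp only: qmf_dec_def split_paired_all prod.case fst_conv snd_conv)
  finally show ?thesis unfolding measurable_qmf_decoder_def .
qed

lemma measurable_qmf_decoded:
  assumes dec: "measurable_qmf_decoder n M dec" and m: "m < M"
  shows "(\<lambda>(XF, h, u, zr, zd). dec XF h (dest_received a b c \<rho> (qmf_code n M (fst XF) (snd XF) (dec XF)) m u h zr zd))
    \<in> qmf_ensemble n M \<Otimes>\<^sub>M channel_space (2 * n) \<rightarrow>\<^sub>M count_space UNIV"
proof -
  let ?B = "PiM {..<2 * n} (\<lambda>_. borel :: complex measure)"
  let ?S = "qmf_ensemble n M \<Otimes>\<^sub>M ((borel :: gain_triple measure) \<Otimes>\<^sub>M (borel :: real measure) \<Otimes>\<^sub>M ?B \<Otimes>\<^sub>M ?B)"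
  have XF: "fst \<in> ?S \<rightarrow>\<^sub>M qmf_ensemble n M" by simp
  have h: "(\<lambda>p. fst (snd p)) \<in> ?S \<rightarrow>\<^sub>M borel" by simp
  have zr: "(\<lambda>p. fst (snd (snd (snd p)))) \<in> ?S \<rightarrow>\<^sub>M ?B" by simp
  have zd: "(\<lambda>p. snd (snd (snd (snd p)))) \<in> ?S \<rightarrow>\<^sub>M ?B" by simp
  note comp = measurable_ensemble_components(1)[OF refl, of _ M _ n] measurable_ensemble_components(2)[OF refl, of _ n _ M]
  let ?Y = "\<lambda>p. \<lambda>i\<in>{..<2 * n}. qmf_output n (gain \<rho> a (fst (fst (snd p)))) (gain \<rho> b (fst (snd (fst (snd p)))))
    (gain \<rho> c (snd (snd (fst (snd p))))) (fst (snd (snd (snd p)))) (snd (snd (snd (snd p)))) (fst (fst p) m) (snd (fst p)) i"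
  have Y: "?Y \<in> ?S \<rightarrow>\<^sub>M ?B"
  proof (rule measurable_restrict, rule measurable_qmf_output)
    show "(\<lambda>p. gain \<rho> a (fst (fst (snd p)))) \<in> borel_measurable ?S"
      by (rule measurable_compose[OF h measurable_gain_components(1)])
    show "(\<lambda>p. gain \<rho> b (fst (snd (fst (snd p))))) \<in> borel_measurable ?S"
      by (rule measurable_compose[OF h measurable_gain_components(2)])
    show "(\<lambda>p. gain \<rho> c (snd (snd (fst (snd p))))) \<in> borel_measurable ?S"
      by (rule measurable_compose[OF h measurable_gain_components(3)])
    show "(\<lambda>p. fst (fst p) m i) \<in> borel_measurable ?S" if "i < 2 * n" for i
      by (rule measurable_compose[OF XF comp(1)]) (use m that in auto)
    show "(\<lambda>p. fst (snd (snd (snd p))) i) \<in> borel_measurable ?S" if "i < n" for i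
      by (rule measurable_compose[OF zr measurable_component_singleton]) (use that in simp)
    show "(\<lambda>p. snd (snd (snd (snd p))) i) \<in> borel_measurable ?S" if "i < 2 * n" for i
      by (rule measurable_compose[OF zd measurable_component_singleton]) (use that in simp)
    show "(\<lambda>p. snd (fst p) q i) \<in> borel_measurable ?S" if "q \<in> quantized n" "i < n" for q i
      by (rule measurable_compose[OF XF comp(2)]) (use that in auto)
  qed simp
  have D: "(\<lambda>(XF, h, y). dec XF h y) \<in> qmf_ensemble n M \<Otimes>\<^sub>M borel \<Otimes>\<^sub>M ?B \<rightarrow>\<^sub>M count_space UNIV"
    using dec by (simp add: measurable_qmf_decoder_def)
  have "(\<lambda>p. (fst p, fst (snd p), ?Y p)) \<in> ?S \<rightarrow>\<^sub>M qmf_ensemble n M \<Otimes>\<^sub>M borel \<Otimes>\<^sub>M ?B"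
    by (intro measurable_Pair XF h Y)
  from measurable_compose[OF this D]
  have "(\<lambda>p. dec (fst p) (fst (snd p)) (?Y p)) \<in> ?S \<rightarrow>\<^sub>M count_space UNIV" by simp
  also have "(\<lambda>p. dec (fst p) (fst (snd p)) (?Y p)) =
      (\<lambda>(XF, h, u, zr, zd). dec XF h (dest_received a b c \<rho> (qmf_code n M (fst XF) (snd XF) (dec XF)) m u h zr zd))"
    by (rule ext) (simp only: split_paired_all prod.case fst_conv snd_conv dest_received_qmf_code)
  finally have *: "(\<lambda>(XF, h, u, zr, zd). dec XF h (dest_received a b c \<rho> (qmf_code n M (fst XF) (snd XF) (dec XF)) m u h zr zd))
    \<in> ?S \<rightarrow>\<^sub>M count_space UNIV" .
  show ?thesis
    by (subst measurable_cong_sets[OF sets_pair_measure_cong[OF refl sets_channel_space] refl]) (rule *)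
qed

text \<open>An event on codebooks and channel jointly, so that Fubini can fix either of
  them.\<close>

definition qmf_error_event ::
  "real \<Rightarrow> real \<Rightarrow> real \<Rightarrow> real \<Rightarrow> nat \<Rightarrow> nat \<Rightarrow> qmf_decoder \<Rightarrow> nat \<Rightarrow>
    (((nat \<Rightarrow> nat \<Rightarrow> complex) \<times> ((nat \<Rightarrow> complex) \<Rightarrow> nat \<Rightarrow> complex)) \<times>
      gain_triple \<times> real \<times> (nat \<Rightarrow> complex) \<times> (nat \<Rightarrow> complex)) set"
where
  "qmf_error_event a b c \<rho> n M dec m = {(XF, h, u, zr, zd) \<in> space (qmf_ensemble n M \<Otimes>\<^sub>M channel_space (2 * n)).
    dec XF h (dest_received a b c \<rho> (qmf_code n M (fst XF) (snd XF) (dec XF)) m u h zr zd) \<noteq> m}"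

lemma sets_qmf_error_event:
  assumes "measurable_qmf_decoder n M dec" "m < M"
  shows "qmf_error_event a b c \<rho> n M dec m \<in> sets (qmf_ensemble n M \<Otimes>\<^sub>M channel_space (2 * n))"
proof -
  have "qmf_error_event a b c \<rho> n M dec m =
    (\<lambda>(XF, h, u, zr, zd). dec XF h (dest_received a b c \<rho> (qmf_code n M (fst XF) (snd XF) (dec XF)) m u h zr zd)) -` (- {m}) \<inter>
      space (qmf_ensemble n M \<Otimes>\<^sub>M channel_space (2 * n))"
    by (auto simp: qmf_error_event_def)
  then show ?thesis using measurable_sets[OF measurable_qmf_decoded[OF assms], of "- {m}"] by simp
qed

lemma error_prob_qmf_code:
  assumes "XF \<in> space (qmf_ensemble n M)"
  shows "error_prob a b c \<rho> (qmf_code n M (fst XF) (snd XF) (dec XF)) =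
    (\<Sum>m<M. measure (channel_space (2 * n)) (Pair XF -` qmf_error_event a b c \<rho> n M dec m)) / real M"
proof -
  have "{(h, u, zr, zd) \<in> space (channel_space (2 * n)).
      dec XF h (dest_received a b c \<rho> (qmf_code n M (fst XF) (snd XF) (dec XF)) m u h zr zd) \<noteq> m} =
    Pair XF -` qmf_error_event a b c \<rho> n M dec m" for m
    unfolding qmf_error_event_def using assms by (auto simp: space_pair_measure)
  then show ?thesis by (simp add: error_prob_def)
qed

text \<open>Averages over codebooks and over the channel are exchanged. Integrability is recorded
  because the comparisons of the average with single codebooks rest on it.\<close>

lemma qmf_error_prob_eq:
  assumes dec: "measurable_qmf_decoder n M dec"
  shows "integrable (qmf_ensemble n M) (\<lambda>XF. error_prob a b c \<rho> (qmf_code n M (fst XF) (snd XF) (dec XF)))"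
    "qmf_error_prob a b c \<rho> n M dec =
      (\<Sum>m<M. measure (qmf_ensemble n M \<Otimes>\<^sub>M channel_space (2 * n)) (qmf_error_event a b c \<rho> n M dec m)) / real M"
proof -
  let ?Q = "qmf_ensemble n M" and ?C = "channel_space (2 * n)"
  interpret Q: prob_space ?Q by (rule prob_space_qmf_ensemble)
  interpret C: prob_space ?C by (rule prob_space_channel_space)
  interpret QC: pair_prob_space ?Q ?C ..
  let ?E = "qmf_error_event a b c \<rho> n M dec"
  have hb: "has_bochner_integral ?Q (\<lambda>XF. measure ?C (Pair XF -` ?E m)) (measure (?Q \<Otimes>\<^sub>M ?C) (?E m))" if m: "m < M" for m
  proof (rule has_bochner_integral_nn_integral)
    note E = sets_qmf_error_event[OF dec m]
    show "(\<lambda>XF. measure ?C (Pair XF -` ?E m)) \<in> borel_measurable ?Q"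
      unfolding measure_def by (rule borel_measurable_enn2real[OF C.measurable_emeasure_Pair[OF E]])
    have "(\<integral>\<^sup>+XF. ennreal (measure ?C (Pair XF -` ?E m)) \<partial>?Q) = (\<integral>\<^sup>+XF. emeasure ?C (Pair XF -` ?E m) \<partial>?Q)"
      by (simp add: C.emeasure_eq_measure)
    also have "\<dots> = emeasure (?Q \<Otimes>\<^sub>M ?C) (?E m)" by (rule C.emeasure_pair_measure_alt[OF E, symmetric])
    finally show "(\<integral>\<^sup>+XF. ennreal (measure ?C (Pair XF -` ?E m)) \<partial>?Q) = ennreal (measure (?Q \<Otimes>\<^sub>M ?C) (?E m))"
      by (simp add: QC.P.emeasure_eq_measure)
  qed auto
  have hb2: "has_bochner_integral ?Q (\<lambda>XF. (\<Sum>m<M. measure ?C (Pair XF -` ?E m)) / real M) ((\<Sum>m<M. measure (?Q \<Otimes>\<^sub>M ?C) (?E m)) / real M)"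
    by (intro has_bochner_integral_divide_zero has_bochner_integral_sum hb) simp
  then have hb3: "has_bochner_integral ?Q (\<lambda>XF. error_prob a b c \<rho> (qmf_code n M (fst XF) (snd XF) (dec XF))) ((\<Sum>m<M. measure (?Q \<Otimes>\<^sub>M ?C) (?E m)) / real M)"
    by (subst has_bochner_integral_cong[OF refl error_prob_qmf_code refl]) auto
  then show "integrable ?Q (\<lambda>XF. error_prob a b c \<rho> (qmf_code n M (fst XF) (snd XF) (dec XF)))"
    by (simp add: has_bochner_integral_iff)
  show "qmf_error_prob a b c \<rho> n M dec = (\<Sum>m<M. measure (?Q \<Otimes>\<^sub>M ?C) (?E m)) / real M"
    unfolding qmf_error_prob_def by (rule has_bochner_integral_integral_eq[OF hb3])
qed

section \<open>Marginals of the ensemble and of the channel\<close>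

lemma distr_pair_snd:
  assumes "prob_space A" "prob_space B"
  shows "distr (A \<Otimes>\<^sub>M B) B snd = B"
proof (rule measure_eqI)
  interpret A: prob_space A by fact
  interpret B: prob_space B by fact
  fix S assume S: "S \<in> sets (distr (A \<Otimes>\<^sub>M B) B snd)"
  have "snd -` S \<inter> space (A \<Otimes>\<^sub>M B) = space A \<times> S"
    using S sets.sets_into_space[of S B] by (auto simp: space_pair_measure)
  then show "emeasure (distr (A \<Otimes>\<^sub>M B) B snd) S = emeasure B S"
    using S by (simp add: emeasure_distr B.emeasure_pair_measure_Times A.emeasure_space_1)
qed simp

lemma AE_disc: "AE x in disc. cmod x \<le> 1"
  by (subst AE_uniform_measure) (auto simp: emeasure_cball_complex)

lemma AE_random_codeword: "AE x in random_codeword k. \<forall>i<k. cmod (x i) \<le> 1"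
proof -
  have "AE x in random_codeword k. \<forall>i\<in>{..<k}. cmod (x i) \<le> 1"
    unfolding random_codeword_def
    by (rule AE_finite_allI) (auto intro!: AE_PiM_component prob_space_disc AE_disc)
  then show ?thesis by (simp only: Ball_def lessThan_iff)
qed

text \<open>The codebook space contains letters of any size, so power bounds hold only almost
  surely. There are countably many relay codewords, so one null set serves for all of them.\<close>

lemma AE_qmf_ensemble:
  "AE XF in qmf_ensemble n M. (\<forall>m<M. \<forall>i<2 * n. cmod (fst XF m i) \<le> 1) \<and> (\<forall>q\<in>quantized n. \<forall>i<n. cmod (snd XF q i) \<le> 1)"
proof -
  interpret X: prob_space "source_books n M" by (rule prob_space_source_books)
  interpret F: prob_space "relay_books n" by (rule prob_space_relay_books)
  interpret XF: pair_prob_space "source_books n M" "relay_books n" ..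
  have "AE X in source_books n M. \<forall>m\<in>{..<M}. \<forall>i<2 * n. cmod (X m i) \<le> 1"
    by (rule AE_finite_allI, simp, rule AE_PiM_component[where P="\<lambda>x. \<forall>i<2 * n. cmod (x i) \<le> 1"])
      (auto intro: prob_space_random_codeword AE_random_codeword)
  then have X: "AE XF in qmf_ensemble n M. \<forall>m\<in>{..<M}. \<forall>i<2 * n. cmod (fst XF m i) \<le> 1"
    unfolding qmf_ensemble_def
    by (intro AE_distrD[OF measurable_fst, where P="\<lambda>X. \<forall>m\<in>{..<M}. \<forall>i<2 * n. cmod (X m i) \<le> 1"]) (simp only: F.distr_pair_fst)
  have "AE F in relay_books n. \<forall>q\<in>quantized n. \<forall>i<n. cmod (F q i) \<le> 1"
    by (subst AE_ball_countable[OF countable_quantized], rule ballI, rule AE_PiM_component[where P="\<lambda>x. \<forall>i<n. cmod (x i) \<le> 1"])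
      (auto intro: prob_space_random_codeword AE_random_codeword)
  then have F: "AE XF in qmf_ensemble n M. \<forall>q\<in>quantized n. \<forall>i<n. cmod (snd XF q i) \<le> 1"
    unfolding qmf_ensemble_def
    by (intro AE_distrD[OF measurable_snd, where P="\<lambda>F. \<forall>q\<in>quantized n. \<forall>i<n. cmod (F q i) \<le> 1"])
      (simp only: distr_pair_snd[OF prob_space_source_books prob_space_relay_books])
  show ?thesis using X F by eventually_elim auto
qed

lemma distr_channel_space:
  "distr (channel_space T) gains fst = gains"
  "i < T \<Longrightarrow> distr (channel_space T) complex_normal (\<lambda>\<omega>. fst (snd (snd \<omega>)) i) = complex_normal"
  "i < T \<Longrightarrow> distr (channel_space T) complex_normal (\<lambda>\<omega>. snd (snd (snd \<omega>)) i) = complex_normal"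
proof -
  let ?N = "noise T" and ?C = "channel_space T"
  interpret U: prob_space seed by (rule prob_space_seed)
  interpret N: prob_space ?N by (rule prob_space_noise)
  interpret UNN: prob_space "seed \<Otimes>\<^sub>M ?N \<Otimes>\<^sub>M ?N" by (intro prob_space_pair prob_space_seed prob_space_noise)
  show "distr ?C gains fst = gains" unfolding channel_space_def by (rule UNN.distr_pair_fst)
  have s1: "distr ?C (seed \<Otimes>\<^sub>M ?N \<Otimes>\<^sub>M ?N) snd = seed \<Otimes>\<^sub>M ?N \<Otimes>\<^sub>M ?N"
    unfolding channel_space_def by (rule distr_pair_snd[OF prob_space_gains UNN.prob_space_axioms])
  have s2: "distr (seed \<Otimes>\<^sub>M ?N \<Otimes>\<^sub>M ?N) (?N \<Otimes>\<^sub>M ?N) snd = ?N \<Otimes>\<^sub>M ?N"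
    by (rule distr_pair_snd[OF prob_space_seed prob_space_noise_pair])
  have ms: "snd \<in> ?C \<rightarrow>\<^sub>M seed \<Otimes>\<^sub>M ?N \<Otimes>\<^sub>M ?N" by (simp add: channel_space_def)
  have NN: "distr ?C (?N \<Otimes>\<^sub>M ?N) (snd \<circ> snd) = ?N \<Otimes>\<^sub>M ?N"
    using distr_distr[OF measurable_snd ms] by (simp only: s1 s2)
  have mss: "snd \<circ> snd \<in> ?C \<rightarrow>\<^sub>M ?N \<Otimes>\<^sub>M ?N" by (rule measurable_comp[OF ms]) simp
  assume i: "i < T"
  have comp: "distr ?N complex_normal (\<lambda>z. z i) = complex_normal"
    using i by (intro distr_PiM_component prob_space_complex_normal) simp
  have mi: "(\<lambda>z. z i) \<in> ?N \<rightarrow>\<^sub>M complex_normal" using i by (intro measurable_component_singleton) simp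
  have Nf: "distr (?N \<Otimes>\<^sub>M ?N) complex_normal ((\<lambda>z. z i) \<circ> fst) = complex_normal"
    using distr_distr[OF mi measurable_fst[of ?N ?N]] by (simp only: N.distr_pair_fst comp)
  have Ns: "distr (?N \<Otimes>\<^sub>M ?N) complex_normal ((\<lambda>z. z i) \<circ> snd) = complex_normal"
    using distr_distr[OF mi measurable_snd[of ?N ?N]] by (simp only: distr_pair_snd[OF prob_space_noise prob_space_noise] comp)
  show "distr ?C complex_normal (\<lambda>\<omega>. fst (snd (snd \<omega>)) i) = complex_normal"
    using distr_distr[OF measurable_comp[OF measurable_fst mi] mss] by (simp only: NN Nf) (simp add: o_def)
  show "distr ?C complex_normal (\<lambda>\<omega>. snd (snd (snd \<omega>)) i) = complex_normal"
    using distr_distr[OF measurable_comp[OF measurable_snd mi] mss] by (simp only: NN Ns) (simp add: o_def)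
qed

lemma channel_space_coordinates:
  "i < T \<Longrightarrow> (\<lambda>\<omega>. fst (snd (snd \<omega>)) i) \<in> channel_space T \<rightarrow>\<^sub>M complex_normal"
  "i < T \<Longrightarrow> (\<lambda>\<omega>. snd (snd (snd \<omega>)) i) \<in> channel_space T \<rightarrow>\<^sub>M complex_normal"
  "fst \<in> channel_space T \<rightarrow>\<^sub>M gains"
proof -
  have 1: "(\<lambda>\<omega>. fst (snd (snd \<omega>))) \<in> channel_space T \<rightarrow>\<^sub>M noise T" "(\<lambda>\<omega>. snd (snd (snd \<omega>))) \<in> channel_space T \<rightarrow>\<^sub>M noise T"
    by (simp_all add: channel_space_def)
  show "i < T \<Longrightarrow> (\<lambda>\<omega>. fst (snd (snd \<omega>)) i) \<in> channel_space T \<rightarrow>\<^sub>M complex_normal"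
    by (rule measurable_compose[OF 1(1) measurable_component_singleton]) simp
  show "i < T \<Longrightarrow> (\<lambda>\<omega>. snd (snd (snd \<omega>)) i) \<in> channel_space T \<rightarrow>\<^sub>M complex_normal"
    by (rule measurable_compose[OF 1(2) measurable_component_singleton]) simp
  show "fst \<in> channel_space T \<rightarrow>\<^sub>M gains" by (simp add: channel_space_def)
qed

text \<open>Union bound over \<open>2 * T\<close> noise letters, each with tail
  \<open>2 * exp (- \<tau>\<^sup>2 / 2)\<close>.\<close>

lemma noise_tail:
  fixes T :: nat and \<tau> :: real
  assumes "0 \<le> \<tau>"
  defines "A \<equiv> {\<omega> \<in> space (channel_space T). \<exists>i<T. \<tau> < cmod (fst (snd (snd \<omega>)) i) \<or> \<tau> < cmod (snd (snd (snd \<omega>)) i)}"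
  shows "A \<in> sets (channel_space T)" "emeasure (channel_space T) A \<le> ennreal (4 * real T * exp (- \<tau>\<^sup>2 / 2))"
proof -
  let ?C = "channel_space T"
  let ?S = "{z. \<tau> < cmod z}"
  define B where "B i = (\<lambda>\<omega>. fst (snd (snd \<omega>)) i) -` ?S \<inter> space ?C" for i
  define D where "D i = (\<lambda>\<omega>. snd (snd (snd \<omega>)) i) -` ?S \<inter> space ?C" for i
  have S: "?S \<in> sets complex_normal" by simp
  have Bs: "B i \<in> sets ?C" and Ds: "D i \<in> sets ?C" if "i < T" for i
    unfolding B_def D_def by (rule measurable_sets[OF channel_space_coordinates(1)[OF that] S], rule measurable_sets[OF channel_space_coordinates(2)[OF that] S])
  have tail: "emeasure complex_normal ?S \<le> ennreal (2 * exp (- \<tau>\<^sup>2 / 2))"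
    using complex_normal_tail[OF assms(1)] by (simp add: CN.emeasure_eq_measure)
  have Be: "emeasure ?C (B i) \<le> ennreal (2 * exp (- \<tau>\<^sup>2 / 2))" and De: "emeasure ?C (D i) \<le> ennreal (2 * exp (- \<tau>\<^sup>2 / 2))" if "i < T" for i
  proof -
    have "emeasure ?C (B i) = emeasure (distr ?C complex_normal (\<lambda>\<omega>. fst (snd (snd \<omega>)) i)) ?S"
      unfolding B_def by (rule emeasure_distr[OF channel_space_coordinates(1)[OF that] S, symmetric])
    then show "emeasure ?C (B i) \<le> ennreal (2 * exp (- \<tau>\<^sup>2 / 2))" using tail by (simp only: distr_channel_space(2)[OF that])
    have "emeasure ?C (D i) = emeasure (distr ?C complex_normal (\<lambda>\<omega>. snd (snd (snd \<omega>)) i)) ?S"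
      unfolding D_def by (rule emeasure_distr[OF channel_space_coordinates(2)[OF that] S, symmetric])
    then show "emeasure ?C (D i) \<le> ennreal (2 * exp (- \<tau>\<^sup>2 / 2))" using tail by (simp only: distr_channel_space(3)[OF that])
  qed
  have A: "A = (\<Union>i\<in>{..<T}. B i \<union> D i)" unfolding A_def B_def D_def by blast
  show "A \<in> sets ?C" unfolding A using Bs Ds by (intro sets.finite_UN sets.Un) auto
  have "emeasure ?C A \<le> (\<Sum>i<T. emeasure ?C (B i \<union> D i))"
    unfolding A using Bs Ds by (intro emeasure_subadditive_finite) auto
  also have "\<dots> \<le> (\<Sum>i<T. ennreal (4 * exp (- \<tau>\<^sup>2 / 2)))"
  proof (rule sum_mono)
    fix i assume i: "i \<in> {..<T}"
    have "emeasure ?C (B i \<union> D i) \<le> emeasure ?C (B i) + emeasure ?C (D i)"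
      using i by (intro emeasure_subadditive Bs Ds) auto
    also have "\<dots> \<le> ennreal (2 * exp (- \<tau>\<^sup>2 / 2)) + ennreal (2 * exp (- \<tau>\<^sup>2 / 2))"
      using i by (intro add_mono Be De) auto
    also have "\<dots> = ennreal (4 * exp (- \<tau>\<^sup>2 / 2))" by (simp flip: ennreal_plus)
    finally show "emeasure ?C (B i \<union> D i) \<le> ennreal (4 * exp (- \<tau>\<^sup>2 / 2))" .
  qed
  also have "\<dots> = ennreal (4 * real T * exp (- \<tau>\<^sup>2 / 2))"
    by (subst sum_ennreal) (auto simp: mult_ac)
  finally show "emeasure ?C A \<le> ennreal (4 * real T * exp (- \<tau>\<^sup>2 / 2))" .
qed

text \<open>The true message passes all tests, with the true relay word as witness. The gap between
  \<open>t - 1\<close> and \<open>t\<close> is the rounding error.\<close>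

lemma qmf_match_transmitted:
  assumes x: "\<And>i. i < 2 * n \<Longrightarrow> cmod (x i) \<le> 1"
    and zr: "\<And>i. i < 2 * n \<Longrightarrow> cmod (zr i) \<le> t - 1" and zd: "\<And>i. i < 2 * n \<Longrightarrow> cmod (zd i) \<le> t - 1"
  shows "qmf_match t n gs gr gd x F (qmf_output n gs gr gd zr zd x F) (relay_word n gs zr x)"
  unfolding qmf_match_def
proof (intro allI impI)
  fix i assume i: "i < n"
  let ?q = "relay_word n gs zr x i"
  have "cmod (?q - gs * x i) = cmod ((quantize (gs * x i + zr i) - (gs * x i + zr i)) + zr i)"
    using i by (simp add: relay_word_def)
  also have "\<dots> \<le> cmod (quantize (gs * x i + zr i) - (gs * x i + zr i)) + cmod (zr i)" by (rule norm_triangle_ineq)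
  also have "\<dots> \<le> t" using quantize_error[of "gs * x i + zr i"] zr[of i] i by simp
  finally have 1: "cmod (?q - gs * x i) \<le> t" .
  have "cmod ?q \<le> cmod (gs * x i) + cmod (?q - gs * x i)" by (metis norm_triangle_sub)
  also have "\<dots> \<le> cmod gs + t"
    using 1 x[of i] i by (auto simp: norm_mult intro!: add_mono mult_left_le)
  finally have 2: "cmod ?q \<le> cmod gs + t" .
  show "cmod ?q \<le> cmod gs + t \<and> cmod (?q - gs * x i) \<le> t \<and>
    cmod (qmf_output n gs gr gd zr zd x F i - gd * x i) \<le> t \<and>
    cmod (qmf_output n gs gr gd zr zd x F (n + i) - gr * F (relay_word n gs zr x) i - gd * x (n + i)) \<le> t"
    using 1 2 zd[of i] zd[of "n + i"] i by (simp add: qmf_output_def)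
qed

section \<open>The error probability averaged over the codebooks\<close>

lemma qmf_match_restrict:
  "qmf_match t n gs gr gd x F (restrict y {..<2 * n}) q = qmf_match t n gs gr gd x F y q"
  unfolding qmf_match_def by (intro all_cong) simp

lemma confusion_bound_nonneg: "0 < t \<Longrightarrow> 0 \<le> confusion_bound t n gs gr gd"
  using hit_bound(1)[of t] unfolding confusion_bound_def
  by (intro mult_nonneg_nonneg add_nonneg_nonneg) (auto intro: less_imp_le)

text \<open>With small noise the transmitted message passes the tests, so \<open>LEAST\<close> can
  err only towards a smaller index, and the union bound runs over \<open>m' < m\<close>.\<close>

lemma qmf_error_section_le:
  assumes t: "1 \<le> t" and m: "m < M" and h: "h = (hsr, hrd, hsd)"
    and \<omega>: "(h, u, zr, zd) \<in> space (channel_space (2 * n))"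
    and zr: "\<And>i. i < 2 * n \<Longrightarrow> cmod (zr i) \<le> t - 1" and zd: "\<And>i. i < 2 * n \<Longrightarrow> cmod (zd i) \<le> t - 1"
  shows "emeasure (qmf_ensemble n M) ((\<lambda>XF. (XF, h, u, zr, zd)) -` qmf_error_event a b c \<rho> n M (qmf_dec a b c \<rho> t n M) m)
    \<le> ennreal (real M * confusion_bound t n (gain \<rho> a hsr) (gain \<rho> b hrd) (gain \<rho> c hsd))"
proof -
  let ?Q = "qmf_ensemble n M"
  let ?gs = "gain \<rho> a hsr" and ?gr = "gain \<rho> b hrd" and ?gd = "gain \<rho> c hsd"
  let ?c = "confusion_bound t n ?gs ?gr ?gd"
  have t0: "0 < t" using t by simp
  define W where "W m' = {XF \<in> space ?Q. \<exists>q\<in>quantized n. qmf_match t n ?gs ?gr ?gd (fst XF m') (snd XF)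
    (qmf_output n ?gs ?gr ?gd zr zd (fst XF m) (snd XF)) q}" for m'
  note comp = measurable_ensemble_components(1)[OF refl, of _ M _ n] measurable_ensemble_components(2)[OF refl, of _ n _ M]
  have Ws: "W m' \<in> sets ?Q" if "m' < m" for m'
  proof -
    have Y: "(\<lambda>XF. qmf_output n ?gs ?gr ?gd zr zd (fst XF m) (snd XF) i) \<in> borel_measurable ?Q" if "i < 2 * n" for i
    proof (rule measurable_qmf_output)
      show "(\<lambda>XF. fst XF m i) \<in> borel_measurable ?Q" if "i < 2 * n" for i
        by (rule comp(1)) (use m that in simp_all)
      show "(\<lambda>XF. snd XF q i) \<in> borel_measurable ?Q" if "q \<in> quantized n" "i < n" for q i
        by (rule comp(2)[OF that])
    qed (use that in simp_all)
    have "Measurable.pred ?Q (\<lambda>XF. \<exists>q\<in>quantized n. qmf_match t n ?gs ?gr ?gd (fst XF m') (snd XF)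
      (qmf_output n ?gs ?gr ?gd zr zd (fst XF m) (snd XF)) q)"
    proof (rule measurable_pred_countable[OF countable_quantized], rule measurable_qmf_match)
      show "(\<lambda>XF. fst XF m' i) \<in> borel_measurable ?Q" if "i < 2 * n" for i
        by (rule comp(1)) (use m \<open>m' < m\<close> that in simp_all)
      show "(\<lambda>XF. snd XF q i) \<in> borel_measurable ?Q" if "q \<in> quantized n" "i < n" for q i
        by (rule comp(2)[OF that])
    qed (use Y in simp_all)
    then show ?thesis unfolding W_def by (rule predE)
  qed
  have WU: "(\<Union>m'\<in>{..<m}. W m') \<in> sets ?Q" by (intro sets.finite_UN) (auto intro: Ws)
  have "emeasure ?Q ((\<lambda>XF. (XF, h, u, zr, zd)) -` qmf_error_event a b c \<rho> n M (qmf_dec a b c \<rho> t n M) m)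
      \<le> emeasure ?Q (\<Union>m'\<in>{..<m}. W m')"
  proof (rule emeasure_mono_AE[OF _ WU])
    show "AE XF in ?Q. XF \<in> (\<lambda>XF. (XF, h, u, zr, zd)) -` qmf_error_event a b c \<rho> n M (qmf_dec a b c \<rho> t n M) m \<longrightarrow>
        XF \<in> (\<Union>m'\<in>{..<m}. W m')"
      using AE_qmf_ensemble[of M n]
    proof (rule AE_mp, intro AE_I2 impI)
      fix XF assume XF: "XF \<in> space ?Q"
        and b: "(\<forall>m<M. \<forall>i<2 * n. cmod (fst XF m i) \<le> 1) \<and> (\<forall>q\<in>quantized n. \<forall>i<n. cmod (snd XF q i) \<le> 1)"
        and E: "XF \<in> (\<lambda>XF. (XF, h, u, zr, zd)) -` qmf_error_event a b c \<rho> n M (qmf_dec a b c \<rho> t n M) m"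
      let ?y = "qmf_output n ?gs ?gr ?gd zr zd (fst XF m) (snd XF)"
      define pass where "pass k \<longleftrightarrow> M \<le> k \<or> (\<exists>q\<in>quantized n. qmf_match t n ?gs ?gr ?gd (fst XF k) (snd XF) ?y q)" for k
      have ne: "(LEAST k. pass k) \<noteq> m"
        using E unfolding h qmf_error_event_def qmf_dec_def pass_def
        by (simp add: dest_received_qmf_code qmf_match_restrict)
      have pm: "pass m"
        unfolding pass_def
      proof (intro disjI2 bexI)
        show "qmf_match t n ?gs ?gr ?gd (fst XF m) (snd XF) ?y (relay_word n ?gs zr (fst XF m))"
          by (rule qmf_match_transmitted) (use b m zr zd in blast)+
      qed (rule relay_word_quantized)
      have "(LEAST k. pass k) < m" using Least_le[of pass, OF pm] ne by simp
      moreover have "pass (LEAST k. pass k)" by (rule LeastI[of pass, OF pm])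
      ultimately show "XF \<in> (\<Union>m'\<in>{..<m}. W m')"
        using XF m unfolding pass_def W_def by auto
    qed
  qed
  also have "\<dots> \<le> (\<Sum>m'<m. emeasure ?Q (W m'))"
    by (rule emeasure_subadditive_finite) (auto intro: Ws)
  also have "\<dots> \<le> (\<Sum>m'<m. ennreal ?c)"
    unfolding W_def using m by (intro sum_mono wrong_codeword_prob t0) auto
  also have "\<dots> = ennreal (real m * ?c)"
    using confusion_bound_nonneg[OF t0] by (simp add: ennreal_of_nat_eq_real_of_nat ennreal_mult)
  also have "\<dots> \<le> ennreal (real M * ?c)"
    using m confusion_bound_nonneg[OF t0] by (intro ennreal_leI mult_right_mono) auto
  finally show ?thesis .
qed

text \<open>Three causes of error: large noise, gains in \<open>A\<close>, and confusion of messages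
  at good gains. The first two are events of the channel alone, and there every codebook is allowed
  to fail.\<close>

lemma qmf_error_prob_le:
  assumes t: "1 \<le> t" and M: "0 < M" and A: "A \<in> sets gains" and s: "0 \<le> s"
    and good: "\<And>hsr hrd hsd. (hsr, hrd, hsd) \<notin> A \<Longrightarrow>
      real M * confusion_bound t n (gain \<rho> a hsr) (gain \<rho> b hrd) (gain \<rho> c hsd) \<le> s"
  shows "qmf_error_prob a b c \<rho> n M (qmf_dec a b c \<rho> t n M)
    \<le> 8 * real n * exp (- (t - 1)\<^sup>2 / 2) + measure gains A + s"
proof -
  let ?Q = "qmf_ensemble n M" and ?C = "channel_space (2 * n)"
  interpret Q: prob_space ?Q by (rule prob_space_qmf_ensemble)
  interpret C: prob_space ?C by (rule prob_space_channel_space)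
  interpret QC: pair_prob_space ?Q ?C ..
  interpret G: prob_space gains by (rule prob_space_gains)
  let ?E = "qmf_error_event a b c \<rho> n M (qmf_dec a b c \<rho> t n M)"
  define NB where "NB = {\<omega> \<in> space ?C. \<exists>i<2 * n. t - 1 < cmod (fst (snd (snd \<omega>)) i) \<or> t - 1 < cmod (snd (snd (snd \<omega>)) i)}"
  define Ou where "Ou = fst -` A \<inter> space ?C"
  have NB: "NB \<in> sets ?C"
    unfolding NB_def by (rule noise_tail(1)) (use t in simp)
  have e: "4 * real (2 * n) = 8 * real n" by simp
  have NBe: "emeasure ?C NB \<le> ennreal (8 * real n * exp (- (t - 1)\<^sup>2 / 2))"
    unfolding NB_def e[symmetric] by (rule noise_tail(2)) (use t in simp)
  have Ou: "Ou \<in> sets ?C" unfolding Ou_def by (rule measurable_sets[OF channel_space_coordinates(3) A])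
  have Oe: "emeasure ?C Ou = ennreal (measure gains A)"
    using emeasure_distr[OF channel_space_coordinates(3) A, of "2 * n"]
    by (simp only: distr_channel_space(1) Ou_def G.emeasure_eq_measure)
  have le: "measure (?Q \<Otimes>\<^sub>M ?C) (?E m) \<le> 8 * real n * exp (- (t - 1)\<^sup>2 / 2) + measure gains A + s" if m: "m < M" for m
  proof -
    have "emeasure (?Q \<Otimes>\<^sub>M ?C) (?E m) = (\<integral>\<^sup>+\<omega>. emeasure ?Q ((\<lambda>XF. (XF, \<omega>)) -` ?E m) \<partial>?C)"
      by (rule QC.emeasure_pair_measure_alt2[OF sets_qmf_error_event[OF measurable_qmf_dec m]])
    also have "\<dots> \<le> (\<integral>\<^sup>+\<omega>. indicator NB \<omega> + (indicator Ou \<omega> + ennreal s) \<partial>?C)"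
    proof (rule nn_integral_mono)
      fix \<omega> assume \<omega>: "\<omega> \<in> space ?C"
      obtain hsr hrd hsd u zr zd where w: "\<omega> = ((hsr, hrd, hsd), u, zr, zd)" by (metis surj_pair)
      show "emeasure ?Q ((\<lambda>XF. (XF, \<omega>)) -` ?E m) \<le> indicator NB \<omega> + (indicator Ou \<omega> + ennreal s)"
      proof (cases "\<omega> \<in> NB \<or> \<omega> \<in> Ou")
        case True
        have "emeasure ?Q ((\<lambda>XF. (XF, \<omega>)) -` ?E m) \<le> 1" by (rule Q.emeasure_le_1)
        also have "1 \<le> indicator NB \<omega> + (indicator Ou \<omega> + ennreal s)"
          using True by (auto simp: indicator_def intro: add_increasing2 add_increasing)
        finally show ?thesis .
      next
        case False
        have "emeasure ?Q ((\<lambda>XF. (XF, \<omega>)) -` ?E m) \<le> ennreal (real M * confusion_bound t n (gain \<rho> a hsr) (gain \<rho> b hrd) (gain \<rho> c hsd))"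
          unfolding w
        proof (rule qmf_error_section_le[OF t m refl])
          show "((hsr, hrd, hsd), u, zr, zd) \<in> space ?C" using \<omega> by (simp only: w)
          have z: "\<not> (\<exists>i<2 * n. t - 1 < cmod (zr i) \<or> t - 1 < cmod (zd i))"
            using False \<omega> by (simp add: w NB_def)
          show "cmod (zr i) \<le> t - 1" "cmod (zd i) \<le> t - 1" if "i < 2 * n" for i
            using z that by (meson not_less)+
        qed
        also have "\<dots> \<le> ennreal s"
          using False \<omega> by (intro ennreal_leI good) (auto simp: Ou_def w)
        finally show ?thesis using False by simp
      qed
    qed
    also have "\<dots> = emeasure ?C NB + (emeasure ?C Ou + ennreal s)"
      using NB Ou by (simp add: nn_integral_add C.emeasure_space_1)
    also have "\<dots> \<le> ennreal (8 * real n * exp (- (t - 1)\<^sup>2 / 2)) + (ennreal (measure gains A) + ennreal s)"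
      unfolding Oe by (intro add_mono NBe order_refl)
    also have "\<dots> = ennreal (8 * real n * exp (- (t - 1)\<^sup>2 / 2) + measure gains A + s)"
      using s by (simp add: add.assoc flip: ennreal_plus)
    finally show ?thesis
      unfolding QC.P.emeasure_eq_measure using s by (subst (asm) ennreal_le_iff) auto
  qed
  have "(\<Sum>m<M. measure (?Q \<Otimes>\<^sub>M ?C) (?E m)) \<le> (\<Sum>m<M. 8 * real n * exp (- (t - 1)\<^sup>2 / 2) + measure gains A + s)"
    by (intro sum_mono le) auto
  then show ?thesis
    unfolding qmf_error_prob_eq(2)[OF measurable_qmf_dec] using M by (simp add: divide_le_eq mult.commute)
qed

section \<open>Outage probability\<close>

text \<open>
  Covering the region \<open>x y \<le> \<theta>\<close> of the unit square by \<open>K\<close> rectangles of area \<open>\<theta>\<^bsup>1 - 1/K\<^esup>\<close> avoids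
  the logarithmic factor of the exact tail.
\<close>

lemma (in prob_space) product_tail:
  assumes [measurable]: "X \<in> borel_measurable M" "Y \<in> borel_measurable M"
    and XY0: "\<And>\<omega>. 0 \<le> X \<omega>" "\<And>\<omega>. 0 \<le> Y \<omega>"
    and X: "\<And>u. 0 \<le> u \<Longrightarrow> prob {\<omega> \<in> space M. X \<omega> \<le> u} \<le> u"
    and Y: "\<And>v. 0 \<le> v \<Longrightarrow> prob {\<omega> \<in> space M. Y \<omega> \<le> v} \<le> v"
    and XY: "\<And>u v. 0 \<le> u \<Longrightarrow> 0 \<le> v \<Longrightarrow> prob {\<omega> \<in> space M. X \<omega> \<le> u \<and> Y \<omega> \<le> v} \<le> u * v"
    and \<theta>: "0 < \<theta>" and K: "0 < (K::nat)"
  shows "prob {\<omega> \<in> space M. X \<omega> * Y \<omega> \<le> \<theta>} \<le> (real K + 2) * \<theta> powr (1 - 1 / real K)"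
proof (cases "\<theta> < 1")
  case False
  have "1 \<le> (real K + 2) * \<theta> powr (1 - 1 / real K)"
    using False K ge_one_powr_ge_zero[of \<theta> "1 - 1 / real K"] mult_mono[of 1 "real K + 2" 1 "\<theta> powr (1 - 1 / real K)"]
    by simp
  then show ?thesis using prob_le_1 order_trans by blast
next
  case True
  define B where "B k = {\<omega> \<in> space M. X \<omega> \<le> \<theta> powr (real k / K) \<and> Y \<omega> \<le> \<theta> powr (1 - (real k + 1) / K)}" for k :: nat
  define BX where "BX = {\<omega> \<in> space M. X \<omega> \<le> \<theta>}"
  define BY where "BY = {\<omega> \<in> space M. Y \<omega> \<le> \<theta>}"
  have [measurable]: "B k \<in> sets M" "BX \<in> sets M" "BY \<in> sets M" for k
    unfolding B_def BX_def BY_def by measurable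
  have cover: "{\<omega> \<in> space M. X \<omega> * Y \<omega> \<le> \<theta>} \<subseteq> (\<Union>k<K. B k) \<union> (BX \<union> BY)"
  proof
    fix \<omega> assume "\<omega> \<in> {\<omega> \<in> space M. X \<omega> * Y \<omega> \<le> \<theta>}"
    then have sp: "\<omega> \<in> space M" and le: "X \<omega> * Y \<omega> \<le> \<theta>" by auto
    \<comment> \<open>The rectangles cover only \<open>X\<close> between \<open>\<theta>\<close> and
      1. If \<open>X\<close> is larger, then \<open>Y\<close> is at most
      \<open>\<theta>\<close>.\<close>
    consider "X \<omega> \<le> \<theta>" | "1 < X \<omega>" | "\<theta> < X \<omega>" "X \<omega> \<le> 1" by linarith
    then show "\<omega> \<in> (\<Union>k<K. B k) \<union> (BX \<union> BY)"
    proof cases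
      case 1
      then show ?thesis using sp by (simp add: BX_def)
    next
      case 2
      then have "1 * Y \<omega> \<le> X \<omega> * Y \<omega>" using XY0 by (intro mult_right_mono) auto
      then show ?thesis using sp le by (simp add: BY_def)
    next
      case 3
      have ln\<theta>: "ln \<theta> < 0" using \<theta> True by simp
      have X0: "0 < X \<omega>" using 3 \<theta> by simp
      \<comment> \<open>Position of \<open>X\<close> on the logarithmic scale with base
        \<open>\<theta>\<close>, in units of \<open>1 / K\<close>; its integer part selects the
        rectangle.\<close>
      define z where "z = K * ln (X \<omega>) / ln \<theta>"
      have zx: "X \<omega> = \<theta> powr (z / K)"
        using ln\<theta> X0 \<theta> K by (simp add: z_def powr_def)
      have z: "0 \<le> z" "z < K"
      proof -
        show "0 \<le> z" unfolding z_def using ln\<theta> X0 3 by (intro divide_nonpos_neg mult_nonneg_nonpos) auto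
        have "ln \<theta> < ln (X \<omega>)" using 3 \<theta> X0 by simp
        then show "z < K" unfolding z_def using ln\<theta> K by (simp add: divide_less_eq)
      qed
      define k where "k = nat \<lfloor>z\<rfloor>"
      have k: "real k \<le> z" "z < real k + 1" using z by (auto simp: k_def)
      then have kK: "k < K" using z by linarith
      have "X \<omega> \<le> \<theta> powr (real k / K)"
        unfolding zx using k \<theta> True by (intro powr_mono') (auto intro: divide_right_mono)
      moreover have "Y \<omega> \<le> \<theta> powr (1 - (real k + 1) / K)"
      proof -
        have "\<theta> powr ((real k + 1) / K) \<le> X \<omega>"
          unfolding zx using k \<theta> True by (intro powr_mono') (auto intro: divide_right_mono)
        then have "\<theta> powr ((real k + 1) / K) * Y \<omega> \<le> \<theta>"
          using XY0(2)[of \<omega>] le mult_right_mono order_trans by blast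
        then show ?thesis using \<theta> by (simp add: powr_diff field_simps)
      qed
      ultimately show ?thesis using sp kK by (auto simp: B_def)
    qed
  qed
  have pw: "\<theta> \<le> \<theta> powr (1 - 1 / real K)"
  proof -
    have "\<theta> powr 1 \<le> \<theta> powr (1 - 1 / real K)" using \<theta> True by (intro powr_mono') auto
    then show ?thesis using \<theta> by simp
  qed
  have "prob {\<omega> \<in> space M. X \<omega> * Y \<omega> \<le> \<theta>} \<le> prob ((\<Union>k<K. B k) \<union> (BX \<union> BY))"
    by (rule finite_measure_mono[OF cover]) measurable
  also have "\<dots> \<le> prob (\<Union>k<K. B k) + prob (BX \<union> BY)"
    by (rule measure_Un_le) measurable
  also have "\<dots> \<le> (\<Sum>k<K. prob (B k)) + (prob BX + prob BY)"
    by (intro add_mono measure_UNION_le measure_Un_le) auto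
  also have "\<dots> \<le> (\<Sum>k<K. \<theta> powr (1 - 1 / real K)) + (\<theta> powr (1 - 1 / real K) + \<theta> powr (1 - 1 / real K))"
  proof (intro add_mono sum_mono)
    fix k assume "k \<in> {..<K}"
    have "prob (B k) \<le> \<theta> powr (real k / K) * \<theta> powr (1 - (real k + 1) / K)"
      unfolding B_def by (rule XY) auto
    \<comment> \<open>The two exponents add up to \<open>1 - 1 / K\<close> for every
      \<open>k\<close>: all rectangles have the same area.\<close>
    also have "\<dots> = \<theta> powr (1 - 1 / real K)"
      unfolding powr_add[symmetric] by (rule arg_cong[where f="\<lambda>y. \<theta> powr y"]) (simp add: add_divide_distrib)
    finally show "prob (B k) \<le> \<theta> powr (1 - 1 / real K)" .
  next
    show "prob BX \<le> \<theta> powr (1 - 1 / real K)" "prob BY \<le> \<theta> powr (1 - 1 / real K)"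
      unfolding BX_def BY_def using X[of \<theta>] Y[of \<theta>] \<theta> pw by auto
  qed
  also have "\<dots> = (real K + 2) * \<theta> powr (1 - 1 / real K)" by (simp add: algebra_simps)
  finally show ?thesis .
qed

text \<open>With received powers \<open>Gs\<close>, \<open>Gr\<close>, \<open>Gd\<close> of the
  three links and \<open>L \<ge> 0\<close>, this says that \<open>max Gs Gd * Gd\<close> or
  \<open>max Gr Gd * Gd\<close> is at most \<open>L\<^sup>2\<close>. Up to constants, it means that
  one of the two QMF cuts at \<open>t = 1/2\<close> is at most \<open>ln L\<close>.\<close>

definition outage_set :: "real \<Rightarrow> real \<Rightarrow> real \<Rightarrow> real \<Rightarrow> real \<Rightarrow> gain_triple set" where
  "outage_set a b c \<rho> L = {(hsr, hrd, hsd). (cmod hsd)\<^sup>2 * \<rho> powr c \<le> L \<and>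
    ((cmod hsr)\<^sup>2 * \<rho> powr a * ((cmod hsd)\<^sup>2 * \<rho> powr c) \<le> L\<^sup>2 \<or>
     (cmod hrd)\<^sup>2 * \<rho> powr b * ((cmod hsd)\<^sup>2 * \<rho> powr c) \<le> L\<^sup>2)}"

lemma measure_gains_small:
  assumes "0 \<le> u" "0 \<le> v"
  shows "measure gains {h. (cmod (fst h))\<^sup>2 \<le> u \<and> (cmod (snd (snd h)))\<^sup>2 \<le> v} \<le> u * v"
    "measure gains {h. (cmod (fst (snd h)))\<^sup>2 \<le> u \<and> (cmod (snd (snd h)))\<^sup>2 \<le> v} \<le> u * v"
    "measure gains {h. (cmod (fst h))\<^sup>2 \<le> u} \<le> u"
    "measure gains {h. (cmod (fst (snd h)))\<^sup>2 \<le> u} \<le> u"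
    "measure gains {h. (cmod (snd (snd h)))\<^sup>2 \<le> u} \<le> u"
proof -
  let ?S = "\<lambda>u. {z. (cmod z)\<^sup>2 \<le> u}"
  have [measurable]: "?S w \<in> sets borel" for w by measurable
  have [simp]: "measure complex_normal UNIV = 1" using CN.prob_space by simp
  have eq: "{h. (cmod (fst h))\<^sup>2 \<le> u \<and> (cmod (snd (snd h)))\<^sup>2 \<le> v} = ?S u \<times> UNIV \<times> ?S v"
    "{h. (cmod (fst (snd h)))\<^sup>2 \<le> u \<and> (cmod (snd (snd h)))\<^sup>2 \<le> v} = UNIV \<times> ?S u \<times> ?S v"
    "{h. (cmod (fst h))\<^sup>2 \<le> u} = ?S u \<times> UNIV \<times> UNIV"
    "{h. (cmod (fst (snd h)))\<^sup>2 \<le> u} = UNIV \<times> ?S u \<times> UNIV"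
    "{h. (cmod (snd (snd h)))\<^sup>2 \<le> u} = UNIV \<times> UNIV \<times> ?S u"
    by (auto simp: set_eq_iff)
  show "measure gains {h. (cmod (fst h))\<^sup>2 \<le> u \<and> (cmod (snd (snd h)))\<^sup>2 \<le> v} \<le> u * v"
    "measure gains {h. (cmod (fst (snd h)))\<^sup>2 \<le> u \<and> (cmod (snd (snd h)))\<^sup>2 \<le> v} \<le> u * v"
    "measure gains {h. (cmod (fst h))\<^sup>2 \<le> u} \<le> u"
    "measure gains {h. (cmod (fst (snd h)))\<^sup>2 \<le> u} \<le> u"
    "measure gains {h. (cmod (snd (snd h)))\<^sup>2 \<le> u} \<le> u"
    unfolding eq using assms by (simp_all add: measure_gains_Times mult_mono complex_normal_small_le del: UNIV_Times_UNIV)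
qed

lemma measurable_gains_components [measurable]:
  "fst \<in> gains \<rightarrow>\<^sub>M borel" "(\<lambda>h. fst (snd h)) \<in> gains \<rightarrow>\<^sub>M borel" "(\<lambda>h. snd (snd h)) \<in> gains \<rightarrow>\<^sub>M borel"
  by (simp_all cong: measurable_cong_sets)

lemma sets_outage_set: "outage_set a b c \<rho> L \<in> sets gains"
proof -
  have "{h \<in> space gains. (cmod (snd (snd h)))\<^sup>2 * \<rho> powr c \<le> L \<and>
    ((cmod (fst h))\<^sup>2 * \<rho> powr a * ((cmod (snd (snd h)))\<^sup>2 * \<rho> powr c) \<le> L\<^sup>2 \<or>
     (cmod (fst (snd h)))\<^sup>2 * \<rho> powr b * ((cmod (snd (snd h)))\<^sup>2 * \<rho> powr c) \<le> L\<^sup>2)} \<in> sets gains"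
    by measurable
  also have "{h \<in> space gains. (cmod (snd (snd h)))\<^sup>2 * \<rho> powr c \<le> L \<and>
    ((cmod (fst h))\<^sup>2 * \<rho> powr a * ((cmod (snd (snd h)))\<^sup>2 * \<rho> powr c) \<le> L\<^sup>2 \<or>
     (cmod (fst (snd h)))\<^sup>2 * \<rho> powr b * ((cmod (snd (snd h)))\<^sup>2 * \<rho> powr c) \<le> L\<^sup>2)} = outage_set a b c \<rho> L"
    by (auto simp: outage_set_def space_pair_measure)
  finally show ?thesis .
qed

text \<open>Only the direct link is used. The exponent is right when the weaker relay link cannot
  carry the rate but the direct link can.\<close>

lemma outage_prob_direct:
  assumes "0 < \<rho>" "0 \<le> L"
  shows "measure gains (outage_set a b c \<rho> L) \<le> L * \<rho> powr (- c)"
proof -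
  interpret G: prob_space gains by (rule prob_space_gains)
  have "outage_set a b c \<rho> L \<subseteq> {h. (cmod (snd (snd h)))\<^sup>2 \<le> L * \<rho> powr (- c)}"
    using assms by (auto simp: outage_set_def powr_minus field_simps)
  moreover have "{h \<in> space gains. (cmod (snd (snd h)))\<^sup>2 \<le> L * \<rho> powr (- c)} \<in> sets gains" by measurable
  ultimately have "measure gains (outage_set a b c \<rho> L) \<le> measure gains {h. (cmod (snd (snd h)))\<^sup>2 \<le> L * \<rho> powr (- c)}"
    by (intro G.finite_measure_mono) (simp_all add: space_pair_measure)
  also have "\<dots> \<le> L * \<rho> powr (- c)" using assms by (intro measure_gains_small(5)[of _ 0]) auto
  finally show ?thesis .
qed

text \<open>Each cut in outage forces a small product of two independent gains. The weaker of the
  links with \<open>a\<close> and \<open>b\<close> sets the common threshold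
  \<open>\<theta>\<close>, and the factor 2 counts the cuts.\<close>

lemma outage_prob_product:
  assumes \<rho>: "1 \<le> \<rho>" and L: "0 < L" and K: "0 < (K::nat)"
  shows "measure gains (outage_set a b c \<rho> L) \<le>
    2 * ((real K + 2) * (L\<^sup>2 * \<rho> powr (- (min a b + c))) powr (1 - 1 / real K))"
proof -
  interpret G: prob_space gains by (rule prob_space_gains)
  define \<theta> where "\<theta> = L\<^sup>2 * \<rho> powr (- (min a b + c))"
  have \<theta>: "0 < \<theta>" using \<rho> L by (simp add: \<theta>_def)
  let ?X = "\<lambda>h::gain_triple. (cmod (fst h))\<^sup>2"
  let ?Z = "\<lambda>h::gain_triple. (cmod (fst (snd h)))\<^sup>2"
  let ?Y = "\<lambda>h::gain_triple. (cmod (snd (snd h)))\<^sup>2"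
  have sp: "space gains = UNIV" by (simp add: space_pair_measure)
  have px: "G.prob {h \<in> space gains. ?X h * ?Y h \<le> \<theta>} \<le> (real K + 2) * \<theta> powr (1 - 1 / real K)"
    by (rule G.product_tail[OF _ _ _ _ _ _ _ \<theta> K]) (use measure_gains_small[OF _ order_refl] measure_gains_small(1) in \<open>simp_all add: sp\<close>)
  have pz: "G.prob {h \<in> space gains. ?Z h * ?Y h \<le> \<theta>} \<le> (real K + 2) * \<theta> powr (1 - 1 / real K)"
    by (rule G.product_tail[OF _ _ _ _ _ _ _ \<theta> K]) (use measure_gains_small[OF _ order_refl] measure_gains_small(2) in \<open>simp_all add: sp\<close>)
  have key: "x * y \<le> \<theta>" if le: "x * \<rho> powr s * (y * \<rho> powr c) \<le> L\<^sup>2" and s: "min a b \<le> s" and xy: "0 \<le> x" "0 \<le> y" for x y s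
  proof -
    have "x * \<rho> powr s * (y * \<rho> powr c) = x * y * \<rho> powr (s + c)" by (simp only: powr_add mult_ac)
    then have "x * y * \<rho> powr (s + c) \<le> L\<^sup>2" using le by (simp only:)
    moreover have "x * y \<le> q * inverse p" if "x * y * p \<le> q" "0 < p" for p q
      using that by (simp add: field_simps)
    ultimately have "x * y \<le> L\<^sup>2 * \<rho> powr (- (s + c))"
      unfolding powr_minus[of \<rho> "s + c"] using \<rho> by simp
    also have "\<dots> \<le> \<theta>" unfolding \<theta>_def using \<rho> s by (intro mult_left_mono powr_mono) auto
    finally show ?thesis .
  qed
  have sub: "outage_set a b c \<rho> L \<subseteq> {h \<in> space gains. ?X h * ?Y h \<le> \<theta>} \<union> {h \<in> space gains. ?Z h * ?Y h \<le> \<theta>}"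
    by (auto simp: outage_set_def sp intro: key)
  have "measure gains (outage_set a b c \<rho> L) \<le> G.prob ({h \<in> space gains. ?X h * ?Y h \<le> \<theta>} \<union> {h \<in> space gains. ?Z h * ?Y h \<le> \<theta>})"
    by (rule G.finite_measure_mono[OF sub]) measurable
  also have "\<dots> \<le> G.prob {h \<in> space gains. ?X h * ?Y h \<le> \<theta>} + G.prob {h \<in> space gains. ?Z h * ?Y h \<le> \<theta>}"
    by (rule measure_Un_le) measurable
  finally show ?thesis using px pz unfolding \<theta>_def[symmetric] by simp
qed

lemma hit_bound_mult_le: "hit_bound t g * (cmod g)\<^sup>2 \<le> t\<^sup>2"
proof (cases "(cmod g)\<^sup>2 \<le> t\<^sup>2")
  case True
  have "hit_bound t g * (cmod g)\<^sup>2 \<le> 1 * (cmod g)\<^sup>2" by (intro mult_right_mono hit_bound(2)) auto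
  then show ?thesis using True by simp
next
  case False
  then show ?thesis by (auto simp: hit_bound_def max_def)
qed

text \<open>Outside outage the letters \<open>i\<close> and \<open>n + i\<close> together pass with
  probability at most \<open>(t\<^sup>2 / L)\<^sup>2\<close>: through the direct link twice if it is
  strong, otherwise once through each link of the cut. Two letters share one factor, hence the 2 in
  \<open>- 2 * w\<close> and the power \<open>n\<close> for a block of length
  \<open>2 * n\<close>.\<close>

lemma confusion_bound_good:
  assumes t: "0 < t" and \<rho>: "0 < \<rho>" and L: "L = t\<^sup>2 * \<rho> powr w" and h: "(hsr, hrd, hsd) \<notin> outage_set a b c \<rho> L"
  shows "confusion_bound t n (gain \<rho> a hsr) (gain \<rho> b hrd) (gain \<rho> c hsd) \<le> ((2 * t + 1)\<^sup>2) ^ n * (2 * (\<rho> powr (- 2 * w)) ^ n)"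
proof -
  let ?gs = "gain \<rho> a hsr" and ?gr = "gain \<rho> b hrd" and ?gd = "gain \<rho> c hsd"
  have L0: "0 < L" using t \<rho> by (simp add: L)
  have tL: "t\<^sup>2 / L = \<rho> powr (- w)" using t \<rho> by (simp add: L powr_minus field_simps)
  note hp = hit_bound(1)[OF t]
  have key: "hit_bound t ?gd * min (hit_bound t g) (hit_bound t ?gd) \<le> \<rho> powr (- 2 * w)"
    if "L < (cmod ?gd)\<^sup>2 \<or> L\<^sup>2 < (cmod g)\<^sup>2 * (cmod ?gd)\<^sup>2" for g
  proof -
    have w2: "\<rho> powr (- 2 * w) = (t\<^sup>2 / L) * (t\<^sup>2 / L)" unfolding tL by (simp flip: powr_add)
    show ?thesis using that
    proof
      assume g: "L < (cmod ?gd)\<^sup>2"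
      have "hit_bound t ?gd * L \<le> hit_bound t ?gd * (cmod ?gd)\<^sup>2" using g hp[of ?gd] by (intro mult_left_mono) auto
      then have 1: "hit_bound t ?gd \<le> t\<^sup>2 / L" using hit_bound_mult_le[of t ?gd] L0 by (simp add: le_divide_eq)
      have "hit_bound t ?gd * min (hit_bound t g) (hit_bound t ?gd) \<le> (t\<^sup>2 / L) * (t\<^sup>2 / L)"
        using 1 hp[of ?gd] hp[of g] L0 by (intro mult_mono) (auto intro: min.coboundedI2 less_imp_le)
      then show ?thesis unfolding w2 .
    next
      assume g: "L\<^sup>2 < (cmod g)\<^sup>2 * (cmod ?gd)\<^sup>2"
      have p0: "0 \<le> hit_bound t ?gd * hit_bound t g" using hp[of ?gd] hp[of g] by simp
      have "hit_bound t ?gd * hit_bound t g * L\<^sup>2 \<le> hit_bound t ?gd * hit_bound t g * ((cmod g)\<^sup>2 * (cmod ?gd)\<^sup>2)"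
        using g p0 by (intro mult_left_mono) auto
      also have "\<dots> = (hit_bound t ?gd * (cmod ?gd)\<^sup>2) * (hit_bound t g * (cmod g)\<^sup>2)" by (simp only: mult_ac)
      also have "\<dots> \<le> t\<^sup>2 * t\<^sup>2" using hp[of g] by (intro mult_mono hit_bound_mult_le) auto
      finally have "hit_bound t ?gd * hit_bound t g \<le> (t\<^sup>2 / L) * (t\<^sup>2 / L)"
        using L0 by (simp add: field_simps power2_eq_square)
      moreover have "hit_bound t ?gd * min (hit_bound t g) (hit_bound t ?gd) \<le> hit_bound t ?gd * hit_bound t g"
        using hp[of ?gd] by (intro mult_left_mono) auto
      ultimately show ?thesis unfolding w2 by linarith
    qed
  qed
  have sq: "(cmod ?gd)\<^sup>2 = (cmod hsd)\<^sup>2 * \<rho> powr c" "(cmod ?gs)\<^sup>2 = (cmod hsr)\<^sup>2 * \<rho> powr a" "(cmod ?gr)\<^sup>2 = (cmod hrd)\<^sup>2 * \<rho> powr b"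
    by (rule cmod_gain_sq)+
  have 1: "hit_bound t ?gd * min (hit_bound t ?gs) (hit_bound t ?gd) \<le> \<rho> powr (- 2 * w)"
    by (rule key) (use h in \<open>auto simp: sq outage_set_def not_le\<close>)
  have 2: "hit_bound t ?gd * min (hit_bound t ?gr) (hit_bound t ?gd) \<le> \<rho> powr (- 2 * w)"
    by (rule key) (use h in \<open>auto simp: sq outage_set_def not_le\<close>)
  have "confusion_bound t n ?gs ?gr ?gd = ((2 * t + 1)\<^sup>2) ^ n *
      ((hit_bound t ?gd * min (hit_bound t ?gs) (hit_bound t ?gd)) ^ n + (hit_bound t ?gd * min (hit_bound t ?gr) (hit_bound t ?gd)) ^ n)"
    unfolding confusion_bound_def power_mult_distrib by (simp add: algebra_simps min.commute)
  also have "\<dots> \<le> ((2 * t + 1)\<^sup>2) ^ n * ((\<rho> powr (- 2 * w)) ^ n + (\<rho> powr (- 2 * w)) ^ n)"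
    using hp by (intro mult_left_mono add_mono power_mono 1 2) (auto intro!: mult_nonneg_nonneg less_imp_le)
  finally show ?thesis by simp
qed

section \<open>Optimality\<close>

text \<open>Logarithmic growth is a compromise: a confusion probability
  \<open>\<rho> powr (- \<eta> * n)\<close> falls below every power of \<open>\<rho>\<close>, while
  the number of noise letters in the union bound stays negligible.\<close>

definition qmf_len :: "real \<Rightarrow> nat" where
  "qmf_len \<rho> = nat \<lceil>ln \<rho>\<rceil>"

text \<open>The summand 1 keeps the rate away from 0 when \<open>r = 0\<close>.\<close>

definition qmf_size :: "real \<Rightarrow> real \<Rightarrow> nat" where
  "qmf_size r \<rho> = nat \<lceil>exp (2 * real (qmf_len \<rho>) * (r * ln \<rho> + 1))\<rceil>"

text \<open>The radius \<open>1 + ln \<rho>\<close> allows noise of size \<open>ln \<rho>\<close>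
  and a rounding error of 1.\<close>

abbreviation qmf_decoding :: "real \<Rightarrow> real \<Rightarrow> real \<Rightarrow> real \<Rightarrow> real \<Rightarrow> qmf_decoder" where
  "qmf_decoding a b c r \<rho> \<equiv> qmf_dec a b c \<rho> (1 + ln \<rho>) (qmf_len \<rho>) (qmf_size r \<rho>)"

abbreviation qmf_error :: "real \<Rightarrow> real \<Rightarrow> real \<Rightarrow> real \<Rightarrow> real \<Rightarrow> real" where
  "qmf_error a b c r \<rho> \<equiv> qmf_error_prob a b c \<rho> (qmf_len \<rho>) (qmf_size r \<rho>) (qmf_decoding a b c r \<rho>)"

lemma qmf_len: "1 < \<rho> \<Longrightarrow> ln \<rho> \<le> real (qmf_len \<rho>)" "1 < \<rho> \<Longrightarrow> real (qmf_len \<rho>) \<le> ln \<rho> + 1" "1 < \<rho> \<Longrightarrow> 0 < qmf_len \<rho>"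
proof -
  assume "1 < \<rho>"
  then have "0 < ln \<rho>" by simp
  then show "ln \<rho> \<le> real (qmf_len \<rho>)" "real (qmf_len \<rho>) \<le> ln \<rho> + 1" "0 < qmf_len \<rho>"
    unfolding qmf_len_def by linarith+
qed

text \<open>The exponential is at least 1, so rounding up at most doubles it; on the rate this has
  no effect in the limit.\<close>

lemma qmf_size:
  assumes "0 \<le> r" "1 < \<rho>"
  defines "x \<equiv> 2 * real (qmf_len \<rho>) * (r * ln \<rho> + 1)"
  shows "exp x \<le> real (qmf_size r \<rho>)" "real (qmf_size r \<rho>) \<le> 2 * exp x" "0 < qmf_size r \<rho>"
proof -
  have x: "0 \<le> x" using assms by (auto simp: x_def)
  have M: "qmf_size r \<rho> = nat \<lceil>exp x\<rceil>" by (simp add: qmf_size_def x_def)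
  have "1 \<le> exp x" using x by simp
  then show "exp x \<le> real (qmf_size r \<rho>)" "real (qmf_size r \<rho>) \<le> 2 * exp x" "0 < qmf_size r \<rho>"
    unfolding M by linarith+
qed

lemma qmf_multiplexing_gain:
  assumes r: "0 \<le> r"
  shows "has_multiplexing_gain (\<lambda>\<rho>. ln (real (qmf_size r \<rho>)) / real (2 * qmf_len \<rho>)) r"
proof -
  have bounds: "r * ln \<rho> + 1 \<le> ln (real (qmf_size r \<rho>)) / real (2 * qmf_len \<rho>) \<and>
      ln (real (qmf_size r \<rho>)) / real (2 * qmf_len \<rho>) \<le> r * ln \<rho> + 1 + ln 2" if \<rho>: "1 < \<rho>" for \<rho>
  proof -
    define x where "x = 2 * real (qmf_len \<rho>) * (r * ln \<rho> + 1)"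
    note s = qmf_size[OF r \<rho>, folded x_def]
    have n: "1 \<le> real (qmf_len \<rho>)" using qmf_len(3)[OF \<rho>] by simp
    have "x \<le> ln (real (qmf_size r \<rho>))" using ln_mono[OF s(1)] by simp
    moreover have "ln (real (qmf_size r \<rho>)) \<le> ln (2 * exp x)" using s by (intro ln_mono) auto
    moreover have "ln (2 * exp x) = ln 2 + x" by (subst ln_mult_pos) auto
    moreover have "1 * ln 2 \<le> 2 * real (qmf_len \<rho>) * ln (2::real)" using n by (intro mult_right_mono) auto
    ultimately have "x \<le> ln (real (qmf_size r \<rho>))" "ln (real (qmf_size r \<rho>)) \<le> x + 2 * real (qmf_len \<rho>) * ln 2"
      by linarith+
    then show ?thesis using n unfolding x_def
      by (auto simp: pos_le_divide_eq pos_divide_le_eq algebra_simps)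
  qed
  have "((\<lambda>\<rho>. ln (real (qmf_size r \<rho>)) / real (2 * qmf_len \<rho>) / ln \<rho>) \<longlongrightarrow> r) at_top"
  proof (rule tendsto_sandwich)
    show "((\<lambda>\<rho>. (r * ln \<rho> + 1) / ln \<rho>) \<longlongrightarrow> r) at_top" by real_asymp
    show "((\<lambda>\<rho>. (r * ln \<rho> + 1 + ln 2) / ln \<rho>) \<longlongrightarrow> r) at_top" by real_asymp
    show "\<forall>\<^sub>F \<rho> in at_top. (r * ln \<rho> + 1) / ln \<rho> \<le> ln (real (qmf_size r \<rho>)) / real (2 * qmf_len \<rho>) / ln \<rho>"
      using eventually_gt_at_top[of 1]
    proof eventually_elim
      case (elim \<rho>)
      then show ?case using bounds[OF elim] by (intro divide_right_mono) simp_all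
    qed
    show "\<forall>\<^sub>F \<rho> in at_top. ln (real (qmf_size r \<rho>)) / real (2 * qmf_len \<rho>) / ln \<rho> \<le> (r * ln \<rho> + 1 + ln 2) / ln \<rho>"
      using eventually_gt_at_top[of 1]
    proof eventually_elim
      case (elim \<rho>)
      then show ?case using bounds[OF elim] by (intro divide_right_mono) simp_all
    qed
  qed
  moreover have "\<forall>\<^sub>F \<rho> in at_top. 1 \<le> ln (real (qmf_size r \<rho>)) / real (2 * qmf_len \<rho>)"
    using eventually_gt_at_top[of 1]
  proof eventually_elim
    case (elim \<rho>)
    have "0 \<le> r * ln \<rho>" using r elim by simp
    then show ?case using bounds[OF elim] by linarith
  qed
  ultimately show ?thesis unfolding has_multiplexing_gain_def by (intro conjI exI[of _ 1]) simp_all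
qed

text \<open>The factor 1/3 is the share of outage among the three causes of error.
  \<open>\<epsilon> / 8\<close> is the margin of the level above the rate, and the rest of
  \<open>\<epsilon>\<close> pays for powers of \<open>ln \<rho>\<close> and for
  \<open>product_tail\<close>.\<close>

lemma outage_exponent:
  assumes cond: "min a b \<le> c \<or> (c < min a b \<and> r \<le> c)" and \<epsilon>: "0 < \<epsilon>"
  shows "\<forall>\<^sub>F \<rho> in at_top. measure gains (outage_set a b c \<rho> ((1 + ln \<rho>)\<^sup>2 * \<rho> powr (r + \<epsilon> / 8)))
    \<le> 1/3 * \<rho> powr (- (cutset_exponent a b c r - \<epsilon>))"
proof -
  interpret G: prob_space gains by (rule prob_space_gains)
  \<comment> \<open>The value \<open>min a b - r\<close>, which arises for
    \<open>c < r < min a b\<close>, is what the hypothesis excludes.\<close>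
  consider "cutset_exponent a b c r = 0" | "cutset_exponent a b c r = c - r"
    | "cutset_exponent a b c r = c + min a b - 2 * r" "0 < c + min a b - 2 * r"
    using cond unfolding cutset_exponent_def by linarith
  then show ?thesis
  proof cases
    case 1
    have "\<forall>\<^sub>F \<rho>::real in at_top. 1 \<le> 1/3 * \<rho> powr \<epsilon>" using \<epsilon> by real_asymp
    then show ?thesis
    proof eventually_elim
      case (elim \<rho>)
      show ?case unfolding 1 by (rule order_trans[OF G.prob_le_1]) (use elim in simp)
    qed
  next
    case 2
    have "\<forall>\<^sub>F \<rho>::real in at_top. (1 + ln \<rho>)\<^sup>2 \<le> 1/3 * \<rho> powr (7/8 * \<epsilon>)" using \<epsilon> by real_asymp
    then show ?thesis using eventually_gt_at_top[of 1]
    proof eventually_elim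
      case (elim \<rho>)
      have "measure gains (outage_set a b c \<rho> ((1 + ln \<rho>)\<^sup>2 * \<rho> powr (r + \<epsilon> / 8))) \<le> (1 + ln \<rho>)\<^sup>2 * \<rho> powr (r + \<epsilon> / 8) * \<rho> powr (- c)"
        using elim by (intro outage_prob_direct) auto
      also have "\<dots> \<le> 1/3 * \<rho> powr (7/8 * \<epsilon>) * \<rho> powr (r + \<epsilon> / 8) * \<rho> powr (- c)"
        using elim by (intro mult_right_mono) auto
      also have "\<dots> = 1/3 * \<rho> powr (7/8 * \<epsilon> + (r + \<epsilon> / 8) + - c)" by (simp only: powr_add mult.assoc)
      also have "7/8 * \<epsilon> + (r + \<epsilon> / 8) + - c = - (cutset_exponent a b c r - \<epsilon>)" unfolding 2 by simp
      finally show ?case .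
    qed
  next
    case 3
    define D where "D = c + min a b - 2 * r"
    have D: "0 < D" using 3 by (simp add: D_def)
    \<comment> \<open>Makes the loss \<open>D / K\<close> of \<open>product_tail\<close> at most
      \<open>\<epsilon> / 4\<close>. The squared margin of the level takes another
      \<open>\<epsilon> / 4\<close>, and \<open>\<epsilon> / 2\<close> absorbs \<open>t ^ 4\<close>
      and the constants.\<close>
    obtain K :: nat where K: "4 * D / \<epsilon> < real K" using reals_Archimedean2 by blast
    have "0 < 4 * D / \<epsilon>" using D \<epsilon> by simp
    then have K0: "0 < K" using K by (cases K) auto
    have DK: "D / real K \<le> \<epsilon> / 4" using K K0 \<epsilon> by (simp add: field_simps)
    define p where "p = 1 - 1 / real K"
    have p: "0 \<le> p" "p \<le> 1" using K0 by (auto simp: p_def)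
    have "\<forall>\<^sub>F \<rho>::real in at_top. 2 * (real K + 2) * (1 + ln \<rho>) ^ 4 \<le> 1/3 * \<rho> powr (\<epsilon> / 2)" using \<epsilon> by real_asymp
    then show ?thesis using eventually_gt_at_top[of 1]
    proof eventually_elim
      case (elim \<rho>)
      define t where "t = 1 + ln \<rho>"
      have t: "1 \<le> t" using elim by (simp add: t_def)
      have "(t\<^sup>2 * \<rho> powr (r + \<epsilon> / 8))\<^sup>2 = t ^ 4 * (\<rho> powr (r + \<epsilon> / 8) * \<rho> powr (r + \<epsilon> / 8))"
        by (simp add: power_mult_distrib power2_eq_square power4_eq_xxxx mult_ac)
      then have "(t\<^sup>2 * \<rho> powr (r + \<epsilon> / 8))\<^sup>2 * \<rho> powr (- (min a b + c)) = t ^ 4 * \<rho> powr ((r + \<epsilon> / 8) + (r + \<epsilon> / 8) + - (min a b + c))"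
        by (simp only: powr_add mult.assoc)
      also have "(r + \<epsilon> / 8) + (r + \<epsilon> / 8) + - (min a b + c) = \<epsilon> / 4 - D" by (simp add: D_def)
      finally have e1: "(t\<^sup>2 * \<rho> powr (r + \<epsilon> / 8))\<^sup>2 * \<rho> powr (- (min a b + c)) = t ^ 4 * \<rho> powr (\<epsilon> / 4 - D)" .
      have "(t ^ 4 * \<rho> powr (\<epsilon> / 4 - D)) powr p = (t ^ 4) powr p * \<rho> powr ((\<epsilon> / 4 - D) * p)"
        using t by (simp add: powr_mult powr_powr)
      also have "\<dots> \<le> t ^ 4 * \<rho> powr (\<epsilon> / 2 - D)"
      proof (intro mult_mono)
        have "(t ^ 4) powr p \<le> (t ^ 4) powr 1" using t p by (intro powr_mono) auto
        then show "(t ^ 4) powr p \<le> t ^ 4" using t by simp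
        have "(\<epsilon> / 4 - D) * p = \<epsilon> / 4 * p - D + D / real K" using K0 by (simp add: p_def field_simps)
        also have "\<dots> \<le> \<epsilon> / 4 * 1 - D + \<epsilon> / 4" using DK p \<epsilon> by (intro add_mono diff_mono mult_left_mono) auto
        finally show "\<rho> powr ((\<epsilon> / 4 - D) * p) \<le> \<rho> powr (\<epsilon> / 2 - D)" using elim by (intro powr_mono) auto
      qed (use t in auto)
      finally have e2: "(t ^ 4 * \<rho> powr (\<epsilon> / 4 - D)) powr p \<le> t ^ 4 * \<rho> powr (\<epsilon> / 2 - D)" .
      have "measure gains (outage_set a b c \<rho> (t\<^sup>2 * \<rho> powr (r + \<epsilon> / 8))) \<le>
          2 * ((real K + 2) * ((t\<^sup>2 * \<rho> powr (r + \<epsilon> / 8))\<^sup>2 * \<rho> powr (- (min a b + c))) powr (1 - 1 / real K))"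
        using elim t by (intro outage_prob_product K0) auto
      also have "\<dots> \<le> 2 * ((real K + 2) * (t ^ 4 * \<rho> powr (\<epsilon> / 2 - D)))"
        unfolding e1 p_def[symmetric] using e2 by (intro mult_left_mono) auto
      also have "\<dots> = (2 * (real K + 2) * t ^ 4) * \<rho> powr (\<epsilon> / 2 - D)" by (simp only: mult.assoc)
      also have "\<dots> \<le> (1/3 * \<rho> powr (\<epsilon> / 2)) * \<rho> powr (\<epsilon> / 2 - D)"
        using elim by (intro mult_right_mono) (auto simp: t_def)
      also have "\<dots> = 1/3 * \<rho> powr (\<epsilon> / 2 + (\<epsilon> / 2 - D))" by (simp only: powr_add mult.assoc)
      also have "\<epsilon> / 2 + (\<epsilon> / 2 - D) = - (cutset_exponent a b c r - \<epsilon>)" using 3 by (simp add: D_def)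
      finally show ?case unfolding t_def .
    qed
  qed
qed

text \<open>Noise and confusion contribute terms below every power of \<open>\<rho>\<close>, so the
  outage term alone fixes the exponent, whatever its value.\<close>

lemma qmf_achievability:
  assumes r: "0 \<le> r" and cond: "min a b \<le> c \<or> (c < min a b \<and> r \<le> c)" and \<epsilon>: "0 < \<epsilon>"
  shows "\<forall>\<^sub>F \<rho> in at_top. qmf_error a b c r \<rho>
    \<le> \<rho> powr (- (cutset_exponent a b c r - \<epsilon>))"
proof -
  define \<eta> where "\<eta> = \<epsilon> / 8"
  define \<delta> where "\<delta> = cutset_exponent a b c r - \<epsilon>"
  have \<eta>: "0 < \<eta>" using \<epsilon> by (simp add: \<eta>_def)
  \<comment> \<open>\<open>exp 2\<close> comes from the extra 1 in the rate, over two letters; the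
    square counts the relay sequences per letter. Confusion gains
    \<open>\<rho> powr (- 2 * \<eta>)\<close> per pair of letters, and one \<open>\<eta>\<close>
    pays for both.\<close>
  have ev1: "\<forall>\<^sub>F \<rho>::real in at_top. exp 2 * (2 * (1 + ln \<rho>) + 1)\<^sup>2 \<le> \<rho> powr \<eta>" using \<eta> by real_asymp
  have ev2: "\<forall>\<^sub>F \<rho>::real in at_top. 8 * (ln \<rho> + 1) * exp (- (ln \<rho>)\<^sup>2 / 2) \<le> 1/3 * \<rho> powr (- \<delta>)" by real_asymp
  have ev3: "\<forall>\<^sub>F \<rho>::real in at_top. 4 * \<rho> powr (- \<eta> * ln \<rho>) \<le> 1/3 * \<rho> powr (- \<delta>)" using \<eta> by real_asymp
  show ?thesis
    using outage_exponent[OF cond \<epsilon>] ev1 ev2 ev3 eventually_gt_at_top[of 1]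
    unfolding \<delta>_def[symmetric] \<eta>_def[symmetric]
  proof eventually_elim
    case (elim \<rho>)
    define n where "n = qmf_len \<rho>"
    define M where "M = qmf_size r \<rho>"
    define t where "t = 1 + ln \<rho>"
    \<comment> \<open>The margin \<open>\<eta>\<close> above \<open>r\<close> is what makes
      confusion outside outage unlikely.\<close>
    define L where "L = t\<^sup>2 * \<rho> powr (r + \<eta>)"
    have n: "ln \<rho> \<le> real n" "real n \<le> ln \<rho> + 1" using qmf_len elim by (auto simp: n_def)
    have t: "1 \<le> t" "0 < t" using elim by (auto simp: t_def add_pos_pos)
    have M: "real M \<le> 2 * exp (2 * real n * (r * ln \<rho> + 1))" "0 < M"
      using qmf_size[OF r] elim by (auto simp: M_def n_def)
    have Mp: "real M \<le> 2 * (exp 2 * \<rho> powr (2 * r)) ^ n"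
    proof -
      have "exp (2 * real n * (r * ln \<rho> + 1)) = exp (real n * (2 + 2 * r * ln \<rho>))" by (simp add: algebra_simps)
      also have "\<dots> = (exp 2 * \<rho> powr (2 * r)) ^ n"
        using elim by (simp add: exp_of_nat_mult exp_add powr_def)
      finally show ?thesis using M(1) by simp
    qed
    have "qmf_error_prob a b c \<rho> n M (qmf_dec a b c \<rho> t n M) \<le>
        8 * real n * exp (- (t - 1)\<^sup>2 / 2) + measure gains (outage_set a b c \<rho> L) + 4 * (\<rho> powr (- \<eta>)) ^ n"
    proof (rule qmf_error_prob_le[OF t(1) M(2) sets_outage_set])
      fix hsr hrd hsd assume h: "(hsr, hrd, hsd) \<notin> outage_set a b c \<rho> L"
      let ?N = "(2 * t + 1)\<^sup>2"
      have "real M * confusion_bound t n (gain \<rho> a hsr) (gain \<rho> b hrd) (gain \<rho> c hsd) \<le>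
          (2 * (exp 2 * \<rho> powr (2 * r)) ^ n) * (?N ^ n * (2 * (\<rho> powr (- 2 * (r + \<eta>))) ^ n))"
        by (intro mult_mono Mp confusion_bound_good[OF t(2) _ L_def h] confusion_bound_nonneg[OF t(2)]) (use elim in auto)
      also have "\<dots> = 4 * ((exp 2 * ?N) * (\<rho> powr (2 * r) * \<rho> powr (- 2 * (r + \<eta>)))) ^ n"
        by (simp only: power_mult_distrib mult_ac)
      also have "\<rho> powr (2 * r) * \<rho> powr (- 2 * (r + \<eta>)) = \<rho> powr (- \<eta>) * \<rho> powr (- \<eta>)"
        unfolding powr_add[symmetric] by (rule arg_cong[where f="\<lambda>y. \<rho> powr y"]) simp
      also have "4 * ((exp 2 * ?N) * (\<rho> powr (- \<eta>) * \<rho> powr (- \<eta>))) ^ n \<le> 4 * (\<rho> powr (- \<eta>)) ^ n"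
      proof (intro mult_left_mono power_mono)
        have "(exp 2 * ?N) * (\<rho> powr (- \<eta>) * \<rho> powr (- \<eta>)) \<le> \<rho> powr \<eta> * (\<rho> powr (- \<eta>) * \<rho> powr (- \<eta>))"
          using elim by (intro mult_right_mono) (auto simp: t_def)
        also have "\<dots> = \<rho> powr (- \<eta>)" unfolding powr_add[symmetric] by simp
        finally show "(exp 2 * ?N) * (\<rho> powr (- \<eta>) * \<rho> powr (- \<eta>)) \<le> \<rho> powr (- \<eta>)" .
      qed auto
      finally show "real M * confusion_bound t n (gain \<rho> a hsr) (gain \<rho> b hrd) (gain \<rho> c hsd) \<le> 4 * (\<rho> powr (- \<eta>)) ^ n" .
    qed auto
    also have "\<dots> \<le> 1/3 * \<rho> powr (- \<delta>) + 1/3 * \<rho> powr (- \<delta>) + 1/3 * \<rho> powr (- \<delta>)"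
    proof (intro add_mono)
      have e: "t - 1 = ln \<rho>" by (simp add: t_def)
      have "8 * real n \<le> 8 * (ln \<rho> + 1)" using n by simp
      then have "8 * real n * exp (- (ln \<rho>)\<^sup>2 / 2) \<le> 8 * (ln \<rho> + 1) * exp (- (ln \<rho>)\<^sup>2 / 2)"
        by (rule mult_right_mono) simp
      then show "8 * real n * exp (- (t - 1)\<^sup>2 / 2) \<le> 1/3 * \<rho> powr (- \<delta>)"
        unfolding e using elim(3) by (rule order_trans)
      show "measure gains (outage_set a b c \<rho> L) \<le> 1/3 * \<rho> powr (- \<delta>)" using elim by (simp add: L_def t_def)
      have "(\<rho> powr (- \<eta>)) ^ n = (\<rho> powr (- \<eta>)) powr (real n)" using elim(5) by (subst powr_realpow) auto
      also have "\<dots> = \<rho> powr (- \<eta> * real n)" by (rule powr_powr)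
      also have "\<dots> \<le> \<rho> powr (- \<eta> * ln \<rho>)" using elim(5) n \<eta> by (intro powr_mono) auto
      finally show "4 * (\<rho> powr (- \<eta>)) ^ n \<le> 1/3 * \<rho> powr (- \<delta>)" using elim(4) by linarith
    qed
    finally show ?case by (simp add: n_def M_def t_def)
  qed
qed

section \<open>Validity of QMF codes in both duplex modes\<close>

lemma sum_cmod_sq_le:
  assumes "\<And>t. t < T \<Longrightarrow> cmod (f t) \<le> 1"
  shows "(\<Sum>t<T. (cmod (f t))\<^sup>2) \<le> real T"
proof -
  have "(\<Sum>t<T. (cmod (f t))\<^sup>2) \<le> (\<Sum>t<T. 1)"
    using assms by (intro sum_mono power_le_one) auto
  then show ?thesis by simp
qed

text \<open>\<open>F\<close> is arbitrary here: the signal is measurable because the quantized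
  sequence has countably many values.\<close>

lemma measurable_qmf_signal:
  fixes n t :: nat and F :: "(nat \<Rightarrow> complex) \<Rightarrow> nat \<Rightarrow> complex"
  assumes "n \<le> t"
  shows "(\<lambda>(u, h, y). F (\<lambda>i\<in>{..<n}. quantize (y i)) (t - n)) \<in>
    (borel :: real measure) \<Otimes>\<^sub>M (borel :: complex measure) \<Otimes>\<^sub>M PiM {..<t} (\<lambda>_. borel) \<rightarrow>\<^sub>M borel"
proof -
  let ?S = "(borel :: real measure) \<Otimes>\<^sub>M (borel :: complex measure) \<Otimes>\<^sub>M PiM {..<t} (\<lambda>_. borel :: complex measure)"
  \<comment> \<open>With gain 0, \<open>relay_word\<close> quantizes its noise argument, in which
    the received sequence is put.\<close>
  have "(\<lambda>p. relay_word n 0 (snd (snd p)) (\<lambda>_. 0)) \<in> ?S \<rightarrow>\<^sub>M count_space (quantized n)"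
  proof (rule measurable_relay_word)
    show "(\<lambda>p. snd (snd p) i) \<in> borel_measurable ?S" if "i < n" for i
      by (rule measurable_compose[OF measurable_compose[OF measurable_snd measurable_snd] measurable_component_singleton])
        (use that assms in simp)
  qed auto
  from measurable_compose_countable'[OF measurable_const this countable_quantized, of "\<lambda>q. F q (t - n)" borel]
  have "(\<lambda>p. F (relay_word n 0 (snd (snd p)) (\<lambda>_. 0)) (t - n)) \<in> ?S \<rightarrow>\<^sub>M borel" by simp
  then show ?thesis by (simp add: relay_word_def split_beta')
qed

text \<open>
  A QMF relay ignores everything after the first half of the block, so that listening throughout
  does not change its signal.
\<close>

definition full_duplex_code :: "relay_code \<Rightarrow> relay_code" where
  "full_duplex_code C = C\<lparr>listens := \<lambda>u h t y. True\<rparr>"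

lemma full_duplex_code_simps [simp]:
  "block_len (full_duplex_code C) = block_len C" "num_msgs (full_duplex_code C) = num_msgs C"
  "codebook (full_duplex_code C) = codebook C" "decoder (full_duplex_code C) = decoder C"
  "listens (full_duplex_code C) = (\<lambda>u h t y. True)" "signal (full_duplex_code C) = signal C"
  by (simp_all add: full_duplex_code_def)

lemma qmf_code_valid:
  assumes n: "0 < n" and M: "0 < M" and dec: "measurable_qmf_decoder n M dec" and XF: "XF \<in> space (qmf_ensemble n M)"
    and X: "\<forall>m<M. \<forall>i<2 * n. cmod (fst XF m i) \<le> 1" and F: "\<forall>q\<in>quantized n. \<forall>i<n. cmod (snd XF q i) \<le> 1"
  defines "C \<equiv> qmf_code n M (fst XF) (snd XF) (dec XF)"
  shows "relay_channel_code Half_Duplex C" "relay_channel_code Full_Duplex (full_duplex_code C)"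
proof -
  have s: "unit_power_source C"
    unfolding unit_power_source_def C_def qmf_code_simps using X by (intro allI impI sum_cmod_sq_le) auto
  have r: "unit_power_relay C"
    unfolding unit_power_relay_def
  proof (intro allI sum_cmod_sq_le)
    fix u h y t assume "t < block_len C"
    then show "cmod (signal C u h t (restrict y {..<t})) \<le> 1"
      unfolding C_def qmf_code_simps using F
      by (auto intro!: F[rule_format])
  qed
  have sig: "(\<lambda>(u, h, y). signal C u h t y) \<in> borel \<Otimes>\<^sub>M borel \<Otimes>\<^sub>M PiM {..<t} (\<lambda>_. borel) \<rightarrow>\<^sub>M borel" for t
    by (cases "t < n") (use measurable_qmf_signal[of n t "snd XF"] in \<open>simp_all add: C_def\<close>)
  have D: "(\<lambda>(h, y). decoder C h y) \<in> borel \<Otimes>\<^sub>M PiM {..<block_len C} (\<lambda>_. borel) \<rightarrow>\<^sub>M count_space UNIV"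
  proof -
    have "Pair XF \<in> borel \<Otimes>\<^sub>M PiM {..<2 * n} (\<lambda>_. borel :: complex measure) \<rightarrow>\<^sub>M
        qmf_ensemble n M \<Otimes>\<^sub>M (borel :: gain_triple measure) \<Otimes>\<^sub>M PiM {..<2 * n} (\<lambda>_. borel)"
      using XF by (rule measurable_Pair1')
    from measurable_compose[OF this dec[unfolded measurable_qmf_decoder_def]]
    show ?thesis by (simp add: C_def split_beta')
  qed
  have L: "(\<lambda>(u, h, y). listens C u h t y) \<in> borel \<Otimes>\<^sub>M borel \<Otimes>\<^sub>M PiM {..<t} (\<lambda>_. borel) \<rightarrow>\<^sub>M count_space UNIV" for t
    by (simp add: C_def)
  have C: "0 < block_len C" "0 < num_msgs C" "obeys_duplex Half_Duplex C"
    using n M by (simp_all add: C_def)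
  have "measurable_code C" "measurable_code (full_duplex_code C)"
    unfolding measurable_code_def using L sig D by (simp_all only: full_duplex_code_simps) auto
  then show "relay_channel_code Half_Duplex C" "relay_channel_code Full_Duplex (full_duplex_code C)"
    using C s r unfolding relay_channel_code_def unit_power_source_def unit_power_relay_def by simp_all
qed

lemma AE_qmf_code_valid:
  assumes "0 < n" "0 < M" "measurable_qmf_decoder n M dec"
  shows "AE XF in qmf_ensemble n M.
    relay_channel_code Half_Duplex (qmf_code n M (fst XF) (snd XF) (dec XF)) \<and>
    relay_channel_code Full_Duplex (full_duplex_code (qmf_code n M (fst XF) (snd XF) (dec XF)))"
  using AE_qmf_ensemble[of M n]
  by (rule AE_mp) (intro AE_I2 impI, use qmf_code_valid[OF assms] in blast)

lemma error_prob_full_duplex_code: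
  "error_prob a b c \<rho> (full_duplex_code (qmf_code n M X F dec)) = error_prob a b c \<rho> (qmf_code n M X F dec)"
proof -
  have "(\<lambda>i\<in>{..<n}. quantize (relay_received a \<rho> (full_duplex_code (qmf_code n M X F dec)) m u hsr zr t i)) =
      (\<lambda>i\<in>{..<n}. quantize (relay_received a \<rho> (qmf_code n M X F dec) m u hsr zr t i))" if "n \<le> t" for m u hsr zr t
    using that by (intro restrict_ext) (simp add: relay_received_listening[where n=n])
  then have "dest_received a b c \<rho> (full_duplex_code (qmf_code n M X F dec)) m u h zr zd =
      dest_received a b c \<rho> (qmf_code n M X F dec) m u h zr zd" for m u h zr zd
    unfolding dest_received_def by (cases h) (auto intro!: restrict_ext)
  then show ?thesis by (simp add: error_prob_def)
qed

lemma rate_qmf_code: "rate (qmf_code n M X F dec) = ln (real M) / real (2 * n)"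
  "rate (full_duplex_code C) = rate C"
  by (simp_all add: rate_def)

text \<open>The gain is a limit, so an upper bound on the error does not suffice. The lower bound
  also keeps \<open>P\<close> away from 0, where \<open>log_prob\<close> would be infinite; its
  constant \<open>K\<close> disappears on the logarithmic scale.\<close>

lemma diversity_gainI:
  assumes up: "\<And>\<epsilon>. 0 < \<epsilon> \<Longrightarrow> \<forall>\<^sub>F \<rho> in at_top. P \<rho> \<le> \<rho> powr (- (d - \<epsilon>))"
    and low: "\<And>\<epsilon>. 0 < \<epsilon> \<Longrightarrow> \<exists>K>0. \<forall>\<^sub>F \<rho> in at_top. K * \<rho> powr (- (d + \<epsilon>)) \<le> P \<rho>"
  shows "has_diversity_gain P (ereal d)"
proof -
  have "((\<lambda>\<rho>. ln (P \<rho>) / ln \<rho>) \<longlongrightarrow> - d) at_top"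
  proof (rule tendstoI)
    fix e :: real assume e: "0 < e"
    obtain K where K: "0 < K" and l: "\<forall>\<^sub>F \<rho> in at_top. K * \<rho> powr (- (d + e / 3)) \<le> P \<rho>"
      using low[of "e / 3"] e by auto
    have k: "\<forall>\<^sub>F \<rho>::real in at_top. - (e / 3) \<le> ln K / ln \<rho>"
    proof -
      have "((\<lambda>\<rho>::real. ln K / ln \<rho>) \<longlongrightarrow> 0) at_top" by real_asymp
      then have "\<forall>\<^sub>F \<rho>::real in at_top. - (e / 3) < ln K / ln \<rho>" using e by (intro order_tendstoD) auto
      then show ?thesis by eventually_elim simp
    qed
    have u: "\<forall>\<^sub>F \<rho> in at_top. P \<rho> \<le> \<rho> powr (- (d - e / 3))" using up[of "e / 3"] e by simp
    show "\<forall>\<^sub>F \<rho> in at_top. dist (ln (P \<rho>) / ln \<rho>) (- d) < e"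
      using l k u eventually_gt_at_top[of 1]
    proof eventually_elim
      case (elim \<rho>)
      have l0: "0 < ln \<rho>" using elim by simp
      have p0: "0 < K * \<rho> powr (- (d + e / 3))" using K elim by simp
      then have P0: "0 < P \<rho>" using elim(1) by linarith
      have "ln (P \<rho>) \<le> ln (\<rho> powr (- (d - e / 3)))" using elim(3) P0 by (intro ln_mono)
      then have 1: "ln (P \<rho>) / ln \<rho> \<le> - (d - e / 3)" using l0 elim by (simp add: ln_powr divide_le_eq)
      have "ln (K * \<rho> powr (- (d + e / 3))) \<le> ln (P \<rho>)" using elim(1) p0 by (intro ln_mono)
      moreover have "ln (K * \<rho> powr (- (d + e / 3))) = ln K + - (d + e / 3) * ln \<rho>"
        using K elim by (simp add: ln_mult_pos ln_powr)
      ultimately have "(ln K + - (d + e / 3) * ln \<rho>) / ln \<rho> \<le> ln (P \<rho>) / ln \<rho>" using l0 by (intro divide_right_mono) auto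
      then have "ln K / ln \<rho> + - (d + e / 3) \<le> ln (P \<rho>) / ln \<rho>" using l0 by (simp add: add_divide_distrib)
      then have 2: "- d - 2 * (e / 3) \<le> ln (P \<rho>) / ln \<rho>" using elim(2) by linarith
      show ?case using 1 2 e by (simp add: dist_real_def abs_less_iff)
    qed
  qed
  then have "((\<lambda>\<rho>. ereal (ln (P \<rho>) / ln \<rho>)) \<longlongrightarrow> ereal (- d)) at_top" by simp
  moreover have "\<forall>\<^sub>F \<rho> in at_top. log_prob (P \<rho>) / ereal (ln \<rho>) = ereal (ln (P \<rho>) / ln \<rho>)"
  proof -
    obtain K where K: "0 < K" and l: "\<forall>\<^sub>F \<rho> in at_top. K * \<rho> powr (- (d + 1)) \<le> P \<rho>"
      using low[of 1] by auto
    show ?thesis using l eventually_gt_at_top[of 1]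
    proof eventually_elim
      case (elim \<rho>)
      have "0 < K * \<rho> powr (- (d + 1))" using K elim by simp
      then have "P \<rho> \<noteq> 0" using elim(1) by linarith
      then show ?case using elim by (simp add: log_prob_def)
    qed
  qed
  ultimately show ?thesis unfolding has_diversity_gain_def by (simp add: tendsto_cong)
qed

text \<open>The lower bound excludes error probability 0, and with it an infinite
  \<open>d'\<close>.\<close>

lemma diversity_gain_le:
  assumes d': "has_diversity_gain P d'"
    and low: "\<And>\<epsilon>. 0 < \<epsilon> \<Longrightarrow> \<exists>K>0. \<forall>\<^sub>F \<rho> in at_top. K * \<rho> powr (- (d + \<epsilon>)) \<le> P \<rho>"
  shows "d' \<le> ereal d"
proof (rule ereal_le_epsilon2)
  fix \<epsilon> :: real assume \<epsilon>: "0 < \<epsilon>"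
  obtain K where K: "0 < K" and l: "\<forall>\<^sub>F \<rho> in at_top. K * \<rho> powr (- (d + \<epsilon>)) \<le> P \<rho>"
    using low[OF \<epsilon>] by auto
  have "((\<lambda>\<rho>. ln K / ln \<rho> + - (d + \<epsilon>)) \<longlongrightarrow> - (d + \<epsilon>)) at_top" by real_asymp
  then have lim: "((\<lambda>\<rho>. ereal (ln K / ln \<rho> + - (d + \<epsilon>))) \<longlongrightarrow> ereal (- (d + \<epsilon>))) at_top" by simp
  have "ereal (- (d + \<epsilon>)) \<le> - d'"
  proof (rule tendsto_le[OF _ d'[unfolded has_diversity_gain_def] lim])
    show "\<forall>\<^sub>F \<rho> in at_top. ereal (ln K / ln \<rho> + - (d + \<epsilon>)) \<le> log_prob (P \<rho>) / ereal (ln \<rho>)"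
      using l eventually_gt_at_top[of 1]
    proof eventually_elim
      case (elim \<rho>)
      have l0: "0 < ln \<rho>" using elim by simp
      have p0: "0 < K * \<rho> powr (- (d + \<epsilon>))" using K elim by simp
      have "ln (K * \<rho> powr (- (d + \<epsilon>))) \<le> ln (P \<rho>)" using elim(1) p0 by (intro ln_mono)
      moreover have "ln (K * \<rho> powr (- (d + \<epsilon>))) = ln K + - (d + \<epsilon>) * ln \<rho>"
        using K elim by (simp add: ln_mult_pos ln_powr)
      ultimately have "(ln K + - (d + \<epsilon>) * ln \<rho>) / ln \<rho> \<le> ln (P \<rho>) / ln \<rho>" using l0 by (intro divide_right_mono) auto
      then have "ln K / ln \<rho> + - (d + \<epsilon>) \<le> ln (P \<rho>) / ln \<rho>" using l0 by (simp add: add_divide_distrib)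
      then show ?case using p0 elim(1) l0 by (simp add: log_prob_def)
    qed
  qed simp
  then have "- (- d') \<le> - ereal (- (d + \<epsilon>))" by (simp only: ereal_minus_le_minus)
  then show "d' \<le> ereal d + ereal \<epsilon>" by (simp add: add.commute)
qed

text \<open>The random coding argument: some codebook satisfies the power constraints and is no
  worse than average. Both at once, because \<open>f\<close> cannot exceed its mean almost
  everywhere.\<close>

lemma (in prob_space) exists_le_expectation:
  assumes "integrable M f" "AE x in M. P x"
  shows "\<exists>x\<in>space M. P x \<and> f x \<le> (expectation f :: real)"
proof (rule ccontr)
  assume "\<not> ?thesis"
  then have n: "expectation f < f x" if "x \<in> space M" "P x" for x using that by force
  have "AE x in M. expectation f < f x"
    using assms(2) by (rule AE_mp) (intro AE_I2 impI n)
  then have "(\<integral>x. expectation f \<partial>M) < expectation f"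
    using assms(1) by (intro integral_less_AE_space) (auto simp: emeasure_space_1)
  then show False by (simp add: prob_space)
qed

section \<open>Existence of optimal codes, and the value of the tradeoff\<close>

abbreviation qmf_scheme ::
  "real \<Rightarrow> real \<Rightarrow> real \<Rightarrow> real \<Rightarrow> real \<Rightarrow>
    (nat \<Rightarrow> nat \<Rightarrow> complex) \<times> ((nat \<Rightarrow> complex) \<Rightarrow> nat \<Rightarrow> complex) \<Rightarrow> relay_code"
where
  "qmf_scheme a b c r \<rho> XF \<equiv> qmf_code (qmf_len \<rho>) (qmf_size r \<rho>) (fst XF) (snd XF) (qmf_decoding a b c r \<rho> XF)"

lemma qmf_parameters:
  "0 \<le> r \<Longrightarrow> \<forall>\<^sub>F \<rho> in at_top. 0 < qmf_len \<rho> \<and> 0 < qmf_size r \<rho>"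
  using eventually_gt_at_top[of 1] by eventually_elim (simp add: qmf_len qmf_size)

text \<open>Almost every codebook gives a valid code of the same rate. The converse is uniform in
  the code, so it passes to the average.\<close>

lemma qmf_converse:
  assumes r: "0 \<le> r" and \<epsilon>: "0 < \<epsilon>"
  shows "\<exists>K>0. \<forall>\<^sub>F \<rho> in at_top.
    K * \<rho> powr (- (cutset_exponent a b c r + \<epsilon>)) \<le> qmf_error a b c r \<rho>"
proof -
  obtain K where K: "0 < K" and ev: "\<forall>\<^sub>F \<rho> in at_top. \<forall>D C. relay_channel_code D C \<and>
      rate C = ln (real (qmf_size r \<rho>)) / real (2 * qmf_len \<rho>) \<longrightarrow>
    K * \<rho> powr (- (cutset_exponent a b c r + \<epsilon>)) \<le> error_prob a b c \<rho> C"
    using converse[OF r qmf_multiplexing_gain[OF r] \<epsilon>] by blast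
  have "\<forall>\<^sub>F \<rho> in at_top.
    K * \<rho> powr (- (cutset_exponent a b c r + \<epsilon>)) \<le> qmf_error a b c r \<rho>"
    using ev qmf_parameters[OF r]
  proof eventually_elim
    case (elim \<rho>)
    let ?Q = "qmf_ensemble (qmf_len \<rho>) (qmf_size r \<rho>)"
    interpret Q: prob_space ?Q by (rule prob_space_qmf_ensemble)
    have "AE XF in ?Q. K * \<rho> powr (- (cutset_exponent a b c r + \<epsilon>)) \<le>
        error_prob a b c \<rho> (qmf_scheme a b c r \<rho> XF)"
      using AE_qmf_code_valid[OF conjunct1[OF elim(2)] conjunct2[OF elim(2)] measurable_qmf_dec]
    proof (rule AE_mp, intro AE_I2 impI)
      fix XF assume "relay_channel_code Half_Duplex (qmf_scheme a b c r \<rho> XF) \<and>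
        relay_channel_code Full_Duplex (full_duplex_code (qmf_scheme a b c r \<rho> XF))"
      then show "K * \<rho> powr (- (cutset_exponent a b c r + \<epsilon>)) \<le>
        error_prob a b c \<rho> (qmf_scheme a b c r \<rho> XF)"
        using elim(1) rate_qmf_code(1) by blast
    qed
    then show ?case
      unfolding qmf_error_prob_def by (intro Q.integral_ge_const qmf_error_prob_eq(1) measurable_qmf_dec)
  qed
  then show ?thesis using K by blast
qed

text \<open>A fixed codebook is chosen for each \<open>\<rho>\<close>. It may well be better than
  average, so that the exact limit needs the converse again.\<close>

lemma achieves_cutset_exponent:
  assumes r: "0 \<le> r" and cond: "min a b \<le> c \<or> (c < min a b \<and> r \<le> c)"
  shows "\<exists>\<C>. achieves_gains D a b c \<C> r (ereal (cutset_exponent a b c r))"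
proof -
  define tr where "tr = (case D of Half_Duplex \<Rightarrow> (\<lambda>C. C) | Full_Duplex \<Rightarrow> full_duplex_code)"
  define code where "code \<rho> XF = tr (qmf_scheme a b c r \<rho> XF)" for \<rho> XF
  have er: "error_prob a b c \<rho> (code \<rho> XF) =
      error_prob a b c \<rho> (qmf_scheme a b c r \<rho> XF)"
    and rt: "rate (code \<rho> XF) = ln (real (qmf_size r \<rho>)) / real (2 * qmf_len \<rho>)" for \<rho> XF
    by (cases D; simp add: code_def tr_def error_prob_full_duplex_code rate_qmf_code)+
  \<comment> \<open>An implication, so that a codebook can be chosen for every
    \<open>\<rho>\<close>, including small ones where the parameters may be 0.\<close>
  have "\<exists>XF. 0 < qmf_len \<rho> \<and> 0 < qmf_size r \<rho> \<longrightarrow> relay_channel_code D (code \<rho> XF) \<and>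
      error_prob a b c \<rho> (code \<rho> XF) \<le> qmf_error a b c r \<rho>" for \<rho>
  proof (cases "0 < qmf_len \<rho> \<and> 0 < qmf_size r \<rho>")
    case True
    let ?Q = "qmf_ensemble (qmf_len \<rho>) (qmf_size r \<rho>)"
    interpret Q: prob_space ?Q by (rule prob_space_qmf_ensemble)
    have "AE XF in ?Q. relay_channel_code D (code \<rho> XF)"
      using AE_qmf_code_valid[OF conjunct1[OF True] conjunct2[OF True] measurable_qmf_dec[of _ _ a b c \<rho> "1 + ln \<rho>"]]
      by (rule AE_mp) (cases D; simp add: code_def tr_def)
    from Q.exists_le_expectation[OF qmf_error_prob_eq(1)[OF measurable_qmf_dec] this]
    show ?thesis unfolding er qmf_error_prob_def by blast
  next
    case False
    then show ?thesis by blast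
  qed
  then obtain XF where XF: "\<And>\<rho>. 0 < qmf_len \<rho> \<and> 0 < qmf_size r \<rho> \<longrightarrow> relay_channel_code D (code \<rho> (XF \<rho>)) \<and>
      error_prob a b c \<rho> (code \<rho> (XF \<rho>)) \<le> qmf_error a b c r \<rho>"
    by metis
  have v: "\<forall>\<^sub>F \<rho> in at_top. relay_channel_code D (code \<rho> (XF \<rho>))"
    using qmf_parameters[OF r] by eventually_elim (use XF in blast)
  have "has_diversity_gain (\<lambda>\<rho>. error_prob a b c \<rho> (code \<rho> (XF \<rho>))) (ereal (cutset_exponent a b c r))"
  proof (rule diversity_gainI)
    fix \<epsilon> :: real assume \<epsilon>: "0 < \<epsilon>"
    show "\<forall>\<^sub>F \<rho> in at_top. error_prob a b c \<rho> (code \<rho> (XF \<rho>)) \<le> \<rho> powr (- (cutset_exponent a b c r - \<epsilon>))"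
      using qmf_achievability[OF r cond \<epsilon>] qmf_parameters[OF r]
      by eventually_elim (use XF order_trans in blast)
    obtain K where K: "0 < K" and ev: "\<forall>\<^sub>F \<rho> in at_top. \<forall>D C. relay_channel_code D C \<and>
        rate C = ln (real (qmf_size r \<rho>)) / real (2 * qmf_len \<rho>) \<longrightarrow>
      K * \<rho> powr (- (cutset_exponent a b c r + \<epsilon>)) \<le> error_prob a b c \<rho> C"
      using converse[OF r qmf_multiplexing_gain[OF r] \<epsilon>] by blast
    have "\<forall>\<^sub>F \<rho> in at_top. K * \<rho> powr (- (cutset_exponent a b c r + \<epsilon>)) \<le> error_prob a b c \<rho> (code \<rho> (XF \<rho>))"
      using ev v by eventually_elim (use rt in blast)
    then show "\<exists>K>0. \<forall>\<^sub>F \<rho> in at_top. K * \<rho> powr (- (cutset_exponent a b c r + \<epsilon>)) \<le> error_prob a b c \<rho> (code \<rho> (XF \<rho>))"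
      using K by blast
  qed
  then have "achieves_gains D a b c (\<lambda>\<rho>. code \<rho> (XF \<rho>)) r (ereal (cutset_exponent a b c r))"
    unfolding achieves_gains_def using v qmf_multiplexing_gain[OF r] by (simp add: rt)
  then show ?thesis by blast
qed

text \<open>Neither bound looks at \<open>D\<close>: the converse disregards the schedule, and
  listening during the whole block does not change the QMF signal. Hence the two duplex modes have
  the same tradeoff.\<close>

lemma dmt_eq_cutset_exponent:
  assumes r: "0 \<le> r" and cond: "min a b \<le> c \<or> (c < min a b \<and> r \<le> c)"
  shows "dmt D a b c r = ereal (cutset_exponent a b c r)"
  unfolding dmt_def
proof (rule antisym)
  show "ereal (cutset_exponent a b c r) \<le> Sup {d. \<exists>\<C>. achieves_gains D a b c \<C> r d}"
    using achieves_cutset_exponent[OF r cond] by (intro Sup_upper) simp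
  show "Sup {d. \<exists>\<C>. achieves_gains D a b c \<C> r d} \<le> ereal (cutset_exponent a b c r)"
  proof (rule Sup_least)
    fix d assume "d \<in> {d. \<exists>\<C>. achieves_gains D a b c \<C> r d}"
    then obtain \<C> where v: "\<forall>\<^sub>F \<rho> in at_top. relay_channel_code D (\<C> \<rho>)"
      and m: "has_multiplexing_gain (\<lambda>\<rho>. rate (\<C> \<rho>)) r"
      and d: "has_diversity_gain (\<lambda>\<rho>. error_prob a b c \<rho> (\<C> \<rho>)) d"
      by (auto simp: achieves_gains_def)
    show "d \<le> ereal (cutset_exponent a b c r)"
    proof (rule diversity_gain_le[OF d])
      fix \<epsilon> :: real assume \<epsilon>: "0 < \<epsilon>"
      obtain K where K: "0 < K" and ev: "\<forall>\<^sub>F \<rho> in at_top. \<forall>D C. relay_channel_code D C \<and> rate C = rate (\<C> \<rho>) \<longrightarrow>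
        K * \<rho> powr (- (cutset_exponent a b c r + \<epsilon>)) \<le> error_prob a b c \<rho> C"
        using converse[OF r m \<epsilon>] by blast
      have "\<forall>\<^sub>F \<rho> in at_top. K * \<rho> powr (- (cutset_exponent a b c r + \<epsilon>)) \<le> error_prob a b c \<rho> (\<C> \<rho>)"
        using ev v by eventually_elim blast
      then show "\<exists>K>0. \<forall>\<^sub>F \<rho> in at_top. K * \<rho> powr (- (cutset_exponent a b c r + \<epsilon>)) \<le> error_prob a b c \<rho> (\<C> \<rho>)"
        using K by blast
    qed
  qed
qed

lemma static_qmf_achieves_cutset_exponent:
  assumes r: "0 \<le> r" and cond: "min a b \<le> c \<or> (c < min a b \<and> r \<le> c)"
  shows "static_qmf_achieves a b c r (ereal (cutset_exponent a b c r))"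
proof -
  have "has_diversity_gain (\<lambda>\<rho>. qmf_error a b c r \<rho>)
      (ereal (cutset_exponent a b c r))"
    by (intro diversity_gainI qmf_achievability[OF r cond] qmf_converse[OF r])
  then show ?thesis
    unfolding static_qmf_achieves_def
    using qmf_multiplexing_gain[OF r] qmf_parameters[OF r] measurable_qmf_dec
    by (intro exI[of _ qmf_len] exI[of _ "qmf_size r"] exI[of _ "qmf_decoding a b c r"]) simp
qed

theorem corollary1:
  fixes a b c r :: real
  assumes "0 \<le> a" "0 \<le> b" "0 \<le> c" "0 \<le> r"
    and "min a b \<le> c \<or> (c < min a b \<and> r \<le> c)"
  shows "static_qmf_achieves a b c r (dmt Half_Duplex a b c r) \<and>
         static_qmf_achieves a b c r (dmt Full_Duplex a b c r)"
  using dmt_eq_cutset_exponent[OF assms(4,5)] static_qmf_achieves_cutset_exponent[OF assms(4,5)] by simp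

end
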